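(* Let $(X,\phi,\xi,\kappa,g)$ be a closed quasi-regular K-contact three-manifold, and let $$S(A):=\int_XA\wedge dA-\int_X\frac{(\kappa\wedge dA)^2}{\kappa\wedge d\kappa}$$ be the action of the shifted $U(1)$-Chern-Simons partition function. Then $S$ can be expressed as a quadratic form on the space of horizontal forms $\Omega^1(H)$ as $$S(A)=\langle A,-\star DA\rangle,$$ or equivalently as $$S(A)=\langle A,-\star_HD^1A\rangle^1_\kappa ,\qquad A\in\Omega^1(H),$$ where $D$ and $D^1$ are the second order operators $D\alpha=\kappa\wedge[\mathcal{L}_\xi+d_H\star_Hd_H]\alpha$ and $D^1=\mathcal{L}_\xi+d_H\star_Hd_H$ on $\Omega^1(H)$.
   Context: A K-contact three-manifold $(X,\phi,\xi,\kappa,g)$ is a 3-manifold with a global contact form $\kappa$, Reeb field $\xi$, contact distribution $H=\ker\kappa$, a complex structure $J$ on $H$, $\phi\in\mathrm{End}(TX)$ with $\phi|_H=J$, $\phi(\xi)=0$, and metric $g=\kappa\otimes\kappa+d\kappa(\cdot,\phi\cdot)$, such that $\mathcal{L}_\xi g=0$. It is quasi-regular if there is a positive integer $j$ such that each point has a foliated chart through which every leaf of the Reeb foliation passes at most $j$ times. $\star$ is the Hodge star of $g$, with $\star1=\kappa\wedge d\kappa$ and $\star\kappa=d\kappa$. The action $S$ appears in the shifted partition function through the factor $\exp[\frac{ik}{4\pi}S(A)]$, where $A\in\Omega^1(X)$ is a tangent vector at a flat connection to the space of $U(1)$-connections (up to a factor $2\pi i$). $S$ is invariant under the shift $A\mapsto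 A+\sigma\kappa$, $\sigma\in\Omega^0(X)$, so one may take $A\in\Omega^1(H)$. The expression $\frac{(\kappa\wedge dA)^2}{\kappa\wedge d\kappa}$ means $f^2\,\kappa\wedge d\kappa$, where $\kappa\wedge dA=f\,\kappa\wedge d\kappa$. $\Omega^l(H)=\{\alpha\in\Omega^l(X):\iota_\xi\alpha=0\}$ is the space of horizontal $l$-forms; $d_H$ is the horizontal exterior derivative, so that $d\alpha=\kappa\wedge\mathcal{L}_\xi\alpha+d_H\alpha$ for horizontal $\alpha$; and $\star_H:=-\iota_\xi\circ\star$. $\langle\alpha,\beta\rangle=\int_X\alpha\wedge\star\beta$ is the usual $L^2$ inner product on $\Omega^1(X)$ and, for $\alpha,\beta\in\Omega^l(H)$, $0\le l\le2$, $\langle\alpha,\beta\rangle^l_\kappa:=(-1)^l\int_X\kappa\wedge[\alpha\wedge\star_H\beta]$.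
   Formalization: The Hodge star on 2-forms is taken with the sign opposite to the usual one (so ⋆dκ = −κ, while ⋆1 = κ∧dκ and ⋆κ = dκ still hold); with the usual star (⋆⋆ = 1) the two displayed expressions for S(A) are negatives of each other and the claim fails. *)

theory Defs
  imports "HOL-Analysis.Analysis"
begin

section \<open>Smooth maps between Euclidean spaces\<close>

primrec Ck_on :: "nat \<Rightarrow> 'v::euclidean_space set \<Rightarrow> ('v \<Rightarrow> 'w::real_normed_vector) \<Rightarrow> bool" where
  "Ck_on 0 S f \<longleftrightarrow> continuous_on S f"
| "Ck_on (Suc k) S f \<longleftrightarrow>
     (\<forall>x\<in>S. f differentiable (at x)) \<and>
     (\<forall>v. Ck_on k S (\<lambda>x. frechet_derivative f (at x) v))"

text \<open>This is only used for open \<open>S\<close>.\<close>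

definition smooth_on :: "'v::euclidean_space set \<Rightarrow> ('v \<Rightarrow> 'w::real_normed_vector) \<Rightarrow> bool" where
  "smooth_on S f \<longleftrightarrow> (\<forall>k. Ck_on k S f)"


section \<open>Closed smooth three-manifolds\<close>

text \<open>A chart is a pair of its domain and its coordinate map; the values of the latter outside the
  domain are irrelevant.\<close>

type_synonym 'a chart = "'a set \<times> ('a \<Rightarrow> real^3)"

definition img :: "'a chart \<Rightarrow> (real^3) set" where
  "img c = snd c ` fst c"

definition param :: "'a chart \<Rightarrow> real^3 \<Rightarrow> 'a" where
  "param c = inv_into (fst c) (snd c)"

definition is_chart :: "'a topology \<Rightarrow> 'a chart \<Rightarrow> bool" where
  "is_chart X c \<longleftrightarrow> openin X (fst c) \<and> open (img c) \<and>
     homeomorphic_map (subtopology X (fst c)) (top_of_set (img c)) (snd c)"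

definition overlap :: "'a chart \<Rightarrow> 'a chart \<Rightarrow> (real^3) set" where
  "overlap c c' = snd c ` (fst c \<inter> fst c')"

definition transition :: "'a chart \<Rightarrow> 'a chart \<Rightarrow> real^3 \<Rightarrow> real^3" where
  "transition c c' = snd c' \<circ> param c"

definition compatible :: "'a chart \<Rightarrow> 'a chart \<Rightarrow> bool" where
  "compatible c c' \<longleftrightarrow>
     smooth_on (overlap c c') (transition c c') \<and> smooth_on (overlap c' c) (transition c' c)"

definition smooth_structure :: "'a topology \<Rightarrow> 'a chart set \<Rightarrow> bool" where
  "smooth_structure X \<A> \<longleftrightarrow>
     (\<forall>c\<in>\<A>. is_chart X c) \<and>
     (\<Union>c\<in>\<A>. fst c) = topspace X \<and>
     (\<forall>c\<in>\<A>. \<forall>c'\<in>\<A>. compatible c c') \<and>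
     (\<forall>c. is_chart X c \<and> (\<forall>c'\<in>\<A>. compatible c c') \<longrightarrow> c \<in> \<A>)"

definition closed_three_manifold :: "'a topology \<Rightarrow> 'a chart set \<Rightarrow> bool" where
  "closed_three_manifold X \<A> \<longleftrightarrow>
     Hausdorff_space X \<and> second_countable X \<and> compact_space X \<and> smooth_structure X \<A>"


section \<open>Vector fields, tensor fields and differential forms\<close>

text \<open>A field is the family of its coordinate representations in all charts, related by the
  transition maps: \<open>\<xi> c x\<close> is the coordinate vector at the point with coordinates \<open>x\<close> in the
  chart \<open>c\<close>, and \<open>T c x v\<close> is the value of a covariant \<open>k\<close>-tensor field on the vectors
  \<open>v 0, \<dots>, v (k - 1)\<close>. Only \<open>c \<in> \<A>\<close> and \<open>x \<in> img c\<close> are relevant.\<close>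

type_synonym 'a vfield = "'a chart \<Rightarrow> real^3 \<Rightarrow> real^3"
type_synonym 'a endo = "'a chart \<Rightarrow> real^3 \<Rightarrow> real^3 \<Rightarrow> real^3"
type_synonym 'a tensor = "'a chart \<Rightarrow> real^3 \<Rightarrow> (nat \<Rightarrow> real^3) \<Rightarrow> real"

definition vector_field :: "'a chart set \<Rightarrow> 'a vfield \<Rightarrow> bool" where
  "vector_field \<A> \<xi> \<longleftrightarrow>
     (\<forall>c\<in>\<A>. smooth_on (img c) (\<xi> c)) \<and>
     (\<forall>c\<in>\<A>. \<forall>c'\<in>\<A>. \<forall>x\<in>overlap c c'.
        \<xi> c' (transition c c' x) = frechet_derivative (transition c c') (at x) (\<xi> c x))"

definition endomorphism_field :: "'a chart set \<Rightarrow> 'a endo \<Rightarrow> bool" where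
  "endomorphism_field \<A> \<phi> \<longleftrightarrow>
     (\<forall>c\<in>\<A>. (\<forall>x\<in>img c. linear (\<phi> c x)) \<and> (\<forall>u. smooth_on (img c) (\<lambda>x. \<phi> c x u))) \<and>
     (\<forall>c\<in>\<A>. \<forall>c'\<in>\<A>. \<forall>x\<in>overlap c c'. \<forall>u.
        \<phi> c' (transition c c' x) (frechet_derivative (transition c c') (at x) u)
          = frechet_derivative (transition c c') (at x) (\<phi> c x u))"

definition multilinear :: "nat \<Rightarrow> ((nat \<Rightarrow> real^3) \<Rightarrow> real) \<Rightarrow> bool" where
  "multilinear k t \<longleftrightarrow>
     (\<forall>v w. (\<forall>i<k. v i = w i) \<longrightarrow> t v = t w) \<and>
     (\<forall>i<k. \<forall>v. linear (\<lambda>u. t (v(i := u))))"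

definition alternating :: "nat \<Rightarrow> ((nat \<Rightarrow> real^3) \<Rightarrow> real) \<Rightarrow> bool" where
  "alternating k t \<longleftrightarrow> (\<forall>v. \<forall>i<k. \<forall>j<k. i \<noteq> j \<and> v i = v j \<longrightarrow> t v = 0)"

definition tensor_field :: "'a chart set \<Rightarrow> nat \<Rightarrow> 'a tensor \<Rightarrow> bool" where
  "tensor_field \<A> k T \<longleftrightarrow>
     (\<forall>c\<in>\<A>. (\<forall>x\<in>img c. multilinear k (T c x)) \<and> (\<forall>v. smooth_on (img c) (\<lambda>x. T c x v))) \<and>
     (\<forall>c\<in>\<A>. \<forall>c'\<in>\<A>. \<forall>x\<in>overlap c c'. \<forall>v.
        T c x v = T c' (transition c c' x) (\<lambda>i. frechet_derivative (transition c c') (at x) (v i)))"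

definition diff_form :: "'a chart set \<Rightarrow> nat \<Rightarrow> 'a tensor \<Rightarrow> bool" where
  "diff_form \<A> k \<alpha> \<longleftrightarrow>
     tensor_field \<A> k \<alpha> \<and> (\<forall>c\<in>\<A>. \<forall>x\<in>img c. alternating k (\<alpha> c x))"

definition neg :: "'a tensor \<Rightarrow> 'a tensor" where
  "neg \<alpha> = (\<lambda>c x v. - \<alpha> c x v)"

definition wedge :: "nat \<Rightarrow> nat \<Rightarrow> 'a tensor \<Rightarrow> 'a tensor \<Rightarrow> 'a tensor" where
  "wedge k l \<alpha> \<beta> = (\<lambda>c x v.
     (\<Sum>p | p permutes {..<k + l}.
        of_int (sign p) * \<alpha> c x (\<lambda>i. v (p i)) * \<beta> c x (\<lambda>i. v (p (k + i))))
     / (fact k * fact l))"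

definition ext_deriv :: "nat \<Rightarrow> 'a tensor \<Rightarrow> 'a tensor" where
  "ext_deriv k \<alpha> = (\<lambda>c x v.
     \<Sum>i\<le>k. (-1) ^ i *
       frechet_derivative (\<lambda>y. \<alpha> c y (\<lambda>j. if j < i then v j else v (Suc j))) (at x) (v i))"

definition interior_prod :: "'a vfield \<Rightarrow> 'a tensor \<Rightarrow> 'a tensor" where
  "interior_prod \<xi> \<alpha> = (\<lambda>c x v. \<alpha> c x (case_nat (\<xi> c x) v))"

text \<open>This is \<open>(L\<^sub>\<xi> T)(v\<^sub>1, \<dots>, v\<^sub>k) = \<xi>(T(v\<^sub>1, \<dots>, v\<^sub>k)) - \<Sum>\<^sub>i T(v\<^sub>1, \<dots>, [\<xi>, v\<^sub>i], \<dots>, v\<^sub>k)\<close>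
  for vector fields \<open>v\<^sub>i\<close> that are constant in the chart, so that \<open>[\<xi>, v\<^sub>i] = - D\<xi>(v\<^sub>i)\<close>.\<close>

definition lie_deriv :: "nat \<Rightarrow> 'a vfield \<Rightarrow> 'a tensor \<Rightarrow> 'a tensor" where
  "lie_deriv k \<xi> T = (\<lambda>c x v.
     frechet_derivative (\<lambda>y. T c y v) (at x) (\<xi> c x)
     + (\<Sum>i<k. T c x (v(i := frechet_derivative (\<xi> c) (at x) (v i)))))"

text \<open>The coordinate frame, listed from index \<open>0\<close>.\<close>

definition frame :: "nat \<Rightarrow> real^3" where
  "frame i = axis (of_nat (Suc i)) 1"


section \<open>Integration of three-forms\<close>

definition smooth_fun :: "'a chart set \<Rightarrow> ('a \<Rightarrow> real) \<Rightarrow> bool" where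
  "smooth_fun \<A> f \<longleftrightarrow> (\<forall>c\<in>\<A>. smooth_on (img c) (f \<circ> param c))"

definition partition_of_unity ::
    "'a topology \<Rightarrow> 'a chart set \<Rightarrow> 'a chart set \<Rightarrow> ('a chart \<Rightarrow> 'a \<Rightarrow> real) \<Rightarrow> bool" where
  "partition_of_unity X \<A> C \<rho> \<longleftrightarrow>
     finite C \<and> C \<subseteq> \<A> \<and>
     (\<forall>c\<in>C. smooth_fun \<A> (\<rho> c) \<and> (\<forall>p\<in>topspace X. 0 \<le> \<rho> c p \<and> \<rho> c p \<le> 1) \<and>
        X closure_of {p \<in> topspace X. \<rho> c p \<noteq> 0} \<subseteq> fst c) \<and>
     (\<forall>p\<in>topspace X. (\<Sum>c\<in>C. \<rho> c p) = 1)"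

text \<open>Integral of \<open>\<omega>\<close> over a compact manifold oriented by the nowhere vanishing three-form \<open>\<mu>\<close>. The
  sign of \<open>\<mu>\<close> on the coordinate frame corrects charts that do not preserve orientation. For smooth
  \<open>\<omega>\<close> the value does not depend on the partition of unity that is chosen.\<close>

definition integral_over :: "'a topology \<Rightarrow> 'a chart set \<Rightarrow> 'a tensor \<Rightarrow> 'a tensor \<Rightarrow> real" where
  "integral_over X \<A> \<mu> \<omega> =
     (let (C, \<rho>) = (SOME (C, \<rho>). partition_of_unity X \<A> C \<rho>) in
      \<Sum>c\<in>C. integral (img c)
        (\<lambda>x. sgn (\<mu> c x frame) * (\<rho> c (param c x) * \<omega> c x frame)))"


section \<open>The Hodge star\<close>

definition riemannian_metric :: "'a chart set \<Rightarrow> 'a tensor \<Rightarrow> bool" where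
  "riemannian_metric \<A> g \<longleftrightarrow>
     tensor_field \<A> 2 g \<and>
     (\<forall>c\<in>\<A>. \<forall>x\<in>img c. \<forall>v. g c x v = g c x (\<lambda>i. v (1 - i)) \<and>
        (v 0 = v 1 \<and> v 0 \<noteq> 0 \<longrightarrow> g c x v > 0))"

definition gram :: "'a tensor \<Rightarrow> 'a chart \<Rightarrow> real^3 \<Rightarrow> real^3^3" where
  "gram g c x = (\<chi> a b. g c x (case_nat (axis a 1) (\<lambda>_. axis b 1)))"

definition volume_form :: "'a tensor \<Rightarrow> 'a tensor \<Rightarrow> 'a tensor" where
  "volume_form \<mu> g = (\<lambda>c x v.
     sgn (\<mu> c x frame) * sqrt (det (gram g c x)) * det (vector [v 0, v 1, v 2] :: real^3^3))"

text \<open>The Hodge star \<open>\<star>\<beta> = \<iota>(\<beta>\<^sup>#) vol\<close> on \<open>k\<close>-forms, with indices raised by \<open>g\<close>, and the sign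
  convention \<open>\<iota>(v\<^sub>1 \<and> \<dots> \<and> v\<^sub>k) = \<iota>(v\<^sub>1) \<circ> \<dots> \<circ> \<iota>(v\<^sub>k)\<close>. Thus \<open>\<alpha> \<and> \<star>\<beta> = \<langle>\<alpha>, \<beta>\<rangle> vol\<close> for \<open>0\<close>- and
  \<open>1\<close>-forms, in particular \<open>\<star>1 = \<kappa> \<and> d\<kappa>\<close> and \<open>\<star>\<kappa> = d\<kappa>\<close> on a K-contact manifold. On \<open>2\<close>-forms the
  sign is opposite to that of the convention \<open>\<alpha> \<and> \<star>\<beta> = \<langle>\<alpha>, \<beta>\<rangle> vol\<close> (for which \<open>\<star>\<star> = 1\<close>): here
  \<open>\<star>d\<kappa> = - \<kappa>\<close> and hence \<open>-\<iota>\<^sub>\<xi> \<star> d\<kappa> = 1\<close>. The choice matters: with \<open>\<star>\<star> = 1\<close> the two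
  expressions \<open>\<langle>A, -\<star>DA\<rangle>\<close> and \<open>\<langle>A, -\<star>\<^sub>H D\<^sup>1A\<rangle>\<close> are negatives of each other.\<close>

definition hodge :: "'a tensor \<Rightarrow> 'a tensor \<Rightarrow> nat \<Rightarrow> 'a tensor \<Rightarrow> 'a tensor" where
  "hodge \<mu> g k \<beta> = (\<lambda>c x w.
     (\<Sum>a \<in> {..<k} \<rightarrow>\<^sub>E (UNIV :: 3 set). \<Sum>b \<in> {..<k} \<rightarrow>\<^sub>E (UNIV :: 3 set).
        (\<Prod>r<k. matrix_inv (gram g c x) $ a r $ b r)
        * \<beta> c x (\<lambda>r. axis (a r) 1)
        * volume_form \<mu> g c x (\<lambda>r. if r < k then axis (b (k - 1 - r)) 1 else w (r - k)))
     / fact k)"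


section \<open>Quasi-regular K-contact structures\<close>

definition contact_volume :: "'a tensor \<Rightarrow> 'a tensor" where
  "contact_volume \<kappa> = wedge 1 2 \<kappa> (ext_deriv 1 \<kappa>)"

definition contact_form :: "'a chart set \<Rightarrow> 'a tensor \<Rightarrow> bool" where
  "contact_form \<A> \<kappa> \<longleftrightarrow>
     diff_form \<A> 1 \<kappa> \<and> (\<forall>c\<in>\<A>. \<forall>x\<in>img c. contact_volume \<kappa> c x frame \<noteq> 0)"

definition reeb_field :: "'a chart set \<Rightarrow> 'a tensor \<Rightarrow> 'a vfield \<Rightarrow> bool" where
  "reeb_field \<A> \<kappa> \<xi> \<longleftrightarrow>
     vector_field \<A> \<xi> \<and>
     (\<forall>c\<in>\<A>. \<forall>x\<in>img c. \<forall>v.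
        interior_prod \<xi> \<kappa> c x v = 1 \<and> interior_prod \<xi> (ext_deriv 1 \<kappa>) c x v = 0)"

definition K_contact ::
    "'a chart set \<Rightarrow> 'a endo \<Rightarrow> 'a vfield \<Rightarrow> 'a tensor \<Rightarrow> 'a tensor \<Rightarrow> bool" where
  "K_contact \<A> \<phi> \<xi> \<kappa> g \<longleftrightarrow>
     contact_form \<A> \<kappa> \<and>
     reeb_field \<A> \<kappa> \<xi> \<and>
     endomorphism_field \<A> \<phi> \<and>
     riemannian_metric \<A> g \<and>
     (\<forall>c\<in>\<A>. \<forall>x\<in>img c.
        \<phi> c x (\<xi> c x) = 0 \<and>
        (\<forall>u. \<kappa> c x (\<lambda>_. u) = 0 \<longrightarrow> \<kappa> c x (\<lambda>_. \<phi> c x u) = 0 \<and> \<phi> c x (\<phi> c x u) = - u) \<and>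
        (\<forall>v. g c x v = \<kappa> c x (\<lambda>_. v 0) * \<kappa> c x (\<lambda>_. v 1)
               + ext_deriv 1 \<kappa> c x (case_nat (v 0) (\<lambda>_. \<phi> c x (v 1)))) \<and>
        (\<forall>v. lie_deriv 2 \<xi> g c x v = 0))"

definition integral_curve ::
    "'a topology \<Rightarrow> 'a chart set \<Rightarrow> 'a vfield \<Rightarrow> real \<Rightarrow> real \<Rightarrow> (real \<Rightarrow> 'a) \<Rightarrow> bool" where
  "integral_curve X \<A> \<xi> a b \<gamma> \<longleftrightarrow>
     continuous_map (top_of_set {a..b}) X \<gamma> \<and>
     (\<forall>t\<in>{a..b}. \<forall>c\<in>\<A>. \<gamma> t \<in> fst c \<longrightarrow>
        ((\<lambda>s. snd c (\<gamma> s)) has_vector_derivative \<xi> c (snd c (\<gamma> t))) (at t within {a..b}))"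

definition leaf :: "'a topology \<Rightarrow> 'a chart set \<Rightarrow> 'a vfield \<Rightarrow> 'a \<Rightarrow> 'a set" where
  "leaf X \<A> \<xi> p =
     {q. \<exists>a b \<gamma>. integral_curve X \<A> \<xi> a b \<gamma> \<and> p \<in> \<gamma> ` {a..b} \<and> q \<in> \<gamma> ` {a..b}}"

text \<open>A foliated chart is a chart onto a box in which the field is vertical. Its plaques are the
  vertical segments of the box, identified by their first two coordinates.\<close>

definition foliated_chart :: "'a chart set \<Rightarrow> 'a vfield \<Rightarrow> 'a chart \<Rightarrow> bool" where
  "foliated_chart \<A> \<xi> c \<longleftrightarrow>
     c \<in> \<A> \<and> (\<exists>l u. img c = box l u) \<and> (\<forall>x\<in>img c. \<xi> c x $ 1 = 0 \<and> \<xi> c x $ 2 = 0)"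

definition plaques :: "'a chart \<Rightarrow> 'a set \<Rightarrow> (real \<times> real) set" where
  "plaques c L = (\<lambda>x. (x $ 1, x $ 2)) ` snd c ` (fst c \<inter> L)"

definition quasi_regular :: "'a topology \<Rightarrow> 'a chart set \<Rightarrow> 'a vfield \<Rightarrow> bool" where
  "quasi_regular X \<A> \<xi> \<longleftrightarrow>
     (\<exists>j::nat. j > 0 \<and> (\<forall>p\<in>topspace X. \<exists>c. foliated_chart \<A> \<xi> c \<and> p \<in> fst c \<and>
        (\<forall>q\<in>topspace X. finite (plaques c (leaf X \<A> \<xi> q)) \<and>
           card (plaques c (leaf X \<A> \<xi> q)) \<le> j)))"


section \<open>Horizontal forms and the operators \<open>D\<close> and \<open>D\<^sup>1\<close>\<close>

definition horizontal_form :: "'a chart set \<Rightarrow> 'a vfield \<Rightarrow> nat \<Rightarrow> 'a tensor \<Rightarrow> bool" where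
  "horizontal_form \<A> \<xi> k \<alpha> \<longleftrightarrow>
     diff_form \<A> k \<alpha> \<and> (k > 0 \<longrightarrow> (\<forall>c\<in>\<A>. \<forall>x\<in>img c. \<forall>v. interior_prod \<xi> \<alpha> c x v = 0))"

definition d_H :: "'a vfield \<Rightarrow> 'a tensor \<Rightarrow> nat \<Rightarrow> 'a tensor \<Rightarrow> 'a tensor" where
  "d_H \<xi> \<kappa> k \<alpha> = (\<lambda>c x v. ext_deriv k \<alpha> c x v - wedge 1 k \<kappa> (lie_deriv k \<xi> \<alpha>) c x v)"

definition star :: "'a tensor \<Rightarrow> 'a tensor \<Rightarrow> nat \<Rightarrow> 'a tensor \<Rightarrow> 'a tensor" where
  "star \<kappa> g k = hodge (contact_volume \<kappa>) g k"

definition star_H :: "'a vfield \<Rightarrow> 'a tensor \<Rightarrow> 'a tensor \<Rightarrow> nat \<Rightarrow> 'a tensor \<Rightarrow> 'a tensor" where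
  "star_H \<xi> \<kappa> g k \<alpha> = neg (interior_prod \<xi> (star \<kappa> g k \<alpha>))"

definition op_D1 :: "'a vfield \<Rightarrow> 'a tensor \<Rightarrow> 'a tensor \<Rightarrow> 'a tensor \<Rightarrow> 'a tensor" where
  "op_D1 \<xi> \<kappa> g \<alpha> = (\<lambda>c x v.
     lie_deriv 1 \<xi> \<alpha> c x v + d_H \<xi> \<kappa> 0 (star_H \<xi> \<kappa> g 2 (d_H \<xi> \<kappa> 1 \<alpha>)) c x v)"

definition op_D :: "'a vfield \<Rightarrow> 'a tensor \<Rightarrow> 'a tensor \<Rightarrow> 'a tensor \<Rightarrow> 'a tensor" where
  "op_D \<xi> \<kappa> g \<alpha> = wedge 1 1 \<kappa> (op_D1 \<xi> \<kappa> g \<alpha>)"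


section \<open>The action and the inner products\<close>

definition contact_integral :: "'a topology \<Rightarrow> 'a chart set \<Rightarrow> 'a tensor \<Rightarrow> 'a tensor \<Rightarrow> real" where
  "contact_integral X \<A> \<kappa> \<omega> = integral_over X \<A> (contact_volume \<kappa>) \<omega>"

text \<open>For a three-form \<open>\<omega>\<close> and a nowhere vanishing three-form \<open>\<mu>\<close>, this is \<open>\<omega>\<^sup>2/\<mu> = f\<^sup>2 \<mu>\<close> where
  \<open>\<omega> = f \<mu>\<close>.\<close>

definition square_quotient :: "'a tensor \<Rightarrow> 'a tensor \<Rightarrow> 'a tensor" where
  "square_quotient \<omega> \<mu> = (\<lambda>c x v. (\<omega> c x frame / \<mu> c x frame)\<^sup>2 * \<mu> c x v)"

definition action :: "'a topology \<Rightarrow> 'a chart set \<Rightarrow> 'a tensor \<Rightarrow> 'a tensor \<Rightarrow> real" where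
  "action X \<A> \<kappa> A =
     contact_integral X \<A> \<kappa> (wedge 1 2 A (ext_deriv 1 A))
     - contact_integral X \<A> \<kappa>
         (square_quotient (wedge 1 2 \<kappa> (ext_deriv 1 A)) (contact_volume \<kappa>))"

definition inner_L2 ::
    "'a topology \<Rightarrow> 'a chart set \<Rightarrow> 'a tensor \<Rightarrow> 'a tensor \<Rightarrow> 'a tensor \<Rightarrow> 'a tensor \<Rightarrow> real" where
  "inner_L2 X \<A> \<kappa> g \<alpha> \<beta> = contact_integral X \<A> \<kappa> (wedge 1 2 \<alpha> (star \<kappa> g 1 \<beta>))"

definition inner_contact ::
    "'a topology \<Rightarrow> 'a chart set \<Rightarrow> 'a vfield \<Rightarrow> 'a tensor \<Rightarrow> 'a tensor \<Rightarrow> nat \<Rightarrow>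
     'a tensor \<Rightarrow> 'a tensor \<Rightarrow> real" where
  "inner_contact X \<A> \<xi> \<kappa> g l \<alpha> \<beta> =
     (-1) ^ l *
     contact_integral X \<A> \<kappa> (wedge 1 2 \<kappa> (wedge l (2 - l) \<alpha> (star_H \<xi> \<kappa> g l \<beta>)))"

end

(* Pointwise, both inner products have the integrand -\<kappa> \<and> A \<and> D\<^sup>1A: on a K-contact
   manifold the Riemannian volume is \<kappa> \<and> d\<kappa>, so that \<star>\<star> = -1 on two-forms and
   \<star>\<^sub>H\<star>\<^sub>H = -1 on horizontal one-forms. Writing \<kappa> \<and> dA = F \<kappa> \<and> d\<kappa>, one has \<star>\<^sub>H d\<^sub>H A = F,
   hence D\<^sup>1A = L\<^sub>\<xi>A + d\<^sub>H F, and Cartan's formula gives A \<and> dA = -\<kappa> \<and> A \<and> L\<^sub>\<xi>A. The integrand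
   of the action therefore differs from -\<kappa> \<and> A \<and> D\<^sup>1A by d(F \<kappa> \<and> A), and the claim is Stokes'
   theorem on the closed manifold. Since the integral is defined by an arbitrary partition of
   unity, Stokes' theorem needs the existence of partitions of unity and, for the terms
   d\<rho> \<and> F \<kappa> \<and> A, a change of variables between charts. *)

theory Submission
  imports Defs "HOL-Computational_Algebra.Polynomial"
begin

section \<open>Calculus of smooth maps\<close>

text \<open>The volume identity is where the metric enters: for horizontal u the Gram matrix of the
  frame \<xi>, u, \<phi> u is diagonal with entries 1, N, N, where N = d\<kappa>(u, \<phi> u), and N
  is also the value of \<kappa> \<and> d\<kappa> on this frame. The other pointwise facts rest on
  two remarks: every two-form is the contraction of the volume with a vector, so that both stars
  become statements about that vector; and a three-form vanishes as soon as its contraction with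
  \<xi> does. The square term of the action is absorbed by the exact form: d\<kappa> \<and> A = 0
  for horizontal A, hence d(F \<kappa> \<and> A) = dF \<and> \<kappa> \<and> A - F \<kappa> \<and>
  dA, and F \<kappa> \<and> dA is F^2 \<kappa> \<and> d\<kappa>. Integration by parts in the chart c
  leaves d\<rho>(c) \<and> \<eta>, a term that vanishes in no single chart. Multiplied by 1 = sum of
  all \<rho>(c') and carried over to the charts c', these terms meet there and cancel, because the
  sum of all d\<rho>(c) is 0. Charts may be disconnected and may reverse the orientation, so a
  locally constant sign accompanies every integrand.\<close>

lemma Ck_on_Suc_imp: "Ck_on (Suc k) S f \<Longrightarrow> Ck_on k S f"
proof (induction k arbitrary: f)
  case 0
  then show ?case
    by (auto intro!: continuous_at_imp_continuous_on differentiable_imp_continuous_within)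
next
  case (Suc k)
  then show ?case by (auto simp del: Ck_on.simps(2) simp: Ck_on.simps(2)[of _ S f])
qed

lemma Ck_on_imp_continuous_on: "Ck_on k S f \<Longrightarrow> continuous_on S f"
  by (induction k) (use Ck_on_Suc_imp in auto)

text \<open>\<open>frechet_derivative f (at x)\<close> depends on \<open>f\<close> in a
  neighbourhood of \<open>x\<close> and not only on its values in \<open>S\<close>; this is why
  \<open>S\<close> has to be open.\<close>

lemma Ck_on_cong:
  assumes "open S" "\<And>x. x \<in> S \<Longrightarrow> f x = g x" "Ck_on k S f"
  shows "Ck_on k S g"
  using assms(2,3)
proof (induction k arbitrary: f g)
  case 0
  then show ?case using continuous_on_cong by force
next
  case (Suc k)
  have d: "f differentiable (at x)" if "x \<in> S" for x using Suc.prems that by auto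
  have eq: "frechet_derivative f (at x) = frechet_derivative g (at x)" if "x \<in> S" for x
    using frechet_derivative_transform_within_open[OF d[OF that] assms(1) that] Suc.prems(1) by blast
  have "g differentiable (at x)" if "x \<in> S" for x
    using d[OF that] that assms(1) Suc.prems(1)
    by (metis differentiable_def has_derivative_transform_within_open)
  moreover have "Ck_on k S (\<lambda>x. frechet_derivative g (at x) v)" for v
    by (rule Suc.IH[of "\<lambda>x. frechet_derivative f (at x) v"]) (use eq Suc.prems in auto)
  ultimately show ?case by simp
qed

lemma Ck_on_mono: "Ck_on k S f \<Longrightarrow> T \<subseteq> S \<Longrightarrow> Ck_on k T f"
  by (induction k arbitrary: f) (auto intro: continuous_on_subset)

text \<open>Every clause of \<open>Ck_on\<close> is a condition near a point. This glues functions
  given by different formulas on different open sets, such as extensions by zero.\<close>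

lemma Ck_on_local:
  assumes "\<And>x. x \<in> S \<Longrightarrow> \<exists>U. open U \<and> x \<in> U \<and> Ck_on k U f"
  shows "Ck_on k S f"
  using assms
proof (induction k arbitrary: f)
  case 0
  then show ?case
    by (metis Ck_on.simps(1) continuous_at_imp_continuous_on continuous_on_eq_continuous_at)
next
  case (Suc k)
  have "f differentiable (at x)" if "x \<in> S" for x using Suc.prems[OF that] by auto
  moreover have "Ck_on k S (\<lambda>x. frechet_derivative f (at x) v)" for v
    by (rule Suc.IH) (use Suc.prems in fastforce)
  ultimately show ?case by simp
qed

lemma Ck_on_const: "Ck_on k S (\<lambda>x. c)"
  by (induction k arbitrary: c) auto

text \<open>The recursion refers to the term \<open>frechet_derivative\<close>; uniqueness of
  derivatives lets an explicit formula \<open>f'\<close> take its place.\<close>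

lemma Ck_on_SucI:
  assumes "open S" "\<And>x. x \<in> S \<Longrightarrow> (f has_derivative f' x) (at x)" "\<And>v. Ck_on k S (\<lambda>x. f' x v)"
  shows "Ck_on (Suc k) S f"
proof -
  have eq: "f' x = frechet_derivative f (at x)" if "x \<in> S" for x
    using assms(2)[OF that] frechet_derivative_at by metis
  have "Ck_on k S (\<lambda>x. frechet_derivative f (at x) v)" for v
    by (rule Ck_on_cong[OF assms(1) _ assms(3)[of v]]) (simp add: eq)
  moreover have "f differentiable (at x)" if "x \<in> S" for x
    using assms(2)[OF that] differentiable_def by blast
  ultimately show ?thesis by simp
qed

lemma Ck_on_SucD:
  assumes "Ck_on (Suc k) S f"
  shows "x \<in> S \<Longrightarrow> (f has_derivative frechet_derivative f (at x)) (at x)"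
    and "Ck_on k S (\<lambda>x. frechet_derivative f (at x) v)"
  using assms by (auto simp flip: frechet_derivative_works)

lemma Ck_on_linear:
  assumes "open S" "bounded_linear h" "Ck_on k S f"
  shows "Ck_on k S (\<lambda>x. h (f x))"
  using assms(3)
proof (induction k arbitrary: f)
  case 0
  then show ?case using linear_continuous_on_compose assms(2)
    by (auto intro: bounded_linear.continuous_on)
next
  case (Suc k)
  show ?case
    by (rule Ck_on_SucI[OF assms(1) bounded_linear.has_derivative[OF assms(2) Ck_on_SucD(1)[OF Suc.prems]]])
       (use Suc in auto)
qed

lemma Ck_on_add:
  assumes "open S" "Ck_on k S f" "Ck_on k S g"
  shows "Ck_on k S (\<lambda>x. f x + g x)"
  using assms(2,3)
proof (induction k arbitrary: f g)
  case 0
  then show ?case by (simp add: continuous_on_add)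
next
  case (Suc k)
  show ?case
    by (rule Ck_on_SucI[OF assms(1) has_derivative_add[OF Ck_on_SucD(1)[OF Suc.prems(1)] Ck_on_SucD(1)[OF Suc.prems(2)]]])
       (use Suc in auto)
qed

lemma Ck_on_sum:
  assumes "open S" "\<And>i. i \<in> I \<Longrightarrow> Ck_on k S (f i)"
  shows "Ck_on k S (\<lambda>x. \<Sum>i\<in>I. f i x)"
  using assms(2)
  by (induction I rule: infinite_finite_induct) (auto intro: Ck_on_const Ck_on_add[OF assms(1)])

lemma Ck_on_scaleR:
  fixes f :: "'v::euclidean_space \<Rightarrow> real"
  assumes "open S" "Ck_on k S f" "Ck_on k S g"
  shows "Ck_on k S (\<lambda>x. f x *\<^sub>R g x)"
  using assms(2,3)
proof (induction k arbitrary: f g)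
  case 0
  then show ?case by (simp add: continuous_on_scaleR)
next
  case (Suc k)
  have *: "Ck_on k S (\<lambda>x. f x *\<^sub>R frechet_derivative g (at x) v + frechet_derivative f (at x) v *\<^sub>R g x)" for v
    by (rule Ck_on_add[OF assms(1) Suc.IH[OF Ck_on_Suc_imp[OF Suc.prems(1)] Ck_on_SucD(2)[OF Suc.prems(2)]]
            Suc.IH[OF Ck_on_SucD(2)[OF Suc.prems(1)] Ck_on_Suc_imp[OF Suc.prems(2)]]])
  show ?case
    by (rule Ck_on_SucI[OF assms(1) has_derivative_scaleR[OF Ck_on_SucD(1)[OF Suc.prems(1)] Ck_on_SucD(1)[OF Suc.prems(2)]] *])
qed

lemma Ck_on_compose:
  fixes f :: "'v::euclidean_space \<Rightarrow> 'u::euclidean_space" and g :: "'u \<Rightarrow> 'w::real_normed_vector"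
  assumes "open S" "open T" "f ` S \<subseteq> T" "Ck_on k S f" "Ck_on k T g"
  shows "Ck_on k S (\<lambda>x. g (f x))"
  using assms(4,5)
proof (induction k arbitrary: g)
  case 0
  then show ?case using assms(3) by (auto intro: continuous_on_compose2)
next
  case (Suc k)
  let ?Dg = "\<lambda>x. frechet_derivative g (at (f x))" and ?Df = "\<lambda>x. frechet_derivative f (at x)"
  have D: "((\<lambda>x. g (f x)) has_derivative (\<lambda>v. ?Dg x (?Df x v))) (at x)" if "x \<in> S" for x
    using diff_chain_at[OF Ck_on_SucD(1)[OF Suc.prems(1) that] Ck_on_SucD(1)[OF Suc.prems(2)], of]
      that assms(3) by (auto simp: o_def image_subset_iff)
  have lin: "linear (?Dg x)" if "x \<in> S" for x
    by (rule linear_frechet_derivative) (use Suc.prems(2) that assms(3) in auto)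
  \<comment> \<open>The direction \<open>?Df x v\<close> varies with \<open>x\<close>, whereas
    \<open>Ck_on\<close> for \<open>g\<close> speaks of fixed directions only. Expanding it over the
    basis leaves products of coefficients with derivatives in fixed directions.\<close>
  have *: "Ck_on k S (\<lambda>x. \<Sum>b\<in>Basis. (?Df x v \<bullet> b) *\<^sub>R ?Dg x b)" for v
    by (rule Ck_on_sum[OF assms(1) Ck_on_scaleR[OF assms(1)
            Ck_on_linear[OF assms(1) bounded_linear_inner_left Ck_on_SucD(2)[OF Suc.prems(1)]]
            Suc.IH[OF Ck_on_Suc_imp[OF Suc.prems(1)] Ck_on_SucD(2)[OF Suc.prems(2)]]]])
  have eq: "(\<Sum>b\<in>Basis. (?Df x v \<bullet> b) *\<^sub>R ?Dg x b) = ?Dg x (?Df x v)" if "x \<in> S" for x v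
  proof -
    have "(\<Sum>b\<in>Basis. (?Df x v \<bullet> b) *\<^sub>R ?Dg x b) = ?Dg x (\<Sum>b\<in>Basis. (?Df x v \<bullet> b) *\<^sub>R b)"
      by (simp only: linear_sum[OF lin[OF that]] linear_cmul[OF lin[OF that]])
    then show ?thesis by (simp only: euclidean_representation)
  qed
  have **: "Ck_on k S (\<lambda>x. ?Dg x (?Df x v))" for v
    by (rule Ck_on_cong[OF assms(1) _ *[of v]]) (simp add: eq)
  show ?case by (rule Ck_on_SucI[OF assms(1) D **])
qed

text \<open>The derivative of 1/f is -(1/f) f' (1/f), so level k for 1/f itself yields level k +
  1.\<close>

lemma Ck_on_inverse:
  fixes f :: "'v::euclidean_space \<Rightarrow> real"
  assumes "open S" "Ck_on k S f" "\<And>x. x \<in> S \<Longrightarrow> f x \<noteq> 0"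
  shows "Ck_on k S (\<lambda>x. inverse (f x))"
  using assms(2)
proof (induction k)
  case 0
  then show ?case using assms(3) by (simp add: continuous_on_inverse)
next
  case (Suc k)
  have "Ck_on k S (\<lambda>x. (-1) *\<^sub>R inverse (f x) *\<^sub>R frechet_derivative f (at x) v *\<^sub>R inverse (f x))" for v
    by (rule Ck_on_scaleR[OF assms(1) Ck_on_const Ck_on_scaleR[OF assms(1) Suc.IH[OF Ck_on_Suc_imp[OF Suc.prems]]
            Ck_on_scaleR[OF assms(1) Ck_on_SucD(2)[OF Suc.prems] Suc.IH[OF Ck_on_Suc_imp[OF Suc.prems]]]]])
  then show ?case
    by (intro Ck_on_SucI[OF assms(1) Deriv.has_derivative_inverse[OF _ Ck_on_SucD(1)[OF Suc.prems]]])
       (auto simp: assms(3) mult.assoc)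
qed

text \<open>Smoothness as a fixed point of differentiation, free of the index k. In the converse
  direction the right side gives level k + 1 for each k, from which level k is recovered.\<close>

lemma smooth_on_iff:
  "smooth_on S f \<longleftrightarrow>
     (\<forall>x\<in>S. f differentiable (at x)) \<and> (\<forall>v. smooth_on S (\<lambda>x. frechet_derivative f (at x) v))"
  (is "?l \<longleftrightarrow> ?r")
proof
  assume ?l then show ?r unfolding smooth_on_def using Ck_on.simps(2) by blast
next
  assume r: ?r
  show ?l unfolding smooth_on_def
  proof
    fix k show "Ck_on k S f"
      using r Ck_on_Suc_imp[of k S f] by (auto simp: smooth_on_def)
  qed
qed

lemma
  assumes "smooth_on S f"
  shows smooth_on_imp_continuous_on: "continuous_on S f"
    and smooth_on_has_derivative: "x \<in> S \<Longrightarrow> (f has_derivative frechet_derivative f (at x)) (at x)"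
    and smooth_on_differentiable: "x \<in> S \<Longrightarrow> f differentiable (at x)"
    and smooth_on_derivative: "smooth_on S (\<lambda>x. frechet_derivative f (at x) v)"
proof -
  show "continuous_on S f" using assms Ck_on_imp_continuous_on unfolding smooth_on_def by blast
  note * = assms[unfolded smooth_on_iff[of S f]]
  show "f differentiable (at x)" if "x \<in> S" using * that by blast
  then show "(f has_derivative frechet_derivative f (at x)) (at x)" if "x \<in> S"
    using that frechet_derivative_works by blast
  show "smooth_on S (\<lambda>x. frechet_derivative f (at x) v)" using * by blast
qed

lemma smooth_on_cong: "open S \<Longrightarrow> (\<And>x. x \<in> S \<Longrightarrow> f x = g x) \<Longrightarrow> smooth_on S f \<Longrightarrow> smooth_on S g"
  using Ck_on_cong[of S f g] by (simp add: smooth_on_def)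

lemma smooth_on_subset: "smooth_on S f \<Longrightarrow> T \<subseteq> S \<Longrightarrow> smooth_on T f"
  using Ck_on_mono[of _ S f T] by (simp add: smooth_on_def)

lemma smooth_on_local:
  "(\<And>x. x \<in> S \<Longrightarrow> \<exists>U. open U \<and> x \<in> U \<and> smooth_on U f) \<Longrightarrow> smooth_on S f"
  unfolding smooth_on_def using Ck_on_local by metis

lemma smooth_on_const: "smooth_on S (\<lambda>x. c)"
  by (simp add: smooth_on_def Ck_on_const)

lemma smooth_on_linear: "open S \<Longrightarrow> bounded_linear h \<Longrightarrow> smooth_on S f \<Longrightarrow> smooth_on S (\<lambda>x. h (f x))"
  by (simp add: smooth_on_def Ck_on_linear)

lemma smooth_on_add: "open S \<Longrightarrow> smooth_on S f \<Longrightarrow> smooth_on S g \<Longrightarrow> smooth_on S (\<lambda>x. f x + g x)"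
  by (simp add: smooth_on_def Ck_on_add)

lemma smooth_on_sum:
  "open S \<Longrightarrow> (\<And>i. i \<in> I \<Longrightarrow> smooth_on S (f i)) \<Longrightarrow> smooth_on S (\<lambda>x. \<Sum>i\<in>I. f i x)"
  by (simp add: smooth_on_def Ck_on_sum)

lemma smooth_on_scaleR:
  fixes f :: "'v::euclidean_space \<Rightarrow> real"
  shows "open S \<Longrightarrow> smooth_on S f \<Longrightarrow> smooth_on S g \<Longrightarrow> smooth_on S (\<lambda>x. f x *\<^sub>R g x)"
  by (simp add: smooth_on_def Ck_on_scaleR)

lemma smooth_on_mult:
  fixes f g :: "'v::euclidean_space \<Rightarrow> real"
  shows "open S \<Longrightarrow> smooth_on S f \<Longrightarrow> smooth_on S g \<Longrightarrow> smooth_on S (\<lambda>x. f x * g x)"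
  using smooth_on_scaleR[of S f g] by simp

lemma smooth_on_diff:
  assumes "open S" "smooth_on S f" "smooth_on S g"
  shows "smooth_on S (\<lambda>x. f x - g x)"
  using smooth_on_add[OF assms(1,2) smooth_on_linear[OF assms(1) bounded_linear_minus[OF bounded_linear_ident] assms(3)]]
  by simp

lemma smooth_on_compose:
  fixes f :: "'v::euclidean_space \<Rightarrow> 'u::euclidean_space"
  shows "open S \<Longrightarrow> open T \<Longrightarrow> f ` S \<subseteq> T \<Longrightarrow> smooth_on S f \<Longrightarrow> smooth_on T g \<Longrightarrow> smooth_on S (\<lambda>x. g (f x))"
  using Ck_on_compose[of S T f _ g] by (simp add: smooth_on_def)

lemma smooth_on_divide:
  fixes f g :: "'v::euclidean_space \<Rightarrow> real"
  assumes "open S" "smooth_on S f" "smooth_on S g" "\<And>x. x \<in> S \<Longrightarrow> g x \<noteq> 0"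
  shows "smooth_on S (\<lambda>x. f x / g x)"
proof -
  have "smooth_on S (\<lambda>x. inverse (g x))"
    using assms(3,4) unfolding smooth_on_def by (auto intro: Ck_on_inverse[OF assms(1)])
  from smooth_on_mult[OF assms(1,2) this] show ?thesis by (simp add: divide_inverse)
qed

section \<open>Restriction to lines and symmetry of second derivatives\<close>

lemma DERIV_along_line:
  fixes f :: "'v::real_normed_vector \<Rightarrow> real"
  assumes "(f has_derivative f') (at (p + s *\<^sub>R u))"
  shows "((\<lambda>s. f (p + s *\<^sub>R u)) has_real_derivative f' u) (at s)"
proof -
  have g: "((\<lambda>s. p + s *\<^sub>R u) has_derivative (\<lambda>h. h *\<^sub>R u)) (at s)"
    by (auto intro!: derivative_eq_intros)
  have "linear f'" using assms has_derivative_linear by blast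
  with diff_chain_at[OF g assms] show ?thesis
    by (simp add: o_def has_field_derivative_def linear_cmul mult.commute[of _ "f' u"] del: add_0)
qed

text \<open>The second difference is \<phi>(h) - \<phi>(0) for \<phi>(s) = f(x + hv + su) - f(x +
  su). The mean value theorem in the direction u, followed by the one in the direction v, turns it
  into h^2 times a mixed second derivative at a point of the parallelogram spanned by hu and
  hv.\<close>

lemma second_difference_mean_value:
  fixes f :: "'v::euclidean_space \<Rightarrow> real"
  assumes f: "smooth_on (ball x r) f" and h: "0 < h" "h * (norm u + norm v) < r"
  shows "\<exists>y. dist x y \<le> h * (norm u + norm v) \<and>
    f (x + h *\<^sub>R u + h *\<^sub>R v) - f (x + h *\<^sub>R u) - f (x + h *\<^sub>R v) + f x =
      h * (h * frechet_derivative (\<lambda>y. frechet_derivative f (at y) u) (at y) v)"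
proof -
  have dist: "dist x (x + s *\<^sub>R u + t *\<^sub>R v) \<le> h * (norm u + norm v)"
    if "0 \<le> s" "s \<le> h" "0 \<le> t" "t \<le> h" for s t
  proof -
    have "norm (s *\<^sub>R u + t *\<^sub>R v) \<le> s * norm u + t * norm v"
      using that by (intro norm_triangle_le) simp
    also have "\<dots> \<le> h * norm u + h * norm v" using that by (intro add_mono mult_right_mono) auto
    also have "\<dots> = h * (norm u + norm v)" by (simp add: distrib_left)
    finally show ?thesis by (simp add: dist_norm norm_minus_commute add.assoc flip: norm_minus_cancel[of "s *\<^sub>R u + t *\<^sub>R v"])
  qed
  have ball: "x + s *\<^sub>R u + t *\<^sub>R v \<in> ball x r" if "0 \<le> s" "s \<le> h" "0 \<le> t" "t \<le> h" for s t
    using dist[OF that] h(2) by simp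
  define \<phi> where "\<phi> s = f (x + h *\<^sub>R v + s *\<^sub>R u) - f (x + s *\<^sub>R u)" for s
  let ?D = "\<lambda>y. frechet_derivative f (at y)"
  have "(\<phi> has_real_derivative (?D (x + h *\<^sub>R v + s *\<^sub>R u) u - ?D (x + s *\<^sub>R u) u)) (at s)"
    if "0 \<le> s" "s \<le> h" for s
    unfolding \<phi>_def
    using ball[OF that, of h] ball[OF that, of 0] h(1)
    by (intro DERIV_diff DERIV_along_line smooth_on_has_derivative[OF f]) (auto simp: algebra_simps)
  from MVT2[OF h(1) this] obtain s where s: "0 < s" "s < h"
    and *: "\<phi> h - \<phi> 0 = h * (?D (x + h *\<^sub>R v + s *\<^sub>R u) u - ?D (x + s *\<^sub>R u) u)" by auto
  have "((\<lambda>t. ?D (x + s *\<^sub>R u + t *\<^sub>R v) u) has_real_derivative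
      frechet_derivative (\<lambda>y. ?D y u) (at (x + s *\<^sub>R u + t *\<^sub>R v)) v) (at t)" if "0 \<le> t" "t \<le> h" for t
    using ball[of s t] s that
    by (intro DERIV_along_line smooth_on_has_derivative[OF smooth_on_derivative[OF f]]) auto
  from MVT2[OF h(1) this] obtain t where t: "0 < t" "t < h"
    and **: "?D (x + s *\<^sub>R u + h *\<^sub>R v) u - ?D (x + s *\<^sub>R u) u =
      h * frechet_derivative (\<lambda>y. ?D y u) (at (x + s *\<^sub>R u + t *\<^sub>R v)) v" by auto
  have e: "x + h *\<^sub>R v + s *\<^sub>R u = x + s *\<^sub>R u + h *\<^sub>R v" for s by simp
  show ?thesis
    by (rule exI[of _ "x + s *\<^sub>R u + t *\<^sub>R v"])
       (use s t * ** dist[of s t] in \<open>simp add: \<phi>_def e\<close>)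
qed

text \<open>Schwarz's theorem. The second difference is symmetric in u and v, so the two mixed
  derivatives agree at suitable points y and z near x; a gap of 2e at x would contradict continuity,
  which keeps each within e of its value at x. Vector values are treated by components.\<close>

lemma smooth_on_symmetric_second_derivative:
  fixes f :: "'v::euclidean_space \<Rightarrow> 'w::euclidean_space"
  assumes S: "open S" "x \<in> S" and f: "smooth_on S f"
  shows "frechet_derivative (\<lambda>y. frechet_derivative f (at y) u) (at x) v =
    frechet_derivative (\<lambda>y. frechet_derivative f (at y) v) (at x) u"
proof -
  have real: "frechet_derivative (\<lambda>y. frechet_derivative f (at y) u) (at x) v =
    frechet_derivative (\<lambda>y. frechet_derivative f (at y) v) (at x) u"
    if f: "smooth_on S f" for f :: "'v \<Rightarrow> real"
  proof (rule ccontr)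
    define D2 where "D2 u v = (\<lambda>x. frechet_derivative (\<lambda>y. frechet_derivative f (at y) u) (at x) v)" for u v
    assume "\<not> ?thesis"
    then have ne: "\<bar>D2 u v x - D2 v u x\<bar> > 0" by (simp add: D2_def)
    define e where "e = \<bar>D2 u v x - D2 v u x\<bar> / 2"
    have "e > 0" using ne e_def by simp
    have cont: "isCont (D2 u v) x" for u v
      using smooth_on_imp_continuous_on[OF smooth_on_derivative[OF smooth_on_derivative[OF f]]] S
      unfolding D2_def by (simp add: continuous_on_eq_continuous_at)
    obtain d1 where d1: "d1 > 0" "\<And>y. dist y x < d1 \<Longrightarrow> dist (D2 u v y) (D2 u v x) < e"
      using cont[of u v] \<open>e > 0\<close> unfolding continuous_at_eps_delta by blast
    obtain d2 where d2: "d2 > 0" "\<And>y. dist y x < d2 \<Longrightarrow> dist (D2 v u y) (D2 v u x) < e"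
      using cont[of v u] \<open>e > 0\<close> unfolding continuous_at_eps_delta by blast
    obtain d3 where d3: "d3 > 0" "ball x d3 \<subseteq> S" using S openE by blast
    define r where "r = min d1 (min d2 d3)"
    have r: "r > 0" "r \<le> d1" "r \<le> d2" "r \<le> d3" using d1 d2 d3 by (auto simp: r_def)
    have fr: "smooth_on (ball x r) f" using f d3 r by (meson smooth_on_subset subset_ball subset_trans)
    define N where "N = norm u + norm v"
    \<comment> \<open>\<open>N\<close> may be 0; with \<open>N + 1\<close> in the denominator the
      step is positive and \<open>h * N\<close> stays below \<open>r\<close> in every case.\<close>
    define h where "h = r / (2 * (N + 1))"
    have N: "N \<ge> 0" by (simp add: N_def)
    have h: "h > 0" using r N by (simp add: h_def)
    have "h * N < h * (2 * (N + 1))" using h N by (intro mult_strict_left_mono) auto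
    also have "\<dots> = r" using N by (simp add: h_def)
    finally have hN: "h * (norm u + norm v) < r" "h * (norm v + norm u) < r" by (simp_all add: N_def add.commute)
    obtain y where y: "dist x y \<le> h * (norm u + norm v)"
      "f (x + h *\<^sub>R u + h *\<^sub>R v) - f (x + h *\<^sub>R u) - f (x + h *\<^sub>R v) + f x = h * (h * D2 u v y)"
      using second_difference_mean_value[OF fr h hN(1)] unfolding D2_def by blast
    obtain z where z: "dist x z \<le> h * (norm v + norm u)"
      "f (x + h *\<^sub>R v + h *\<^sub>R u) - f (x + h *\<^sub>R v) - f (x + h *\<^sub>R u) + f x = h * (h * D2 v u z)"
      using second_difference_mean_value[OF fr h hN(2)] unfolding D2_def by blast
    have e: "x + h *\<^sub>R v + h *\<^sub>R u = x + h *\<^sub>R u + h *\<^sub>R v" by simp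
    have "h * (h * D2 u v y) = h * (h * D2 v u z)" using y(2) z(2)[unfolded e] by linarith
    then have "D2 u v y = D2 v u z" using h by simp
    moreover have "dist (D2 u v y) (D2 u v x) < e"
      using y(1) hN r by (intro d1(2)) (simp only: dist_commute[of y])
    moreover have "dist (D2 v u z) (D2 v u x) < e"
      using z(1) hN r by (intro d2(2)) (simp only: dist_commute[of z])
    ultimately show False unfolding e_def dist_real_def by argo
  qed
  show ?thesis
  proof (rule euclidean_eqI)
    fix b :: 'w
    have comp: "frechet_derivative (\<lambda>y. g y \<bullet> b) (at y) = (\<lambda>v. frechet_derivative g (at y) v \<bullet> b)"
      if "smooth_on S g" "y \<in> S" for g :: "'v \<Rightarrow> 'w" and y
      using has_derivative_inner_left[OF smooth_on_has_derivative[OF that]] frechet_derivative_at by metis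
    have fb: "smooth_on S (\<lambda>y. f y \<bullet> b)"
      by (rule smooth_on_linear[OF S(1) bounded_linear_inner_left f])
    have "frechet_derivative (\<lambda>y. frechet_derivative (\<lambda>y. f y \<bullet> b) (at y) u) (at x) v =
        frechet_derivative (\<lambda>y. frechet_derivative f (at y) u) (at x) v \<bullet> b" for u v
    proof -
      have "frechet_derivative (\<lambda>y. frechet_derivative (\<lambda>y. f y \<bullet> b) (at y) u) (at x) =
          frechet_derivative (\<lambda>y. frechet_derivative f (at y) u \<bullet> b) (at x)"
        by (rule frechet_derivative_transform_within_open[OF smooth_on_differentiable[OF smooth_on_derivative[OF fb]] S])
           (use S comp[OF f] in auto)
      then show ?thesis using comp[OF smooth_on_derivative[OF f] S(2)] by simp
    qed
    with real[OF fb]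
    show "frechet_derivative (\<lambda>y. frechet_derivative f (at y) u) (at x) v \<bullet> b =
      frechet_derivative (\<lambda>y. frechet_derivative f (at y) v) (at x) u \<bullet> b" by simp
  qed
qed

section \<open>Partitions of unity\<close>

text \<open>The polynomial factor makes the family closed under differentiation, so that smoothness,
  including at 0, follows by one induction over all \<open>p\<close> simultaneously.\<close>

definition flat_exp :: "real poly \<Rightarrow> real \<Rightarrow> real" where
  "flat_exp p t = (if t > 0 then poly p (1 / t) * exp (- (1 / t)) else 0)"

text \<open>The substitution s = 1/t turns the limit from the right into the decay of s^i / e^s at
  infinity; on the left the function is 0.\<close>

lemma flat_exp_tendsto_0: "(flat_exp p \<longlongrightarrow> 0) (at 0)"
proof -
  have "((\<lambda>s. \<Sum>i\<le>degree p. coeff p i * (s ^ i / exp s)) \<longlongrightarrow> (\<Sum>i\<le>degree p. coeff p i * 0)) at_top"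
    by (intro tendsto_sum tendsto_mult tendsto_const tendsto_power_div_exp_0)
  then have "((\<lambda>s. poly p s * exp (- s)) \<longlongrightarrow> 0) at_top"
    by (simp add: poly_altdef sum_distrib_right exp_minus divide_inverse mult.assoc)
  from filterlim_compose[OF this filterlim_inverse_at_top_right]
  have "((\<lambda>t. poly p (1 / t) * exp (- (1 / t))) \<longlongrightarrow> 0) (at_right 0)"
    by (simp add: inverse_eq_divide)
  then have "(flat_exp p \<longlongrightarrow> 0) (at_right 0)"
    by (rule tendsto_cong[THEN iffD1, rotated])
       (simp add: flat_exp_def eventually_at_right_less eventually_at_filter)
  moreover have "(flat_exp p \<longlongrightarrow> 0) (at_left 0)"
    by (rule tendsto_cong[THEN iffD1, OF _ tendsto_const])
       (auto simp: flat_exp_def eventually_at_filter)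
  ultimately show ?thesis by (simp add: filterlim_at_split)
qed

text \<open>The derivative of \<open>p(1/t) e\<^sup>-\<^sup>1\<^sup>/\<^sup>t\<close> is \<open>(p - p')(1/t) t\<^sup>-\<^sup>2 e\<^sup>-\<^sup>1\<^sup>/\<^sup>t\<close>.\<close>

lemma flat_exp_has_derivative:
  "(flat_exp p has_real_derivative flat_exp ([:0, 0, 1:] * (p - pderiv p)) t) (at t)"
proof (cases t "0 :: real" rule: linorder_cases)
  case less
  have "((\<lambda>_. 0) has_real_derivative 0) (at t)" by simp
  then have "(flat_exp p has_real_derivative 0) (at t)"
    by (rule has_field_derivative_transform_within_open[of _ _ _ "{..<0}"])
       (use less in \<open>auto simp: flat_exp_def\<close>)
  with less show ?thesis by (simp add: flat_exp_def)
next
  case equal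
  \<comment> \<open>Division by h multiplies the polynomial in 1/h by its variable, so the
    difference quotient at 0 is \<open>flat_exp (pCons 0 p)\<close>, which tends to 0.\<close>
  have "((\<lambda>h. (flat_exp p h - flat_exp p 0) / h) \<longlongrightarrow> 0) (at 0)"
    by (rule tendsto_cong[THEN iffD1, OF _ flat_exp_tendsto_0[of "pCons 0 p"]])
       (auto simp: flat_exp_def eventually_at_filter)
  with equal show ?thesis by (simp add: has_field_derivative_iff flat_exp_def)
next
  case greater
  have "((\<lambda>t. poly p (1 / t) * exp (- (1 / t))) has_real_derivative
      poly ([:0, 0, 1:] * (p - pderiv p)) (1 / t) * exp (- (1 / t))) (at t)"
    using greater
    by (auto intro!: derivative_eq_intros DERIV_chain2[OF poly_DERIV] simp: field_simps power2_eq_square)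
  then have "(flat_exp p has_real_derivative
      poly ([:0, 0, 1:] * (p - pderiv p)) (1 / t) * exp (- (1 / t))) (at t)"
    by (rule has_field_derivative_transform_within_open[of _ _ _ "{0<..}"])
       (use greater in \<open>auto simp: flat_exp_def\<close>)
  with greater show ?thesis by (simp only: flat_exp_def if_True)
qed

lemma smooth_on_flat_exp: "smooth_on UNIV (flat_exp p)"
  unfolding smooth_on_def
proof
  show "Ck_on k UNIV (flat_exp p)" for k
  proof (induction k arbitrary: p)
    case 0
    show ?case using flat_exp_has_derivative by (auto intro: DERIV_continuous_on)
  next
    case (Suc k)
    show ?case
    proof (rule Ck_on_SucI)
      show "(flat_exp p has_derivative (\<lambda>v. v *\<^sub>R flat_exp ([:0, 0, 1:] * (p - pderiv p)) t)) (at t)" for t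
        using flat_exp_has_derivative[of p t] by (simp add: has_field_derivative_def mult.commute[of _ "flat_exp _ _"])
      show "Ck_on k UNIV (\<lambda>t. v *\<^sub>R flat_exp ([:0, 0, 1:] * (p - pderiv p)) t)" for v
        by (rule Ck_on_scaleR[OF open_UNIV Ck_on_const Suc.IH])
    qed simp
  qed
qed

text \<open>With the constant polynomial 1 this is exp(-1/(r^2 - |x - p|^2)) inside the ball and 0
  outside. The squared norm is spelled out in coordinates so that the smoothness rules for sums and
  products apply to it.\<close>

definition bump :: "'v::euclidean_space \<Rightarrow> real \<Rightarrow> 'v \<Rightarrow> real" where
  "bump p r x = flat_exp 1 (r\<^sup>2 - (\<Sum>b\<in>Basis. ((x - p) \<bullet> b) * ((x - p) \<bullet> b)))"

lemma smooth_on_bump: "smooth_on UNIV (bump p r)"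
proof -
  have id: "smooth_on UNIV (\<lambda>x::'a. x)"
    unfolding smooth_on_iff[of UNIV "\<lambda>x. x"] by (simp add: smooth_on_const)
  have lin: "smooth_on UNIV (\<lambda>x. (x - p) \<bullet> b)" for b
    by (rule smooth_on_linear[OF open_UNIV bounded_linear_inner_left smooth_on_diff[OF open_UNIV id smooth_on_const]])
  have "smooth_on UNIV (\<lambda>x. r\<^sup>2 - (\<Sum>b\<in>Basis. ((x - p) \<bullet> b) * ((x - p) \<bullet> b)))"
    by (rule smooth_on_diff[OF open_UNIV smooth_on_const smooth_on_sum[OF open_UNIV smooth_on_mult[OF open_UNIV lin lin]]])
  from smooth_on_compose[OF open_UNIV open_UNIV _ this smooth_on_flat_exp[of 1]]
  show ?thesis unfolding bump_def[abs_def] by simp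
qed

lemma
  assumes "r > 0"
  shows bump_nonneg: "bump p r x \<ge> 0"
    and bump_pos_iff: "bump p r x > 0 \<longleftrightarrow> x \<in> ball p r"
proof -
  have "bump p r x = flat_exp 1 (r\<^sup>2 - (dist p x)\<^sup>2)"
    unfolding bump_def euclidean_inner[symmetric] power2_norm_eq_inner[symmetric]
    by (simp add: dist_norm norm_minus_commute)
  moreover have "r\<^sup>2 - (dist p x)\<^sup>2 > 0 \<longleftrightarrow> dist p x < r"
    using assms by (simp add: abs_square_less_1 power2_less_imp_less power_strict_mono pos2 power_mono_iff flip: not_le)
  ultimately show "bump p r x \<ge> 0" "bump p r x > 0 \<longleftrightarrow> x \<in> ball p r"
    by (auto simp: flat_exp_def)
qed

section \<open>Charts, their inverses and transition maps\<close>

locale atlas =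
  fixes X :: "'a topology" and \<A> :: "'a chart set"
  assumes smooth_structure: "smooth_structure X \<A>"
begin

lemma chart: "c \<in> \<A> \<Longrightarrow> is_chart X c"
  using smooth_structure by (simp add: smooth_structure_def)

lemma chart_dom: "c \<in> \<A> \<Longrightarrow> openin X (fst c)" "c \<in> \<A> \<Longrightarrow> fst c \<subseteq> topspace X"
  using chart[of c] openin_subset by (auto simp: is_chart_def)

lemma chart_inj: "c \<in> \<A> \<Longrightarrow> inj_on (snd c) (fst c)"
  using chart[of c] homeomorphic_imp_injective_map[of "subtopology X (fst c)" _ "snd c"]
    topspace_subtopology_subset[OF chart_dom(2)[of c]]
  unfolding is_chart_def by metis

lemma open_img: "c \<in> \<A> \<Longrightarrow> open (img c)"
  using chart[of c] by (simp add: is_chart_def)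

lemma ex_chart:
  assumes "p \<in> topspace X"
  shows "\<exists>c\<in>\<A>. p \<in> fst c"
proof -
  have "(\<Union>c\<in>\<A>. fst c) = topspace X" using smooth_structure by (simp add: smooth_structure_def)
  then show ?thesis using assms by blast
qed

lemma param_chart [simp]: "c \<in> \<A> \<Longrightarrow> p \<in> fst c \<Longrightarrow> param c (snd c p) = p"
  using chart_inj by (simp add: param_def)

lemma chart_param [simp]: "x \<in> img c \<Longrightarrow> snd c (param c x) = x"
  by (simp add: param_def img_def f_inv_into_f)

lemma param_in_dom: "x \<in> img c \<Longrightarrow> param c x \<in> fst c"
  by (simp add: param_def img_def inv_into_into)

lemma chart_in_img: "p \<in> fst c \<Longrightarrow> snd c p \<in> img c"
  by (simp add: img_def)

lemma continuous_map_chart: "c \<in> \<A> \<Longrightarrow> continuous_map (subtopology X (fst c)) (top_of_set (img c)) (snd c)"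
  using chart[of c] by (simp add: is_chart_def homeomorphic_imp_continuous_map)

text \<open>\<open>param c\<close> is an inverse chosen by \<open>inv_into\<close>; on the image of
  the chart it coincides with the continuous inverse that the homeomorphism provides.\<close>

lemma continuous_map_param:
  assumes "c \<in> \<A>"
  shows "continuous_map (top_of_set (img c)) (subtopology X (fst c)) (param c)"
proof -
  obtain g where g: "homeomorphic_maps (subtopology X (fst c)) (top_of_set (img c)) (snd c) g"
    using chart[OF assms] unfolding is_chart_def homeomorphic_map_maps by blast
  have *: "g x = param c x" if "x \<in> img c" for x
  proof -
    have "topspace (subtopology X (fst c)) = fst c"
      by (rule topspace_subtopology_subset[OF chart_dom(2)[OF assms]])
    then have "g (snd c (param c x)) = param c x"
      using g param_in_dom[OF that] unfolding homeomorphic_maps_def by blast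
    then show ?thesis using that by simp
  qed
  have **: "continuous_map (top_of_set (img c)) (subtopology X (fst c)) g"
    using g by (simp add: homeomorphic_maps_def)
  show ?thesis by (rule continuous_map_eq[OF **]) (simp add: *)
qed

lemma open_image_chart:
  assumes "c \<in> \<A>" "openin X U"
  shows "open (snd c ` (fst c \<inter> U))"
proof -
  have "openin (subtopology X (fst c)) (fst c \<inter> U)"
    using assms(2) by (simp add: openin_subtopology_Int2)
  then have "openin (top_of_set (img c)) (snd c ` (fst c \<inter> U))"
    using chart[OF assms(1)] homeomorphic_imp_open_map unfolding is_chart_def open_map_def by blast
  then show ?thesis using open_img[OF assms(1)] openin_open_eq by blast
qed

lemma openin_vimage_chart:
  assumes "c \<in> \<A>" "open B"
  shows "openin X {q \<in> fst c. snd c q \<in> B}"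
proof -
  have "openin (subtopology X (fst c)) {q \<in> topspace (subtopology X (fst c)). snd c q \<in> B \<inter> img c}"
    by (rule openin_continuous_map_preimage[OF continuous_map_chart[OF assms(1)]])
       (use openin_open_Int[OF assms(2), of "img c"] in \<open>simp add: Int_commute\<close>)
  moreover have "{q \<in> topspace (subtopology X (fst c)). snd c q \<in> B \<inter> img c} = {q \<in> fst c. snd c q \<in> B}"
    using chart_dom[OF assms(1)] by (auto simp: chart_in_img)
  ultimately show ?thesis using chart_dom(1)[OF assms(1)] openin_trans_full by metis
qed

lemma compactin_param:
  assumes "c \<in> \<A>" "compact K" "K \<subseteq> img c"
  shows "compactin X (param c ` K)"
proof -
  have "compactin (top_of_set (img c)) K" using assms by (simp add: compactin_subtopology)
  from image_compactin[OF this continuous_map_param[OF assms(1)]]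
  show ?thesis by (simp add: compactin_subtopology)
qed

lemma compact_image_chart:
  assumes "c \<in> \<A>" "compactin X K" "K \<subseteq> fst c"
  shows "compact (snd c ` K)"
proof -
  have "compactin (subtopology X (fst c)) K" using assms by (simp add: compactin_subtopology)
  from image_compactin[OF this continuous_map_chart[OF assms(1)]]
  show ?thesis by (simp add: compactin_subtopology)
qed

lemma overlap_subset: "overlap c c' \<subseteq> img c"
  by (auto simp: overlap_def img_def)

lemma open_overlap: "c \<in> \<A> \<Longrightarrow> c' \<in> \<A> \<Longrightarrow> open (overlap c c')"
  unfolding overlap_def using open_image_chart chart_dom(1) by blast

lemma in_overlap_iff: "c \<in> \<A> \<Longrightarrow> x \<in> overlap c c' \<longleftrightarrow> x \<in> img c \<and> param c x \<in> fst c'"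
  by (force simp: overlap_def img_def)

lemma smooth_on_transition: "c \<in> \<A> \<Longrightarrow> c' \<in> \<A> \<Longrightarrow> smooth_on (overlap c c') (transition c c')"
  using smooth_structure unfolding smooth_structure_def compatible_def by blast

lemma transition_image: "c \<in> \<A> \<Longrightarrow> transition c c' ` overlap c c' = overlap c' c"
  by (force simp: overlap_def transition_def image_iff)

lemma param_transition: "c \<in> \<A> \<Longrightarrow> c' \<in> \<A> \<Longrightarrow> x \<in> overlap c c' \<Longrightarrow> param c' (transition c c' x) = param c x"
  by (auto simp: overlap_def transition_def)

lemma transition_transition:
  "c \<in> \<A> \<Longrightarrow> c' \<in> \<A> \<Longrightarrow> x \<in> overlap c c' \<Longrightarrow> transition c' c (transition c c' x) = x"
  by (auto simp: overlap_def transition_def)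

lemma inj_on_transition: "c \<in> \<A> \<Longrightarrow> c' \<in> \<A> \<Longrightarrow> inj_on (transition c c') (overlap c c')"
  by (rule inj_on_inverseI[of _ "transition c' c"]) (rule transition_transition)

end

locale closed_manifold = atlas +
  assumes compact: "compact_space X" and Hausdorff: "Hausdorff_space X"
begin

text \<open>A Euclidean bump around the coordinates of \<open>p\<close>, carried over by the chart
  and extended by 0. The extension is smooth because the bump lives in a compact set
  \<open>K\<close> inside the chart domain, and compact sets in a Hausdorff space are
  closed.\<close>

lemma ex_bump_function:
  assumes "p \<in> topspace X"
  shows "\<exists>c\<in>\<A>. \<exists>b. smooth_fun \<A> b \<and> (\<forall>q. 0 \<le> b q) \<and> b p > 0 \<and>
    openin X {q \<in> topspace X. b q > 0} \<and> X closure_of {q \<in> topspace X. b q \<noteq> 0} \<subseteq> fst c"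
proof -
  obtain c where c: "c \<in> \<A>" "p \<in> fst c" using ex_chart[OF assms] by blast
  obtain r where r: "r > 0" "cball (snd c p) r \<subseteq> img c"
    using open_img[OF c(1)] chart_in_img[OF c(2)] open_contains_cball by blast
  define K where "K = param c ` cball (snd c p) r"
  define b where "b q = (if q \<in> fst c then bump (snd c p) r (snd c q) else 0)" for q
  have K: "closedin X K" "K \<subseteq> fst c"
  proof -
    show "closedin X K"
      unfolding K_def by (rule compactin_imp_closedin[OF Hausdorff compactin_param[OF c(1) compact_cball r(2)]])
    show "K \<subseteq> fst c"
      unfolding K_def using r(2) by (intro image_subsetI param_in_dom) blast
  qed
  have b_nz: "q \<in> K" if "b q \<noteq> 0" for q
  proof -
    have q: "q \<in> fst c" and "bump (snd c p) r (snd c q) \<noteq> 0"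
      using that by (auto simp: b_def split: if_splits)
    then have "snd c q \<in> ball (snd c p) r"
      using bump_pos_iff[OF r(1)] bump_nonneg[OF r(1)] by (metis less_eq_real_def)
    then have "param c (snd c q) \<in> K" unfolding K_def using ball_subset_cball by blast
    then show ?thesis using q c(1) by simp
  qed
  have smooth: "smooth_on (img c') (b \<circ> param c')" if c': "c' \<in> \<A>" for c'
  proof (rule smooth_on_local)
    fix x assume x: "x \<in> img c'"
    show "\<exists>U. open U \<and> x \<in> U \<and> smooth_on U (b \<circ> param c')"
    \<comment> \<open>Two open sets cover the image of \<open>c'\<close>: the overlap with
      \<open>c\<close>, where the function is a bump composed with a transition map, and the
      complement of \<open>K\<close>, where it is 0.\<close>
    proof (cases "param c' x \<in> fst c")
      case True
      have "smooth_on (overlap c' c) (\<lambda>y. bump (snd c p) r (transition c' c y))"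
        by (rule smooth_on_compose[OF open_overlap[OF c' c(1)] open_UNIV _ smooth_on_transition[OF c' c(1)] smooth_on_bump]) simp
      then have "smooth_on (overlap c' c) (b \<circ> param c')"
        by (rule smooth_on_cong[OF open_overlap[OF c' c(1)], rotated])
           (use in_overlap_iff[OF c'] in \<open>auto simp: b_def transition_def\<close>)
      with True x open_overlap[OF c' c(1)] in_overlap_iff[OF c'] show ?thesis by blast
    next
      case False
      let ?U = "snd c' ` (fst c' \<inter> (topspace X - K))"
      have U: "open ?U" using open_image_chart[OF c'] K(1) by (simp add: openin_diff)
      have "param c' x \<in> fst c' \<inter> (topspace X - K)"
        using False K(2) param_in_dom[OF x] chart_dom(2)[OF c'] by blast
      then have xU: "x \<in> ?U" using x chart_param by (metis imageI)
      have "smooth_on ?U (b \<circ> param c')"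
      proof (rule smooth_on_cong[OF U _ smooth_on_const[of _ 0]])
        fix y assume "y \<in> ?U"
        then have "param c' y \<notin> K" using c' by auto
        then show "0 = (b \<circ> param c') y" using b_nz by (metis comp_apply)
      qed
      with U xU show ?thesis by blast
    qed
  qed
  have pos: "{q \<in> topspace X. b q > 0} = {q \<in> fst c. snd c q \<in> ball (snd c p) r}"
    using bump_pos_iff[OF r(1)] chart_dom(2)[OF c(1)] by (auto simp: b_def)
  have "X closure_of {q \<in> topspace X. b q \<noteq> 0} \<subseteq> K"
    using b_nz by (intro closure_of_minimal K(1)) auto
  moreover have "b p > 0" using c(2) r(1) bump_pos_iff[OF r(1), of "snd c p" "snd c p"] by (simp add: b_def)
  moreover have "b q \<ge> 0" for q using bump_nonneg[OF r(1), of "snd c p"] by (simp add: b_def)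
  ultimately show ?thesis
    using c(1) smooth K(2) openin_vimage_chart[OF c(1), of "ball (snd c p) r"] pos
    by (intro bexI[of _ c] exI[of _ b]) (auto simp: smooth_fun_def)
qed

text \<open>By compactness finitely many bumps have positivity sets covering the space; their sum is
  positive everywhere and serves as the common denominator.\<close>

lemma ex_partition_of_unity: "\<exists>C \<rho>. partition_of_unity X \<A> C \<rho>"
proof -
  define bump_for where "bump_for p c b \<longleftrightarrow> c \<in> \<A> \<and> smooth_fun \<A> b \<and> (\<forall>q. 0 \<le> b q) \<and> b p > 0 \<and>
    openin X {q \<in> topspace X. b q > 0} \<and> X closure_of {q \<in> topspace X. b q \<noteq> 0} \<subseteq> fst c" for p c b
  have "\<exists>c b. p \<in> topspace X \<longrightarrow> bump_for p c b" for p
    using ex_bump_function[of p] unfolding bump_for_def by blast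
  then obtain ch bf where *: "\<And>p. p \<in> topspace X \<longrightarrow> bump_for p (ch p) (bf p)" by metis
  have b: "\<And>p. p \<in> topspace X \<Longrightarrow> ch p \<in> \<A>"
    "\<And>p. p \<in> topspace X \<Longrightarrow> smooth_fun \<A> (bf p)"
    "\<And>p q. p \<in> topspace X \<Longrightarrow> 0 \<le> bf p q" "\<And>p. p \<in> topspace X \<Longrightarrow> bf p p > 0"
    "\<And>p. p \<in> topspace X \<Longrightarrow> openin X {q \<in> topspace X. bf p q > 0}"
    "\<And>p. p \<in> topspace X \<Longrightarrow> X closure_of {q \<in> topspace X. bf p q \<noteq> 0} \<subseteq> fst (ch p)"
    using *[unfolded bump_for_def] by blast+
  let ?U = "\<lambda>p. {q \<in> topspace X. bf p q > 0}"
  have "\<exists>\<F>. finite \<F> \<and> \<F> \<subseteq> ?U ` topspace X \<and> topspace X \<subseteq> \<Union>\<F>"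
  proof -
    have "topspace X \<subseteq> \<Union>(?U ` topspace X)" using b(4) by blast
    moreover have "\<forall>U\<in>?U ` topspace X. openin X U" using b(5) by blast
    ultimately show ?thesis
      using compact unfolding compact_space_def compactin_def by meson
  qed
  then obtain \<F> where F: "finite \<F>" "\<F> \<subseteq> ?U ` topspace X" "topspace X \<subseteq> \<Union>\<F>" by blast
  from finite_subset_image[OF F(1,2)] F(3)
  obtain P where P: "finite P" "P \<subseteq> topspace X" "topspace X \<subseteq> (\<Union>p\<in>P. ?U p)" by blast
  \<comment> \<open>A partition is indexed by charts, but several points of \<open>P\<close> may
    have been given the same chart; their bumps are added.\<close>
  define s where "s c q = (\<Sum>p\<in>{p\<in>P. ch p = c}. bf p q)" for c q
  define t where "t q = (\<Sum>p\<in>P. bf p q)" for q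
  have s_nonneg: "s c q \<ge> 0" for c q unfolding s_def using b(3) P(2) by (intro sum_nonneg) auto
  have t_pos: "t q > 0" if q: "q \<in> topspace X" for q
  proof -
    obtain p where "p \<in> P" "bf p q > 0" using P(3) q by blast
    then show ?thesis unfolding t_def using b(3) P(1,2) by (intro sum_pos2[of P p]) auto
  qed
  have st: "(\<Sum>c\<in>ch ` P. s c q) = t q" for q
    unfolding s_def t_def using P(1) by (rule sum.image_gen[symmetric])
  have smooth: "smooth_on (img c) (\<lambda>x. bf p (param c x))" if "c \<in> \<A>" "p \<in> P" for c p
    using b(2)[of p] P(2) that unfolding smooth_fun_def o_def by blast
  have sm: "smooth_fun \<A> (\<lambda>q. s c q / t q)" for c
    unfolding smooth_fun_def
  proof
    fix c' assume c': "c' \<in> \<A>"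
    have "smooth_on (img c') (\<lambda>x. (\<Sum>p\<in>{p\<in>P. ch p = c}. bf p (param c' x)) / (\<Sum>p\<in>P. bf p (param c' x)))"
    proof (rule smooth_on_divide[OF open_img[OF c'] smooth_on_sum[OF open_img[OF c']] smooth_on_sum[OF open_img[OF c']]])
      show "(\<Sum>p\<in>P. bf p (param c' x)) \<noteq> 0" if "x \<in> img c'" for x
        using t_pos[of "param c' x"] param_in_dom[OF that] chart_dom(2)[OF c'] by (auto simp: t_def)
    qed (use smooth[OF c'] in auto)
    then show "smooth_on (img c') ((\<lambda>q. s c q / t q) \<circ> param c')"
      by (simp add: s_def t_def o_def)
  qed
  have cl: "X closure_of {q \<in> topspace X. s c q / t q \<noteq> 0} \<subseteq> fst c" for c
  proof -
    have "{q \<in> topspace X. s c q / t q \<noteq> 0} \<subseteq> \<Union>((\<lambda>p. {q \<in> topspace X. bf p q \<noteq> 0}) ` {p\<in>P. ch p = c})"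
    proof
      fix q assume "q \<in> {q \<in> topspace X. s c q / t q \<noteq> 0}"
      then have "q \<in> topspace X" "s c q \<noteq> 0" by auto
      moreover from this(2) obtain p where "p \<in> {p\<in>P. ch p = c}" "bf p q \<noteq> 0"
        unfolding s_def by (rule sum.not_neutral_contains_not_neutral)
      ultimately show "q \<in> \<Union>((\<lambda>p. {q \<in> topspace X. bf p q \<noteq> 0}) ` {p\<in>P. ch p = c})" by blast
    qed
    then have "X closure_of {q \<in> topspace X. s c q / t q \<noteq> 0} \<subseteq>
        X closure_of \<Union>((\<lambda>p. {q \<in> topspace X. bf p q \<noteq> 0}) ` {p\<in>P. ch p = c})"
      by (rule closure_of_mono)
    \<comment> \<open>The union is finite, so its closure is the union of the closures, each of
      which lies in the domain of \<open>c\<close>.\<close>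
    also have "\<dots> = (\<Union>p\<in>{p\<in>P. ch p = c}. X closure_of {q \<in> topspace X. bf p q \<noteq> 0})"
      using P(1) by (subst closure_of_Union) auto
    also have "\<dots> \<subseteq> fst c" using b(6) P(2) by blast
    finally show ?thesis .
  qed
  have su: "(\<Sum>c\<in>ch ` P. s c q / t q) = 1" if "q \<in> topspace X" for q
    using t_pos[OF that] by (simp add: st flip: sum_divide_distrib)
  have le: "s c q / t q \<le> 1" if "q \<in> topspace X" "c \<in> ch ` P" for c q
  proof -
    have "s c q \<le> (\<Sum>c\<in>ch ` P. s c q)" using P(1) s_nonneg that by (intro member_le_sum) auto
    then show ?thesis using t_pos[OF that(1)] by (simp add: st)
  qed
  have ge: "0 \<le> s c q / t q" if "q \<in> topspace X" for c q
    using s_nonneg t_pos[OF that] by simp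
  have fin: "finite (ch ` P)" "ch ` P \<subseteq> \<A>" using P(1,2) b(1) by auto
  have "partition_of_unity X \<A> (ch ` P) (\<lambda>c q. s c q / t q)"
    unfolding partition_of_unity_def using fin sm cl su le ge by simp
  then show ?thesis by blast
qed

end

section \<open>Multilinear algebra in three dimensions\<close>

text \<open>Tensors take infinite sequences of vectors. \<open>apply1\<close>, \<open>apply2\<close>
  and \<open>apply3\<close> supply finitely many and repeat the last one; a
  \<open>multilinear k\<close> map reads only the first \<open>k\<close> entries.\<close>

definition apply1 :: "((nat \<Rightarrow> real^3) \<Rightarrow> real) \<Rightarrow> real^3 \<Rightarrow> real" where
  "apply1 t u = t (\<lambda>_. u)"

definition apply2 :: "((nat \<Rightarrow> real^3) \<Rightarrow> real) \<Rightarrow> real^3 \<Rightarrow> real^3 \<Rightarrow> real" where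
  "apply2 t u v = t (case_nat u (\<lambda>_. v))"

definition apply3 :: "((nat \<Rightarrow> real^3) \<Rightarrow> real) \<Rightarrow> real^3 \<Rightarrow> real^3 \<Rightarrow> real^3 \<Rightarrow> real" where
  "apply3 t u v w = t (case_nat u (case_nat v (\<lambda>_. w)))"

definition bilinear_alt :: "(real^3 \<Rightarrow> real^3 \<Rightarrow> real) \<Rightarrow> bool" where
  "bilinear_alt b \<longleftrightarrow> (\<forall>v. linear (\<lambda>u. b u v)) \<and> (\<forall>u. linear (b u)) \<and> (\<forall>u. b u u = 0)"

definition trilinear_alt :: "(real^3 \<Rightarrow> real^3 \<Rightarrow> real^3 \<Rightarrow> real) \<Rightarrow> bool" where
  "trilinear_alt t \<longleftrightarrow> (\<forall>v w. linear (\<lambda>u. t u v w)) \<and> (\<forall>u w. linear (\<lambda>v. t u v w)) \<and>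
     (\<forall>u v. linear (t u v)) \<and> (\<forall>u w. t u u w = 0 \<and> t w u u = 0 \<and> t u w u = 0)"

lemma bilinear_altD:
  assumes "bilinear_alt b"
  shows "linear (\<lambda>u. b u v)" "linear (b u)" "b u u = 0"
  using assms by (simp_all add: bilinear_alt_def)

lemma trilinear_altD:
  assumes "trilinear_alt t"
  shows "linear (\<lambda>u. t u v w)" "linear (\<lambda>v. t u v w)" "linear (t u v)"
    "t u u w = 0" "t w u u = 0" "t u w u = 0"
  using assms by (simp_all add: trilinear_alt_def)

lemma less_2_nat_cases: "i < (2::nat) \<Longrightarrow> (i = 0 \<Longrightarrow> P) \<Longrightarrow> (i = 1 \<Longrightarrow> P) \<Longrightarrow> P"
  by (auto simp: less_Suc_eq numeral_2_eq_2)

lemma less_3_nat_cases: "i < (3::nat) \<Longrightarrow> (i = 0 \<Longrightarrow> P) \<Longrightarrow> (i = 1 \<Longrightarrow> P) \<Longrightarrow> (i = 2 \<Longrightarrow> P) \<Longrightarrow> P"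
  by (auto simp: less_Suc_eq numeral_3_eq_3 numeral_2_eq_2)

text \<open>Together with its analogues in degrees 2 and 3, the passage from maps on sequences,
  updated at an index, to curried maps, where linearity in an argument is a plain
  \<open>linear\<close>.\<close>

lemma multilinear_1:
  "multilinear 1 t \<longleftrightarrow> (\<forall>v. t v = apply1 t (v 0)) \<and> linear (apply1 t)"
proof
  assume t: "multilinear 1 t"
  have "t v = apply1 t (v 0)" for v
    using t unfolding multilinear_def apply1_def by (metis less_one)
  moreover have "linear (apply1 t)"
  proof -
    have "linear (\<lambda>u. t ((\<lambda>_. 0)(0 := u)))" using t unfolding multilinear_def by (metis less_one)
    moreover have "t ((\<lambda>_. 0)(0 := u)) = apply1 t u" for u
      using t unfolding multilinear_def apply1_def by (metis less_one fun_upd_same)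
    ultimately show ?thesis by simp
  qed
  ultimately show "(\<forall>v. t v = apply1 t (v 0)) \<and> linear (apply1 t)" by blast
next
  assume t: "(\<forall>v. t v = apply1 t (v 0)) \<and> linear (apply1 t)"
  then have eq: "t v = apply1 t (v 0)" for v by blast
  have "(\<lambda>u. t (v(0 := u))) = apply1 t" for v by (rule ext, subst eq) simp
  moreover have "t v = t w" if "v 0 = w 0" for v w using that eq[of v] eq[of w] by simp
  ultimately show "multilinear 1 t" using t by (simp add: multilinear_def)
qed

lemma multilinear_2:
  "multilinear 2 t \<longleftrightarrow> (\<forall>v. t v = apply2 t (v 0) (v 1)) \<and>
     (\<forall>v. linear (\<lambda>u. apply2 t u v)) \<and> (\<forall>u. linear (apply2 t u))"
proof
  assume t: "multilinear 2 t"
  have eq: "t v = apply2 t (v 0) (v 1)" for v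
    unfolding apply2_def
    using t unfolding multilinear_def by (elim conjE allE[of _ v] allE[of _ "case_nat (v 0) (\<lambda>_. v 1)"] impE) (auto elim!: less_2_nat_cases)
  have "linear (\<lambda>u. t ((case_nat a (\<lambda>_. b))(0 := u)))" "linear (\<lambda>u. t ((case_nat a (\<lambda>_. b))(1 := u)))" for a b
    using t unfolding multilinear_def by auto
  then have "linear (\<lambda>u. apply2 t u b)" "linear (\<lambda>u. apply2 t a u)" for a b
    by (simp_all add: eq[of "(case_nat _ _)(_ := _)"])
  then show "(\<forall>v. t v = apply2 t (v 0) (v 1)) \<and> (\<forall>v. linear (\<lambda>u. apply2 t u v)) \<and> (\<forall>u. linear (apply2 t u))"
    using eq by auto
next
  assume t: "(\<forall>v. t v = apply2 t (v 0) (v 1)) \<and>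
     (\<forall>v. linear (\<lambda>u. apply2 t u v)) \<and> (\<forall>u. linear (apply2 t u))"
  then have eq: "t v = apply2 t (v 0) (v 1)" for v by blast
  have "(\<lambda>u. t (v(0 := u))) = (\<lambda>u. apply2 t u (v 1))" "(\<lambda>u. t (v(1 := u))) = apply2 t (v 0)" for v
    by (rule ext, subst eq, simp)+
  then have "linear (\<lambda>u. t (v(i := u)))" if "i < 2" for i v
    using that t by (elim less_2_nat_cases) auto
  moreover have "t v = t w" if "\<forall>i<2. v i = w i" for v w using that eq[of v] eq[of w] by simp
  ultimately show "multilinear 2 t" unfolding multilinear_def by blast
qed

lemma multilinear_3:
  "multilinear 3 t \<longleftrightarrow> (\<forall>v. t v = apply3 t (v 0) (v 1) (v 2)) \<and>
     (\<forall>v w. linear (\<lambda>u. apply3 t u v w)) \<and> (\<forall>u w. linear (\<lambda>v. apply3 t u v w)) \<and>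
     (\<forall>u v. linear (apply3 t u v))"
proof
  assume t: "multilinear 3 t"
  have eq: "t v = apply3 t (v 0) (v 1) (v 2)" for v
    unfolding apply3_def
    using t unfolding multilinear_def by (elim conjE allE[of _ v] allE[of _ "case_nat (v 0) (case_nat (v 1) (\<lambda>_. v 2))"] impE)
      (auto elim!: less_3_nat_cases simp: numeral_2_eq_2)
  let ?v = "\<lambda>a b c. case_nat a (case_nat b (\<lambda>_. c))"
  have "linear (\<lambda>u. t ((?v a b c)(0 := u)))" "linear (\<lambda>u. t ((?v a b c)(1 := u)))" 
    "linear (\<lambda>u. t ((?v a b c)(2 := u)))" for a b c
    using t unfolding multilinear_def by auto
  then have "linear (\<lambda>u. apply3 t u b c)" "linear (\<lambda>u. apply3 t a u c)" "linear (\<lambda>u. apply3 t a b u)" for a b c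
    by (simp_all add: eq[of "(case_nat _ _)(_ := _)"] numeral_2_eq_2)
  then show "(\<forall>v. t v = apply3 t (v 0) (v 1) (v 2)) \<and>
     (\<forall>v w. linear (\<lambda>u. apply3 t u v w)) \<and> (\<forall>u w. linear (\<lambda>v. apply3 t u v w)) \<and>
     (\<forall>u v. linear (apply3 t u v))"
    using eq by auto
next
  assume t: "(\<forall>v. t v = apply3 t (v 0) (v 1) (v 2)) \<and>
     (\<forall>v w. linear (\<lambda>u. apply3 t u v w)) \<and> (\<forall>u w. linear (\<lambda>v. apply3 t u v w)) \<and>
     (\<forall>u v. linear (apply3 t u v))"
  then have eq: "t v = apply3 t (v 0) (v 1) (v 2)" for v by blast
  have "(\<lambda>u. t (v(0 := u))) = (\<lambda>u. apply3 t u (v 1) (v 2))"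
    "(\<lambda>u. t (v(1 := u))) = (\<lambda>u. apply3 t (v 0) u (v 2))"
    "(\<lambda>u. t (v(2 := u))) = apply3 t (v 0) (v 1)" for v
    by (rule ext, subst eq, simp)+
  then have "linear (\<lambda>u. t (v(i := u)))" if "i < 3" for i v
    using that t by (elim less_3_nat_cases) auto
  moreover have "t v = t w" if "\<forall>i<3. v i = w i" for v w using that eq[of v] eq[of w] by simp
  ultimately show "multilinear 3 t" unfolding multilinear_def by blast
qed

lemma alternating_form_2:
  "multilinear 2 t \<and> alternating 2 t \<longleftrightarrow> (\<forall>v. t v = apply2 t (v 0) (v 1)) \<and> bilinear_alt (apply2 t)"
proof -
  have "alternating 2 t \<longleftrightarrow> (\<forall>u. apply2 t u u = 0)" if eq: "\<forall>v. t v = apply2 t (v 0) (v 1)"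
  proof
    assume a: "alternating 2 t"
    show "\<forall>u. apply2 t u u = 0"
    proof
      fix u
      have "t (\<lambda>_. u) = 0" using a unfolding alternating_def by (metis one_less_numeral_iff pos2 semiring_norm(76) zero_neq_one)
      then show "apply2 t u u = 0" using eq by metis
    qed
  next
    assume a: "\<forall>u. apply2 t u u = 0"
    show "alternating 2 t" unfolding alternating_def
    proof (intro allI impI)
      fix v :: "nat \<Rightarrow> real^3" and i j :: nat
      assume ij: "i < 2" "j < 2" "i \<noteq> j \<and> v i = v j"
      then have "v 0 = v 1" by (elim less_2_nat_cases) auto
      then show "t v = 0" using a eq by metis
    qed
  qed
  then show ?thesis unfolding multilinear_2 bilinear_alt_def by blast
qed

lemma alternating_form_3:
  "multilinear 3 t \<and> alternating 3 t \<longleftrightarrow> (\<forall>v. t v = apply3 t (v 0) (v 1) (v 2)) \<and> trilinear_alt (apply3 t)"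
proof -
  have "alternating 3 t \<longleftrightarrow> (\<forall>u w. apply3 t u u w = 0 \<and> apply3 t w u u = 0 \<and> apply3 t u w u = 0)"
    if eq: "\<forall>v. t v = apply3 t (v 0) (v 1) (v 2)"
  proof
    assume a: "alternating 3 t"
    let ?v = "\<lambda>a b c. case_nat a (case_nat b (\<lambda>_. c))"
    have a': "v i = v j \<Longrightarrow> i < 3 \<Longrightarrow> j < 3 \<Longrightarrow> i \<noteq> j \<Longrightarrow> t v = 0" for v i j
      using a unfolding alternating_def by blast
    show "\<forall>u w. apply3 t u u w = 0 \<and> apply3 t w u u = 0 \<and> apply3 t u w u = 0"
      using a'[of "?v _ _ _" 0 1] a'[of "?v _ _ _" 1 2] a'[of "?v _ _ _" 0 2]
      by (simp add: apply3_def numeral_2_eq_2)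
  next
    assume a: "\<forall>u w. apply3 t u u w = 0 \<and> apply3 t w u u = 0 \<and> apply3 t u w u = 0"
    show "alternating 3 t" unfolding alternating_def
    proof (intro allI impI)
      fix v :: "nat \<Rightarrow> real^3" and i j :: nat
      assume ij: "i < 3" "j < 3" "i \<noteq> j \<and> v i = v j"
      then have "v 0 = v 1 \<or> v 1 = v 2 \<or> v 0 = v 2" by (elim less_3_nat_cases) auto
      then show "t v = 0" using a eq[rule_format, of v] by (elim disjE) simp_all
    qed
  qed
  then show ?thesis unfolding multilinear_3 trilinear_alt_def by blast
qed

lemma bilinear_alt_swap:
  assumes "bilinear_alt b"
  shows "b v u = - b u v"
proof -
  note l = bilinear_altD(1,2)[OF assms] and z = bilinear_altD(3)[OF assms]
  have "b (u + v) (u + v) = b u u + b u v + (b v u + b v v)"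
    by (simp add: linear_add[OF l(1)] linear_add[OF l(2)])
  then show ?thesis using z by simp
qed

lemma trilinear_alt_swap:
  assumes "trilinear_alt t"
  shows "t v u w = - t u v w" "t u w v = - t u v w"
proof -
  have "bilinear_alt (\<lambda>u v. t u v w)" "bilinear_alt (t u)"
    unfolding bilinear_alt_def using trilinear_altD[OF assms] by auto
  from bilinear_alt_swap[OF this(1), of v u] bilinear_alt_swap[OF this(2), of w v]
  show "t v u w = - t u v w" "t u w v = - t u v w" by blast+
qed

abbreviation e1 :: "real^3" where "e1 \<equiv> axis 1 1"
abbreviation e2 :: "real^3" where "e2 \<equiv> axis 2 1"
abbreviation e3 :: "real^3" where "e3 \<equiv> axis 3 1"

lemma basis_expansion_3: "u = u $ 1 *\<^sub>R e1 + u $ 2 *\<^sub>R e2 + u $ 3 *\<^sub>R e3"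
  by (simp add: vec_eq_iff axis_def forall_3)

lemma frame_simps [simp]: "frame 0 = e1" "frame 1 = e2" "frame (Suc 0) = e2" "frame 2 = e3"
  by (simp_all add: frame_def numeral_2_eq_2 numeral_3_eq_3)

lemma linear_basis_3:
  assumes "linear (f :: real^3 \<Rightarrow> real)"
  shows "f u = u $ 1 * f e1 + u $ 2 * f e2 + u $ 3 * f e3"
  by (subst basis_expansion_3) (simp add: linear_add[OF assms] linear_cmul[OF assms])

text \<open>Alternating trilinear forms on a three-dimensional space form a line. A three-form in a
  chart is therefore determined by its value on the coordinate frame, which is all that
  \<open>integral_over\<close> reads.\<close>

lemma trilinear_alt_det:
  assumes t: "trilinear_alt t"
  shows "t u v w = det (vector [u, v, w]) * t e1 e2 e3"
proof -
  note l = trilinear_altD(1-3)[OF t] and z = trilinear_altD(4-6)[OF t]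
  have s: "t e2 e1 e3 = - t e1 e2 e3" "t e1 e3 e2 = - t e1 e2 e3" "t e3 e2 e1 = - t e1 e2 e3"
    "t e2 e3 e1 = t e1 e2 e3" "t e3 e1 e2 = t e1 e2 e3"
    using trilinear_alt_swap[OF t] by (metis minus_minus)+
  show ?thesis
    unfolding linear_basis_3[OF l(1), of u] linear_basis_3[OF l(2), of _ v] linear_basis_3[OF l(3), of _ _ w]
    by (simp add: z s det_3 algebra_simps)
qed

text \<open>A nonzero multiple of the determinant has no nonzero vector in its kernel. Applied with
  the Reeb vector, this reduces identities between three-forms to their contractions with
  \<xi>.\<close>

lemma trilinear_alt_eq_0:
  assumes t: "trilinear_alt t" and "\<xi> \<noteq> 0" "\<And>v w. t \<xi> v w = 0"
  shows "t u v w = 0"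
proof -
  have "det (vector [\<xi>, v, w] :: real^3^3) * t e1 e2 e3 = 0" for v w
    using assms(3)[of v w] trilinear_alt_det[OF t, of \<xi> v w] by simp
  \<comment> \<open>The three determinants are the coordinates of \<xi>, and one of them is
    nonzero.\<close>
  from this[of e2 e3] this[of e3 e1] this[of e1 e2] assms(2) have "t e1 e2 e3 = 0"
    by (auto simp: det_3 axis_def vec_eq_iff forall_3)
  then show ?thesis using trilinear_alt_det[OF t, of u v w] by simp
qed

text \<open>In dimension three an alternating bilinear form is the contraction of the determinant
  with a vector; its coordinates are the values on the cyclically ordered pairs of basis
  vectors.\<close>

lemma bilinear_alt_cross:
  assumes b: "bilinear_alt b"
  shows "b u v = det (vector [vector [b e2 e3, b e3 e1, b e1 e2], u, v])"
proof -
  note l = bilinear_altD(1,2)[OF b] and z = bilinear_altD(3)[OF b]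
  show ?thesis
    unfolding linear_basis_3[OF l(1), of u] linear_basis_3[OF l(2), of _ v]
    by (simp add: z bilinear_alt_swap[OF b, of e1 e2] bilinear_alt_swap[OF b, of e2 e3] bilinear_alt_swap[OF b, of e1 e3] det_3 algebra_simps)
qed

section \<open>Wedge products and the Hodge star in low degrees\<close>

lemma wedge_1_1:
  assumes "multilinear 1 (\<alpha> c x)" "multilinear 1 (\<beta> c x)"
  shows "wedge 1 1 \<alpha> \<beta> c x v =
    apply1 (\<alpha> c x) (v 0) * apply1 (\<beta> c x) (v 1) - apply1 (\<alpha> c x) (v 1) * apply1 (\<beta> c x) (v 0)"
proof -
  have \<alpha>: "\<alpha> c x w = apply1 (\<alpha> c x) (w 0)" and \<beta>: "\<beta> c x w = apply1 (\<beta> c x) (w 0)" for w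
    using assms by (simp_all only: multilinear_1)
  have f: "finite {1::nat}" "0 \<notin> {1::nat}" by auto
  have "{..<1 + 1::nat} = {0, 1}" by auto
  then show ?thesis
    unfolding wedge_def \<alpha>[of "\<lambda>i. v (_ i)"] \<beta>[of "\<lambda>i. v (_ (1 + i))"]
    by (simp only: sum_over_permutations_insert[OF f] permutes_sing)
       (simp add: sign_swap_id sign_id)
qed

text \<open>The six permutations pair off: exchanging the two arguments of \<beta> changes the sign
  of the permutation and that of the value, and the resulting factor 2 cancels the denominator 1!
  2!.\<close>

lemma wedge_1_2:
  assumes "multilinear 1 (\<alpha> c x)" "multilinear 2 (\<beta> c x)" "alternating 2 (\<beta> c x)"
  shows "wedge 1 2 \<alpha> \<beta> c x v =
    apply1 (\<alpha> c x) (v 0) * apply2 (\<beta> c x) (v 1) (v 2) +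
    apply1 (\<alpha> c x) (v 1) * apply2 (\<beta> c x) (v 2) (v 0) +
    apply1 (\<alpha> c x) (v 2) * apply2 (\<beta> c x) (v 0) (v 1)"
proof -
  have \<alpha>: "\<alpha> c x w = apply1 (\<alpha> c x) (w 0)" for w
    using assms(1) by (simp only: multilinear_1)
  have \<beta>: "\<beta> c x w = apply2 (\<beta> c x) (w 0) (w 1)" for w
    using assms(2) by (simp only: multilinear_2)
  have alt: "bilinear_alt (apply2 (\<beta> c x))" using assms alternating_form_2 by blast
  have f123: "finite {1, 2::nat}" "0 \<notin> {1, 2::nat}" and f23: "finite {2::nat}" "1 \<notin> {2::nat}" by auto
  have "{..<1 + 2::nat} = {0, 1, 2}" by auto
  then show ?thesis
    unfolding wedge_def \<alpha>[of "\<lambda>i. v (_ i)"] \<beta>[of "\<lambda>i. v (_ (1 + i))"]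
    by (simp only: sum_over_permutations_insert[OF f123] sum_over_permutations_insert[OF f23] permutes_sing)
       (simp add: sign_swap_id permutation_swap_id sign_compose sign_id swap_id_eq numeral_2_eq_2
          bilinear_alt_swap[OF alt, of "v (Suc 0)" "v (Suc (Suc 0))"]
          bilinear_alt_swap[OF alt, of "v (Suc (Suc 0))" "v 0"]
          bilinear_alt_swap[OF alt, of "v 0" "v (Suc 0)"] fact_2 field_simps)
qed

lemma wedge_1_0:
  assumes "multilinear 1 (\<alpha> c x)" "\<And>v w. \<beta> c x v = \<beta> c x w"
  shows "wedge 1 0 \<alpha> \<beta> c x v = apply1 (\<alpha> c x) (v 0) * \<beta> c x v"
proof -
  have \<alpha>: "\<alpha> c x w = apply1 (\<alpha> c x) (w 0)" for w
    using assms(1) by (simp only: multilinear_1)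
  have "{..<1 + 0::nat} = {0}" by auto
  then show ?thesis
    unfolding wedge_def by (simp only: permutes_sing) (simp add: sign_id \<alpha>[of v] assms(2)[of "\<lambda>i. v (Suc i)" v])
qed

text \<open>Splits off the last entry of a multi-index. Iterated, it turns the sums over
  multi-indices in \<open>hodge\<close> into nested sums over the three coordinates.\<close>

lemma sum_PiE_Suc:
  assumes "finite S"
  shows "(\<Sum>a\<in>{..<Suc k} \<rightarrow>\<^sub>E S. f a) = (\<Sum>s\<in>S. \<Sum>a\<in>{..<k} \<rightarrow>\<^sub>E S. f (a(k := s)))"
proof -
  have "inj_on (\<lambda>(s, a). a(k := s)) (S \<times> ({..<k} \<rightarrow>\<^sub>E S))"
    by (rule inj_combinator) simp
  then show ?thesis
    unfolding lessThan_Suc PiE_insert_eq sum.cartesian_product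
    by (subst sum.reindex) (auto simp: case_prod_unfold)
qed

lemma trilinear_alt_det_vector: "trilinear_alt (\<lambda>u v w. det (vector [u, v, w] :: real^3^3))"
  unfolding trilinear_alt_def
  by (auto intro!: linearI simp: det_3 algebra_simps)

text \<open>The left side is alternating and trilinear in u, v, w, hence a multiple of the
  determinant; the factor is its value on the basis vectors, whose images are the columns of
  \<open>M\<close>.\<close>

lemma det_vector_matrix_mult:
  fixes M :: "real^3^3"
  shows "det (vector [M *v u, M *v v, M *v w] :: real^3^3) = det M * det (vector [u, v, w] :: real^3^3)"
proof -
  have "trilinear_alt (\<lambda>u v w. det (vector [M *v u, M *v v, M *v w] :: real^3^3))"
    using trilinear_alt_det_vector unfolding trilinear_alt_def
    by (auto intro!: linearI simp: det_3 algebra_simps matrix_vector_right_distrib matrix_vector_mult_scaleR)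
  from trilinear_alt_det[OF this, of u v w] show ?thesis
    by (simp add: det_3 matrix_vector_mult_def sum_3 axis_def algebra_simps)
qed

lemma det_vector_frame: "det (vector [e1, e2, e3] :: real^3^3) = 1"
  by (simp add: det_3 axis_def)

lemma matrix_inv_symmetric:
  fixes G :: "real^3^3"
  assumes "transpose G = G" "det G \<noteq> 0"
  shows "G ** matrix_inv G = mat 1" "matrix_inv G ** G = mat 1"
    "transpose (matrix_inv G) = matrix_inv G" "det (matrix_inv G) = 1 / det G"
proof -
  have "invertible G" using assms(2) by (simp add: invertible_det_nz)
  then have "G ** matrix_inv G = mat 1 \<and> matrix_inv G ** G = mat 1"
    unfolding invertible_def matrix_inv_def by (rule someI_ex)
  then show 1: "G ** matrix_inv G = mat 1" "matrix_inv G ** G = mat 1" by simp_all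
  have "transpose (matrix_inv G) ** transpose G = mat 1"
    unfolding matrix_transpose_mul[symmetric] 1(1) by (rule transpose_mat)
  then have "transpose (matrix_inv G) ** G = mat 1" by (simp only: assms(1))
  then have "transpose (matrix_inv G) ** G ** matrix_inv G = matrix_inv G"
    by (simp only: matrix_mul_lid)
  then show "transpose (matrix_inv G) = matrix_inv G"
    by (simp only: 1 matrix_mul_rid flip: matrix_mul_assoc)
  show "det (matrix_inv G) = 1 / det G"
    using arg_cong[OF 1(1), of det] assms(2) by (simp add: det_mul field_simps)
qed

lemma volume_form_apply:
  "volume_form \<mu> g c x v =
    sgn (\<mu> c x frame) * sqrt (det (gram g c x)) * det (vector [v 0, v 1, v 2] :: real^3^3)"
  by (simp add: volume_form_def)

text \<open>Here \<beta> is the metric dual of u. Raising its index returns u, so \<star>\<beta> is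
  the contraction of the volume with u.\<close>

lemma hodge_1:
  assumes G: "transpose (gram g c x) = gram g c x" "det (gram g c x) \<noteq> 0"
    and \<beta>: "\<And>v. apply1 (\<beta> c x) v = u \<bullet> (gram g c x *v v)" "multilinear 1 (\<beta> c x)"
  shows "hodge \<mu> g 1 \<beta> c x w =
    sgn (\<mu> c x frame) * sqrt (det (gram g c x)) * det (vector [u, w 0, w 1] :: real^3^3)"
proof -
  define M where "M = matrix_inv (gram g c x)"
  define p where "p = gram g c x *v u"
  define \<sigma> where "\<sigma> = sgn (\<mu> c x frame) * sqrt (det (gram g c x))"
  have \<beta>': "\<beta> c x v = p \<bullet> v 0" for v
  proof -
    have "\<beta> c x v = u \<bullet> (gram g c x *v v 0)" using \<beta> by (simp only: multilinear_1)
    then show ?thesis by (simp add: p_def dot_lmul_matrix[symmetric] G flip: transpose_matrix_vector)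
  qed
  have "M *v p = u" using matrix_inv_symmetric[OF G] by (simp add: M_def p_def matrix_vector_mul_assoc)
  moreover have "transpose M = M" using matrix_inv_symmetric[OF G] by (simp add: M_def)
  ultimately have "transpose M *v p = u" by simp
  moreover have "(\<Sum>a\<in>UNIV. M $ a $ b * p $ a) = (transpose M *v p) $ b" for b
    by (simp add: matrix_vector_mult_def transpose_def)
  ultimately have key: "(\<Sum>a\<in>UNIV. M $ a $ b * p $ a) = u $ b" for b by simp
  have "hodge \<mu> g 1 \<beta> c x w = (\<Sum>a\<in>UNIV. \<Sum>b\<in>UNIV. M $ a $ b * p $ a * (\<sigma> * det (vector [axis b 1, w 0, w 1] :: real^3^3)))"
    unfolding hodge_def One_nat_def sum_PiE_Suc[OF finite_class.finite_UNIV] volume_form_apply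
    by (simp add: \<beta>' M_def \<sigma>_def inner_axis numeral_2_eq_2)
  also have "\<dots> = (\<Sum>b\<in>UNIV. (\<Sum>a\<in>UNIV. M $ a $ b * p $ a) * (\<sigma> * det (vector [axis b 1, w 0, w 1] :: real^3^3)))"
    unfolding sum_distrib_right by (rule sum.swap)
  also have "\<dots> = \<sigma> * det (vector [u, w 0, w 1] :: real^3^3)"
    unfolding key by (simp add: sum_3 det_3 axis_def algebra_simps)
  finally show ?thesis by (simp add: \<sigma>_def)
qed

text \<open>Raising both indices of the contraction of the determinant with u gives det(G)^-1 times
  the contraction with the covector p = Gu, and pairing this with the volume leaves a multiple of p.
  The minus sign stems from the reversed order \<open>b (k - 1 - r)\<close> in \<open>hodge\<close>;
  it is the origin of \<star>\<star> = -1 on two-forms.\<close>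

lemma hodge_2:
  assumes G: "transpose (gram g c x) = gram g c x" "det (gram g c x) \<noteq> 0"
    and \<beta>: "\<And>v w. apply2 (\<beta> c x) v w = \<tau> * det (vector [u, v, w] :: real^3^3)" "multilinear 2 (\<beta> c x)"
  shows "hodge \<mu> g 2 \<beta> c x w =
    - (sgn (\<mu> c x frame) * sqrt (det (gram g c x)) * \<tau> / det (gram g c x) * (u \<bullet> (gram g c x *v w 0)))"
proof -
  define M where "M = matrix_inv (gram g c x)"
  define p where "p = gram g c x *v u"
  define \<sigma> where "\<sigma> = sgn (\<mu> c x frame) * sqrt (det (gram g c x))"
  have \<beta>': "\<beta> c x v = \<tau> * det (vector [u, v 0, v 1] :: real^3^3)" for v
    using \<beta> by (simp only: multilinear_2)
  have Mp: "u = M *v p" using matrix_inv_symmetric[OF G] by (simp add: M_def p_def matrix_vector_mul_assoc)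
  \<comment> \<open>Raising the indices applies \<open>M\<close> to the second and third vectors of
    the determinant. As u = Mp, the first one carries \<open>M\<close> as well and det M can be
    pulled out.\<close>
  have key: "(\<Sum>a0\<in>UNIV. \<Sum>a1\<in>UNIV. M $ a0 $ b0 * M $ a1 $ b1 * det (vector [u, axis a0 1, axis a1 1] :: real^3^3)) =
      det M * det (vector [p, axis b0 1, axis b1 1] :: real^3^3)" for b0 b1
  proof -
    define m where "m b = M *v axis b 1" for b
    have m: "m b $ a = M $ a $ b" for a b
      by (simp add: m_def matrix_vector_mult_basis column_def)
    show ?thesis
      unfolding det_vector_matrix_mult[symmetric] Mp[symmetric] m_def[symmetric]
      by (simp add: sum_3 det_3 m axis_def algebra_simps)
  qed
  let ?d = "\<lambda>u v w. det (vector [u, v, w] :: real^3^3)"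
  have "hodge \<mu> g 2 \<beta> c x w = (\<Sum>a1\<in>UNIV. \<Sum>a0\<in>UNIV. \<Sum>b1\<in>UNIV. \<Sum>b0\<in>UNIV.
      M $ a0 $ b0 * M $ a1 $ b1 * (\<tau> * ?d u (axis a0 1) (axis a1 1)) * (\<sigma> * ?d (axis b1 1) (axis b0 1) (w 0))) / 2"
    unfolding hodge_def numeral_2_eq_2 sum_PiE_Suc[OF finite_class.finite_UNIV] volume_form_apply
    by (simp add: \<beta>' M_def \<sigma>_def)
  also have "\<dots> = (\<Sum>b1\<in>UNIV. \<Sum>b0\<in>UNIV.
      (\<Sum>a0\<in>UNIV. \<Sum>a1\<in>UNIV. M $ a0 $ b0 * M $ a1 $ b1 * ?d u (axis a0 1) (axis a1 1)) *
      (\<sigma> * \<tau> * ?d (axis b1 1) (axis b0 1) (w 0))) / 2"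
    by (simp add: sum_3 algebra_simps)
  also have "\<dots> = (\<Sum>b1\<in>UNIV. \<Sum>b0\<in>UNIV. det M * ?d p (axis b0 1) (axis b1 1) *
      (\<sigma> * \<tau> * ?d (axis b1 1) (axis b0 1) (w 0))) / 2"
    unfolding key ..
  also have "\<dots> = - (\<sigma> * \<tau> * det M * (p \<bullet> w 0))"
  proof -
    \<comment> \<open>Contracting two determinants over two indices gives twice the inner product of
      the remaining vectors. The order b1, b0 in the second one makes the result negative, and the 2
      cancels \<open>fact 2\<close>.\<close>
    have "(\<Sum>b1\<in>UNIV. \<Sum>b0\<in>UNIV. D * ?d p (axis b0 1) (axis b1 1) * (\<sigma> * \<tau> * ?d (axis b1 1) (axis b0 1) (w 0))) =
        2 * - (\<sigma> * \<tau> * D * (p \<bullet> w 0))" for D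
      by (simp add: sum_3 det_3 axis_def inner_vec_def algebra_simps)
    then show ?thesis by simp
  qed
  also have "p \<bullet> w 0 = u \<bullet> (gram g c x *v w 0)"
    by (simp add: p_def dot_lmul_matrix[symmetric] G flip: transpose_matrix_vector)
  also have "det M = 1 / det (gram g c x)" using matrix_inv_symmetric[OF G] by (simp add: M_def)
  finally show ?thesis by (simp add: \<sigma>_def)
qed

lemma bilinear_alt_wedge_1_1:
  assumes "linear a" "linear b"
  shows "bilinear_alt (\<lambda>u v. a u * b v - a v * b u)"
  unfolding bilinear_alt_def
  by (auto intro!: linearI simp: linear_add[OF assms(1)] linear_add[OF assms(2)]
      linear_cmul[OF assms(1)] linear_cmul[OF assms(2)] algebra_simps)

lemma trilinear_alt_wedge_1_2:
  assumes "linear a" "bilinear_alt b"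
  shows "trilinear_alt (\<lambda>u v w. a u * b v w + a v * b w u + a w * b u v)"
proof -
  note l = bilinear_altD(1,2)[OF assms(2)] and z = bilinear_altD(3)[OF assms(2)]
  have s: "a u * b u w + a u * b w u = 0" "a u * b w u + a u * b u w = 0" for u w
    using bilinear_alt_swap[OF assms(2), of u w] by simp_all
  show ?thesis
    unfolding trilinear_alt_def
    by (intro conjI allI linearI)
       (auto simp: linear_add[OF assms(1)] linear_cmul[OF assms(1)] linear_add[OF l(1)] linear_add[OF l(2)]
          linear_cmul[OF l(1)] linear_cmul[OF l(2)] z s algebra_simps)
qed

section \<open>Differential forms in charts\<close>

context atlas
begin

section \<open>Forms under change of chart, and the exterior derivative\<close>

lemma transition_in_img: "c \<in> \<A> \<Longrightarrow> c' \<in> \<A> \<Longrightarrow> x \<in> overlap c c' \<Longrightarrow> transition c c' x \<in> img c'"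
  using transition_image[of c c'] overlap_subset[of c' c] by blast

lemma linear_transition_derivative:
  "c \<in> \<A> \<Longrightarrow> c' \<in> \<A> \<Longrightarrow> x \<in> overlap c c' \<Longrightarrow> linear (frechet_derivative (transition c c') (at x))"
  using linear_frechet_derivative smooth_on_differentiable[OF smooth_on_transition] by blast

lemma tensor_fieldD:
  assumes "tensor_field \<A> k T" "c \<in> \<A>"
  shows "x \<in> img c \<Longrightarrow> multilinear k (T c x)" "smooth_on (img c) (\<lambda>x. T c x v)"
  using assms unfolding tensor_field_def by blast+

lemma tensor_field_natural:
  assumes "tensor_field \<A> k T" "c \<in> \<A>" "c' \<in> \<A>" "x \<in> overlap c c'"
  shows "T c x v = T c' (transition c c' x) (\<lambda>i. frechet_derivative (transition c c') (at x) (v i))"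
  using assms unfolding tensor_field_def by blast

lemma diff_formD:
  assumes "diff_form \<A> k T" "c \<in> \<A>" "x \<in> img c"
  shows "multilinear k (T c x)" "alternating k (T c x)"
  using assms unfolding diff_form_def tensor_field_def by blast+

lemma diff_form_1_linear:
  assumes "diff_form \<A> 1 T" "c \<in> \<A>" "x \<in> img c"
  shows "linear (apply1 (T c x))" "T c x v = apply1 (T c x) (v 0)"
  using diff_formD(1)[OF assms] by (simp_all only: multilinear_1)

lemma diff_form_2_bilinear:
  assumes "diff_form \<A> 2 T" "c \<in> \<A>" "x \<in> img c"
  shows "bilinear_alt (apply2 (T c x))" "T c x v = apply2 (T c x) (v 0) (v 1)"
  using diff_formD[OF assms] alternating_form_2[of "T c x"] by blast+

lemma diff_form_3_trilinear:
  assumes "diff_form \<A> 3 T" "c \<in> \<A>" "x \<in> img c"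
  shows "trilinear_alt (apply3 (T c x))" "T c x v = apply3 (T c x) (v 0) (v 1) (v 2)"
  using diff_formD[OF assms] alternating_form_3[of "T c x"] by blast+

lemma diff_form_smooth: "diff_form \<A> k T \<Longrightarrow> c \<in> \<A> \<Longrightarrow> smooth_on (img c) (\<lambda>x. T c x v)"
  unfolding diff_form_def using tensor_fieldD(2) by blast

lemma diff_form_1_smooth: "diff_form \<A> 1 T \<Longrightarrow> c \<in> \<A> \<Longrightarrow> smooth_on (img c) (\<lambda>x. apply1 (T c x) v)"
  unfolding apply1_def by (rule diff_form_smooth)

lemma diff_form_2_smooth: "diff_form \<A> 2 T \<Longrightarrow> c \<in> \<A> \<Longrightarrow> smooth_on (img c) (\<lambda>x. apply2 (T c x) v w)"
  unfolding apply2_def by (rule diff_form_smooth)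

lemma diff_form_natural:
  assumes "diff_form \<A> k T" "c \<in> \<A>" "c' \<in> \<A>" "x \<in> overlap c c'"
  shows "T c x v = T c' (transition c c' x) (\<lambda>i. frechet_derivative (transition c c') (at x) (v i))"
  using tensor_field_natural assms unfolding diff_form_def by blast

lemma diff_form_1_natural:
  assumes "diff_form \<A> 1 T" "c \<in> \<A>" "c' \<in> \<A>" "x \<in> overlap c c'"
  shows "apply1 (T c x) v = apply1 (T c' (transition c c' x)) (frechet_derivative (transition c c') (at x) v)"
  unfolding apply1_def by (rule diff_form_natural[OF assms])

lemma diff_form_2_natural:
  assumes "diff_form \<A> 2 T" "c \<in> \<A>" "c' \<in> \<A>" "x \<in> overlap c c'"
  shows "apply2 (T c x) v w = apply2 (T c' (transition c c' x))
    (frechet_derivative (transition c c') (at x) v) (frechet_derivative (transition c c') (at x) w)"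
proof -
  have "(\<lambda>i. frechet_derivative (transition c c') (at x) (case_nat v (\<lambda>_. w) i)) =
      case_nat (frechet_derivative (transition c c') (at x) v) (\<lambda>_. frechet_derivative (transition c c') (at x) w)"
    by (auto split: nat.split)
  then show ?thesis unfolding apply2_def diff_form_natural[OF assms] by simp
qed

lemma diff_form_3_det:
  assumes "diff_form \<A> 3 T" "c \<in> \<A>" "x \<in> img c"
  shows "T c x v = det (vector [v 0, v 1, v 2] :: real^3^3) * T c x frame"
proof -
  have "T c x frame = apply3 (T c x) e1 e2 e3"
    unfolding diff_form_3_trilinear(2)[OF assms, of frame] by simp
  then show ?thesis
    unfolding diff_form_3_trilinear(2)[OF assms, of v]
    by (simp only: trilinear_alt_det[OF diff_form_3_trilinear(1)[OF assms], of "v 0" "v 1" "v 2"])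
qed

text \<open>Naturality evaluates the form on the images of the coordinate frame under the
  differential of the transition, and the determinant of these images is the Jacobian.\<close>

lemma diff_form_3_natural:
  assumes "diff_form \<A> 3 T" "c \<in> \<A>" "c' \<in> \<A>" "x \<in> overlap c c'"
  shows "T c x frame = det (matrix (frechet_derivative (transition c c') (at x))) * T c' (transition c c' x) frame"
proof -
  let ?D = "frechet_derivative (transition c c') (at x)"
  have "det (vector [?D e1, ?D e2, ?D e3] :: real^3^3) = det (matrix ?D)"
    using det_vector_matrix_mult[of "matrix ?D" e1 e2 e3] linear_transition_derivative[OF assms(2-4)]
    by (simp add: matrix_works det_vector_frame)
  moreover have "T c x frame =
      det (vector [?D (frame 0), ?D (frame 1), ?D (frame 2)] :: real^3^3) * T c' (transition c c' x) frame"
    by (rule trans[OF diff_form_natural[OF assms] diff_form_3_det[OF assms(1,3) transition_in_img[OF assms(2-4)]]])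
  ultimately show ?thesis by (simp only: frame_simps)
qed

text \<open>\<open>wedge\<close> merely permutes the arguments of its factors, so transporting each
  argument by the differential passes through it in every degree.\<close>

lemma wedge_natural:
  assumes "diff_form \<A> k \<alpha>" "diff_form \<A> l \<beta>" "c \<in> \<A>" "c' \<in> \<A>" "x \<in> overlap c c'"
  shows "wedge k l \<alpha> \<beta> c x v =
    wedge k l \<alpha> \<beta> c' (transition c c' x) (\<lambda>i. frechet_derivative (transition c c') (at x) (v i))"
  unfolding wedge_def
    diff_form_natural[OF assms(1,3-5), of "\<lambda>i. v (_ i)"] diff_form_natural[OF assms(2,3-5), of "\<lambda>i. v (_ (k + i))"] ..

lemma diff_form_2I:
  assumes "\<And>c x v. c \<in> \<A> \<Longrightarrow> x \<in> img c \<Longrightarrow> T c x v = b c x (v 0) (v 1)"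
    and "\<And>c x. c \<in> \<A> \<Longrightarrow> x \<in> img c \<Longrightarrow> bilinear_alt (b c x)"
    and "\<And>c u v. c \<in> \<A> \<Longrightarrow> smooth_on (img c) (\<lambda>x. b c x u v)"
    and "\<And>c c' x v. c \<in> \<A> \<Longrightarrow> c' \<in> \<A> \<Longrightarrow> x \<in> overlap c c' \<Longrightarrow>
      T c x v = T c' (transition c c' x) (\<lambda>i. frechet_derivative (transition c c') (at x) (v i))"
  shows "diff_form \<A> 2 T"
proof -
  have "multilinear 2 (T c x) \<and> alternating 2 (T c x)" if "c \<in> \<A>" "x \<in> img c" for c x
  proof -
    have "apply2 (T c x) = b c x" by (intro ext) (simp add: apply2_def assms(1)[OF that])
    then show ?thesis unfolding alternating_form_2 using assms(1,2)[OF that] by simp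
  qed
  moreover have "smooth_on (img c) (\<lambda>x. T c x v)" if "c \<in> \<A>" for c v
    by (rule smooth_on_cong[OF open_img[OF that] assms(1)[OF that, symmetric] assms(3)[OF that]])
  ultimately show ?thesis unfolding diff_form_def tensor_field_def using assms(4) by blast
qed

lemma diff_form_3I:
  assumes "\<And>c x v. c \<in> \<A> \<Longrightarrow> x \<in> img c \<Longrightarrow> T c x v = b c x (v 0) (v 1) (v 2)"
    and "\<And>c x. c \<in> \<A> \<Longrightarrow> x \<in> img c \<Longrightarrow> trilinear_alt (b c x)"
    and "\<And>c u v w. c \<in> \<A> \<Longrightarrow> smooth_on (img c) (\<lambda>x. b c x u v w)"
    and "\<And>c c' x v. c \<in> \<A> \<Longrightarrow> c' \<in> \<A> \<Longrightarrow> x \<in> overlap c c' \<Longrightarrow>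
      T c x v = T c' (transition c c' x) (\<lambda>i. frechet_derivative (transition c c') (at x) (v i))"
  shows "diff_form \<A> 3 T"
proof -
  have "multilinear 3 (T c x) \<and> alternating 3 (T c x)" if "c \<in> \<A>" "x \<in> img c" for c x
  proof -
    have "apply3 (T c x) = b c x" by (intro ext) (simp add: apply3_def assms(1)[OF that] numeral_2_eq_2)
    then show ?thesis unfolding alternating_form_3 using assms(1,2)[OF that] by simp
  qed
  moreover have "smooth_on (img c) (\<lambda>x. T c x v)" if "c \<in> \<A>" for c v
    by (rule smooth_on_cong[OF open_img[OF that] assms(1)[OF that, symmetric] assms(3)[OF that]])
  ultimately show ?thesis unfolding diff_form_def tensor_field_def using assms(4) by blast
qed

lemma diff_form_wedge_1_1:
  assumes "diff_form \<A> 1 \<alpha>" "diff_form \<A> 1 \<beta>"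
  shows "diff_form \<A> 2 (wedge 1 1 \<alpha> \<beta>)"
proof (rule diff_form_2I)
  fix c x v assume c: "c \<in> \<A>" and x: "x \<in> img c"
  show "wedge 1 1 \<alpha> \<beta> c x v = apply1 (\<alpha> c x) (v 0) * apply1 (\<beta> c x) (v 1) - apply1 (\<alpha> c x) (v 1) * apply1 (\<beta> c x) (v 0)"
    by (rule wedge_1_1[of \<alpha> c x \<beta>, OF diff_formD(1)[OF assms(1) c x] diff_formD(1)[OF assms(2) c x]])
next
  fix c x assume c: "c \<in> \<A>" and x: "x \<in> img c"
  show "bilinear_alt (\<lambda>u v. apply1 (\<alpha> c x) u * apply1 (\<beta> c x) v - apply1 (\<alpha> c x) v * apply1 (\<beta> c x) u)"
    by (rule bilinear_alt_wedge_1_1[OF diff_form_1_linear(1)[OF assms(1) c x] diff_form_1_linear(1)[OF assms(2) c x]])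
next
  fix c u v assume c: "c \<in> \<A>"
  show "smooth_on (img c) (\<lambda>x. apply1 (\<alpha> c x) u * apply1 (\<beta> c x) v - apply1 (\<alpha> c x) v * apply1 (\<beta> c x) u)"
    using c by (intro smooth_on_diff smooth_on_mult open_img diff_form_1_smooth[OF assms(1)] diff_form_1_smooth[OF assms(2)])
qed (rule wedge_natural[OF assms])

lemma diff_form_wedge_1_2:
  assumes "diff_form \<A> 1 \<alpha>" "diff_form \<A> 2 \<beta>"
  shows "diff_form \<A> 3 (wedge 1 2 \<alpha> \<beta>)"
proof (rule diff_form_3I)
  fix c x v assume c: "c \<in> \<A>" and x: "x \<in> img c"
  show "wedge 1 2 \<alpha> \<beta> c x v = apply1 (\<alpha> c x) (v 0) * apply2 (\<beta> c x) (v 1) (v 2) +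
      apply1 (\<alpha> c x) (v 1) * apply2 (\<beta> c x) (v 2) (v 0) + apply1 (\<alpha> c x) (v 2) * apply2 (\<beta> c x) (v 0) (v 1)"
    by (rule wedge_1_2[of \<alpha> c x \<beta>, OF diff_formD(1)[OF assms(1) c x] diff_formD[OF assms(2) c x]])
next
  fix c x assume c: "c \<in> \<A>" and x: "x \<in> img c"
  show "trilinear_alt (\<lambda>u v w. apply1 (\<alpha> c x) u * apply2 (\<beta> c x) v w +
      apply1 (\<alpha> c x) v * apply2 (\<beta> c x) w u + apply1 (\<alpha> c x) w * apply2 (\<beta> c x) u v)"
    by (rule trilinear_alt_wedge_1_2[OF diff_form_1_linear(1)[OF assms(1) c x] diff_form_2_bilinear(1)[OF assms(2) c x]])
next
  fix c u v w assume c: "c \<in> \<A>"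
  show "smooth_on (img c) (\<lambda>x. apply1 (\<alpha> c x) u * apply2 (\<beta> c x) v w +
      apply1 (\<alpha> c x) v * apply2 (\<beta> c x) w u + apply1 (\<alpha> c x) w * apply2 (\<beta> c x) u v)"
    using c by (intro smooth_on_add smooth_on_mult open_img diff_form_1_smooth[OF assms(1)] diff_form_2_smooth[OF assms(2)])
qed (rule wedge_natural[OF assms])

text \<open>Meant for F \<kappa> \<and> A, whose coefficient is a quotient of three-forms and is
  given chart by chart.\<close>

lemma diff_form_2_scale:
  assumes "diff_form \<A> 2 T" "\<And>c. c \<in> \<A> \<Longrightarrow> smooth_on (img c) (F c)"
    "\<And>c c' x. c \<in> \<A> \<Longrightarrow> c' \<in> \<A> \<Longrightarrow> x \<in> overlap c c' \<Longrightarrow> F c x = F c' (transition c c' x)"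
  shows "diff_form \<A> 2 (\<lambda>c x v. F c x * T c x v)"
proof (rule diff_form_2I)
  fix c x v assume c: "c \<in> \<A>" and x: "x \<in> img c"
  show "F c x * T c x v = F c x * apply2 (T c x) (v 0) (v 1)"
    unfolding diff_form_2_bilinear(2)[OF assms(1) c x, of v] ..
next
  fix c x assume c: "c \<in> \<A>" and x: "x \<in> img c"
  note b = diff_form_2_bilinear(1)[OF assms(1) c x]
  show "bilinear_alt (\<lambda>u v. F c x * apply2 (T c x) u v)"
    unfolding bilinear_alt_def
    by (auto intro!: linearI simp: linear_add[OF bilinear_altD(1)[OF b]] linear_add[OF bilinear_altD(2)[OF b]]
      linear_cmul[OF bilinear_altD(1)[OF b]] linear_cmul[OF bilinear_altD(2)[OF b]] bilinear_altD(3)[OF b] algebra_simps)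
next
  fix c u v assume c: "c \<in> \<A>"
  show "smooth_on (img c) (\<lambda>x. F c x * apply2 (T c x) u v)"
    by (rule smooth_on_mult[OF open_img[OF c] assms(2)[OF c] diff_form_2_smooth[OF assms(1) c]])
next
  fix c c' x v assume c: "c \<in> \<A>" "c' \<in> \<A>" "x \<in> overlap c c'"
  show "F c x * T c x v = F c' (transition c c' x) * T c' (transition c c' x) (\<lambda>i. frechet_derivative (transition c c') (at x) (v i))"
    unfolding diff_form_natural[OF assms(1) c, of v] assms(3)[OF c] ..
qed

lemma ext_deriv_1:
  assumes \<alpha>: "diff_form \<A> 1 \<alpha>" and c: "c \<in> \<A>" and x: "x \<in> img c"
  shows "ext_deriv 1 \<alpha> c x v = frechet_derivative (\<lambda>y. apply1 (\<alpha> c y) (v 1)) (at x) (v 0) -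
    frechet_derivative (\<lambda>y. apply1 (\<alpha> c y) (v 0)) (at x) (v 1)"
proof -
  have "frechet_derivative (\<lambda>y. \<alpha> c y w) (at x) = frechet_derivative (\<lambda>y. apply1 (\<alpha> c y) (w 0)) (at x)" for w
    by (rule frechet_derivative_transform_within_open[OF smooth_on_differentiable[OF diff_form_smooth[OF \<alpha> c] x] open_img[OF c] x])
       (rule diff_form_1_linear(2)[OF \<alpha> c])
  then show ?thesis unfolding ext_deriv_def by simp
qed

lemma ext_deriv_2_frame:
  assumes \<alpha>: "diff_form \<A> 2 \<alpha>" and c: "c \<in> \<A>" and x: "x \<in> img c"
  shows "ext_deriv 2 \<alpha> c x frame =
    frechet_derivative (\<lambda>y. apply2 (\<alpha> c y) e2 e3) (at x) e1 +
    frechet_derivative (\<lambda>y. apply2 (\<alpha> c y) e3 e1) (at x) e2 +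
    frechet_derivative (\<lambda>y. apply2 (\<alpha> c y) e1 e2) (at x) e3"
proof -
  have eq: "frechet_derivative (\<lambda>y. \<alpha> c y w) (at x) = frechet_derivative (\<lambda>y. apply2 (\<alpha> c y) (w 0) (w 1)) (at x)" for w
    by (rule frechet_derivative_transform_within_open[OF smooth_on_differentiable[OF diff_form_smooth[OF \<alpha> c] x] open_img[OF c] x])
       (rule diff_form_2_bilinear(2)[OF \<alpha> c])
  \<comment> \<open>The middle term of \<open>ext_deriv\<close> has the sign (-1)^1 and the pair e1,
    e3. Reversing the pair absorbs the sign and gives the cyclic form.\<close>
  have "frechet_derivative (\<lambda>y. apply2 (\<alpha> c y) e1 e3) (at x) =
      (\<lambda>v. - frechet_derivative (\<lambda>y. apply2 (\<alpha> c y) e3 e1) (at x) v)"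
  proof (rule frechet_derivative_at[symmetric], rule has_derivative_transform_within_open[OF _ open_img[OF c] x])
    show "((\<lambda>y. - apply2 (\<alpha> c y) e3 e1) has_derivative
        (\<lambda>v. - frechet_derivative (\<lambda>y. apply2 (\<alpha> c y) e3 e1) (at x) v)) (at x)"
      by (rule has_derivative_minus[OF smooth_on_has_derivative[OF diff_form_2_smooth[OF \<alpha> c] x]])
    show "- apply2 (\<alpha> c y) e3 e1 = apply2 (\<alpha> c y) e1 e3" if "y \<in> img c" for y
      by (rule bilinear_alt_swap[OF diff_form_2_bilinear(1)[OF \<alpha> c that], symmetric])
  qed
  moreover have "frame 2 = e3" by simp
  ultimately show ?thesis
    unfolding ext_deriv_def by (simp add: numeral_2_eq_2 eq)
qed

lemma linear_derivative_form_1: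
  assumes \<alpha>: "diff_form \<A> 1 \<alpha>" and c: "c \<in> \<A>" and x: "x \<in> img c"
  shows "linear (\<lambda>u. frechet_derivative (\<lambda>y. apply1 (\<alpha> c y) u) (at x) v)"
proof (rule linearI)
  note D = smooth_on_has_derivative[OF diff_form_1_smooth[OF \<alpha> c] x]
  note lin = diff_form_1_linear(1)[OF \<alpha> c]
  have "((\<lambda>y. apply1 (\<alpha> c y) (u + w)) has_derivative (\<lambda>v. frechet_derivative (\<lambda>y. apply1 (\<alpha> c y) u) (at x) v +
      frechet_derivative (\<lambda>y. apply1 (\<alpha> c y) w) (at x) v)) (at x)" for u w
    by (rule has_derivative_transform_within_open[OF has_derivative_add[OF D[of u] D[of w]] open_img[OF c] x])
       (simp add: linear_add[OF lin])
  from fun_cong[OF frechet_derivative_at[OF this, symmetric]]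
  show "frechet_derivative (\<lambda>y. apply1 (\<alpha> c y) (u + w)) (at x) v =
    frechet_derivative (\<lambda>y. apply1 (\<alpha> c y) u) (at x) v + frechet_derivative (\<lambda>y. apply1 (\<alpha> c y) w) (at x) v" for u w .
  have "((\<lambda>y. apply1 (\<alpha> c y) (r *\<^sub>R u)) has_derivative (\<lambda>v. r *\<^sub>R frechet_derivative (\<lambda>y. apply1 (\<alpha> c y) u) (at x) v)) (at x)" for u r
    by (rule has_derivative_transform_within_open[OF has_derivative_scaleR_right[OF D[of u]] open_img[OF c] x])
       (simp add: linear_cmul[OF lin])
  from fun_cong[OF frechet_derivative_at[OF this, symmetric]]
  show "frechet_derivative (\<lambda>y. apply1 (\<alpha> c y) (r *\<^sub>R u)) (at x) v =
    r *\<^sub>R frechet_derivative (\<lambda>y. apply1 (\<alpha> c y) u) (at x) v" for u r .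
qed

text \<open>The product rule for \<alpha>(Ty)(DT(y)u): the first summand differentiates the Jacobian
  and so contains the second derivative of the transition, the second one differentiates the form.
  Since DT(y)u varies with y, it is expanded over the basis before differentiating.\<close>

lemma derivative_form_1_transition:
  assumes \<alpha>: "diff_form \<A> 1 \<alpha>" and c: "c \<in> \<A>" "c' \<in> \<A>" "x \<in> overlap c c'"
  defines "T \<equiv> transition c c'"
  shows "frechet_derivative (\<lambda>y. apply1 (\<alpha> c y) u) (at x) v =
    apply1 (\<alpha> c' (T x)) (frechet_derivative (\<lambda>y. frechet_derivative T (at y) u) (at x) v) +
    frechet_derivative (\<lambda>y. apply1 (\<alpha> c' y) (frechet_derivative T (at x) u)) (at (T x)) (frechet_derivative T (at x) v)"
proof -
  note op = open_overlap[OF c(1,2)]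
  note Tx = transition_in_img[OF c(1,2), folded T_def]
  note T = smooth_on_transition[OF c(1,2), folded T_def]
  let ?DT = "\<lambda>y. frechet_derivative T (at y)"
  let ?D = "\<lambda>b. frechet_derivative (\<lambda>y. apply1 (\<alpha> c' y) b) (at (T x))"
  have lin: "linear (apply1 (\<alpha> c' (T y)))" if "y \<in> overlap c c'" for y
    by (rule diff_form_1_linear(1)[OF \<alpha> c(2) Tx[OF that]])
  have comp: "((\<lambda>y. apply1 (\<alpha> c' (T y)) b) has_derivative (\<lambda>v. ?D b (?DT x v))) (at x)" for b
    using diff_chain_at[OF smooth_on_has_derivative[OF T c(3)] smooth_on_has_derivative[OF diff_form_1_smooth[OF \<alpha> c(2)] Tx[OF c(3)]]]
    by (simp only: o_def)
  have coef: "((\<lambda>y. ?DT y u \<bullet> b) has_derivative (\<lambda>v. frechet_derivative (\<lambda>y. ?DT y u) (at x) v \<bullet> b)) (at x)" for b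
    by (rule has_derivative_inner_left[OF smooth_on_has_derivative[OF smooth_on_derivative[OF T] c(3)]])
  have rep: "f w = (\<Sum>b\<in>Basis. (w \<bullet> b) * f b)" if "linear f" for f :: "real^3 \<Rightarrow> real" and w
    using linear_sum[OF that, of "\<lambda>b. (w \<bullet> b) *\<^sub>R b" Basis]
    by (simp add: euclidean_representation linear_cmul[OF that])
  have "((\<lambda>y. \<Sum>b\<in>Basis. (?DT y u \<bullet> b) * apply1 (\<alpha> c' (T y)) b) has_derivative
      (\<lambda>v. \<Sum>b\<in>Basis. (?DT x u \<bullet> b) * ?D b (?DT x v) +
        (frechet_derivative (\<lambda>y. ?DT y u) (at x) v \<bullet> b) * apply1 (\<alpha> c' (T x)) b)) (at x)"
    by (rule has_derivative_sum[OF has_derivative_mult[OF coef comp]])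
  then have "((\<lambda>y. apply1 (\<alpha> c y) u) has_derivative
      (\<lambda>v. \<Sum>b\<in>Basis. (?DT x u \<bullet> b) * ?D b (?DT x v) +
        (frechet_derivative (\<lambda>y. ?DT y u) (at x) v \<bullet> b) * apply1 (\<alpha> c' (T x)) b)) (at x)"
  proof (rule has_derivative_transform_within_open[OF _ op c(3)])
    fix y assume y: "y \<in> overlap c c'"
    show "(\<Sum>b\<in>Basis. (?DT y u \<bullet> b) * apply1 (\<alpha> c' (T y)) b) = apply1 (\<alpha> c y) u"
      by (subst diff_form_1_natural[OF \<alpha> c(1,2) y], fold T_def) (rule rep[OF lin[OF y], symmetric])
  qed
  from fun_cong[OF frechet_derivative_at[OF this, symmetric]]
  have "frechet_derivative (\<lambda>y. apply1 (\<alpha> c y) u) (at x) v = (\<Sum>b\<in>Basis. (?DT x u \<bullet> b) * ?D b (?DT x v) +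
        (frechet_derivative (\<lambda>y. ?DT y u) (at x) v \<bullet> b) * apply1 (\<alpha> c' (T x)) b)" .
  also have "\<dots> = (\<Sum>b\<in>Basis. (?DT x u \<bullet> b) * ?D b (?DT x v)) +
      apply1 (\<alpha> c' (T x)) (frechet_derivative (\<lambda>y. ?DT y u) (at x) v)"
    unfolding sum.distrib rep[OF lin[OF c(3)], symmetric] ..
  also have "(\<Sum>b\<in>Basis. (?DT x u \<bullet> b) * ?D b (?DT x v)) = ?D (?DT x u) (?DT x v)"
    by (rule rep[OF linear_derivative_form_1[OF \<alpha> c(2) Tx[OF c(3)]], symmetric])
  finally show ?thesis by simp
qed

text \<open>The point is naturality. Derivatives of a one-form are not tensorial, but the defect is
  the second derivative of the transition; it is symmetric and drops out of the antisymmetrised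
  expression.\<close>

lemma diff_form_ext_deriv_1:
  assumes \<alpha>: "diff_form \<A> 1 \<alpha>"
  shows "diff_form \<A> 2 (ext_deriv 1 \<alpha>)"
proof (rule diff_form_2I)
  fix c x assume c: "c \<in> \<A>" and x: "x \<in> img c"
  have l1: "linear (\<lambda>u. frechet_derivative (\<lambda>y. apply1 (\<alpha> c y) u) (at x) v)" for v
    by (rule linear_derivative_form_1[OF \<alpha> c x])
  have l2: "linear (frechet_derivative (\<lambda>y. apply1 (\<alpha> c y) u) (at x))" for u
    by (rule linear_frechet_derivative[OF smooth_on_differentiable[OF diff_form_1_smooth[OF \<alpha> c] x]])
  show "bilinear_alt (\<lambda>u v. frechet_derivative (\<lambda>y. apply1 (\<alpha> c y) v) (at x) u -
      frechet_derivative (\<lambda>y. apply1 (\<alpha> c y) u) (at x) v)"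
    unfolding bilinear_alt_def by (simp add: linear_compose_sub l1 l2)
next
  fix c u v assume c: "c \<in> \<A>"
  show "smooth_on (img c) (\<lambda>x. frechet_derivative (\<lambda>y. apply1 (\<alpha> c y) v) (at x) u -
      frechet_derivative (\<lambda>y. apply1 (\<alpha> c y) u) (at x) v)"
    by (rule smooth_on_diff[OF open_img[OF c] smooth_on_derivative[OF diff_form_1_smooth[OF \<alpha> c]]
          smooth_on_derivative[OF diff_form_1_smooth[OF \<alpha> c]]])
next
  fix c c' x v assume c: "c \<in> \<A>" "c' \<in> \<A>" "x \<in> overlap c c'"
  have x: "x \<in> img c" using c overlap_subset by blast
  show "ext_deriv 1 \<alpha> c x v =
    ext_deriv 1 \<alpha> c' (transition c c' x) (\<lambda>i. frechet_derivative (transition c c') (at x) (v i))"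
    unfolding ext_deriv_1[OF \<alpha> c(1) x] ext_deriv_1[OF \<alpha> c(2) transition_in_img[OF c]]
      derivative_form_1_transition[OF \<alpha> c]
      smooth_on_symmetric_second_derivative[OF open_overlap[OF c(1,2)] c(3) smooth_on_transition[OF c(1,2)], of "v 1" "v 0"]
    by simp
qed (rule ext_deriv_1[OF \<alpha>])

end

section \<open>Stokes' theorem\<close>

text \<open>Difference quotients of \<open>f\<close> have integral 0 by translation invariance of
  Lebesgue measure, and they converge to the derivative. Dominated convergence applies: by the mean
  value theorem a quotient is a value of the derivative at a nearby point, hence bounded and zero
  outside a fixed ball.\<close>

lemma integral_derivative_compact_support_UNIV:
  fixes f :: "'v::euclidean_space \<Rightarrow> real"
  assumes f: "smooth_on UNIV f" and K: "compact K" "\<And>x. x \<notin> K \<Longrightarrow> f x = 0"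
  shows "((\<lambda>x. frechet_derivative f (at x) v) has_integral 0) UNIV"
proof -
  define g where "g x = frechet_derivative f (at x) v" for x
  have cont: "continuous_on UNIV f" "continuous_on UNIV g"
    using smooth_on_imp_continuous_on[OF f] smooth_on_imp_continuous_on[OF smooth_on_derivative[OF f]]
    by (simp_all add: g_def[abs_def])
  have meas: "f \<in> borel_measurable borel" "g \<in> borel_measurable borel"
    using cont borel_measurable_continuous_onI by blast+
  have g0: "g x = 0" if "x \<notin> K" for x
  proof -
    have "(f has_derivative (\<lambda>_. 0)) (at x)"
      by (rule has_derivative_transform_within_open[of "\<lambda>_. 0" _ _ _ "- K"])
         (use K that in \<open>auto simp: compact_imp_closed open_Compl\<close>)
    then show ?thesis by (simp add: g_def flip: frechet_derivative_at)
  qed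
  have "integrable lborel (\<lambda>x. indicator K x *\<^sub>R f x)"
    by (rule borel_integrable_compact[OF K(1)]) (use cont continuous_on_subset in blast)
  moreover have "(\<lambda>x. indicator K x *\<^sub>R f x) = f"
    using K(2) by (auto simp: fun_eq_iff indicator_def)
  ultimately have fi: "integrable lborel f" by simp
  have shift: "integrable lborel (\<lambda>x. f (a + x)) \<and> (\<integral>x. f (a + x) \<partial>lborel) = (\<integral>x. f x \<partial>lborel)" for a
  proof -
    have "integrable (distr lborel borel ((+) a)) f" using fi by (simp add: lborel_distr_plus)
    then have "integrable lborel (\<lambda>x. f (a + x))"
      by (subst (asm) integrable_distr_eq) (use meas in auto)
    moreover have "(\<integral>x. f (a + x) \<partial>lborel) = (\<integral>x. f x \<partial>distr lborel borel ((+) a))"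
      by (subst integral_distr) (use meas in auto)
    ultimately show ?thesis by (simp add: lborel_distr_plus)
  qed
  obtain B where B: "\<And>x. x \<in> K \<Longrightarrow> norm (g x) \<le> B"
    using compact_imp_bounded[OF compact_continuous_image[OF continuous_on_subset[OF cont(2) subset_UNIV] K(1)]]
    unfolding bounded_iff by blast
  \<comment> \<open>\<open>B\<close> may be negative when \<open>K\<close> is empty; the maximum
    with 0 also covers the points outside \<open>K\<close>.\<close>
  have B': "norm (g x) \<le> max B 0" for x using B[of x] g0[of x] by (cases "x \<in> K") auto
  obtain R where R: "\<And>x. x \<in> K \<Longrightarrow> norm x \<le> R" using compact_imp_bounded[OF K(1)] unfolding bounded_iff by blast
  \<comment> \<open>The step 1/(n + 1) is never 0 and at most 1, so the mean value point lies within
    \<open>norm v\<close> of \<open>x\<close>.\<close>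
  define q where "q n x = real (Suc n) * (f (inverse (real (Suc n)) *\<^sub>R v + x) - f x)" for n x
  have mvt: "\<exists>y. q n x = g y \<and> norm (y - x) \<le> norm v" for n x
  proof -
    let ?h = "inverse (real (Suc n))"
    have "((\<lambda>s. f (x + s *\<^sub>R v)) has_real_derivative g (x + s *\<^sub>R v)) (at s)" for s
      unfolding g_def by (rule DERIV_along_line[OF smooth_on_has_derivative[OF f UNIV_I]])
    from MVT2[of 0 ?h "\<lambda>s. f (x + s *\<^sub>R v)" "\<lambda>s. g (x + s *\<^sub>R v)"] this
    obtain s where s: "0 < s" "s < ?h" "f (x + ?h *\<^sub>R v) - f (x + 0 *\<^sub>R v) = (?h - 0) * g (x + s *\<^sub>R v)"
      by auto
    have "f (?h *\<^sub>R v + x) - f x = ?h * g (x + s *\<^sub>R v)"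
      using s(3) by (simp only: add.commute[of "?h *\<^sub>R v" x] diff_0_right scaleR_zero_left add_0_right)
    then have "q n x = real (Suc n) * ?h * g (x + s *\<^sub>R v)" by (simp only: q_def mult.assoc)
    then have "q n x = g (x + s *\<^sub>R v)" by (simp del: of_nat_Suc)
    moreover have "?h \<le> 1" by (simp add: inverse_le_1_iff)
    then have "s * norm v \<le> 1 * norm v" using s by (intro mult_right_mono) auto
    then have "norm (x + s *\<^sub>R v - x) \<le> norm v" using s by simp
    ultimately show ?thesis by blast
  qed
  \<comment> \<open>A nonzero quotient at \<open>x\<close> comes from a point of \<open>K\<close>
    within \<open>norm v\<close> of \<open>x\<close>, whence the radius
    \<open>R + norm v\<close>.\<close>
  have bound: "norm (q n x) \<le> indicator (cball 0 (R + norm v)) x *\<^sub>R max B 0" for n x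
  proof -
    obtain y where y: "q n x = g y" "norm (y - x) \<le> norm v" using mvt by blast
    show ?thesis
    proof (cases "norm x \<le> R + norm v")
      case True then show ?thesis using y B'[of y] by simp
    next
      case False
      have "norm x \<le> norm y + norm (y - x)" by (metis norm_minus_commute norm_triangle_sub)
      then have "y \<notin> K" using False R[of y] y(2) by force
      then show ?thesis using y g0 False by simp
    qed
  qed
  have lim: "(\<lambda>n. q n x) \<longlonglongrightarrow> g x" for x
  proof -
    have "((\<lambda>s. f (x + s *\<^sub>R v)) has_real_derivative g x) (at 0)"
      unfolding g_def using DERIV_along_line[of f _ x 0 v] smooth_on_has_derivative[OF f UNIV_I, of x] by simp
    then have "((\<lambda>h. (f (x + h *\<^sub>R v) - f x) / h) \<longlongrightarrow> g x) (at 0)"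
      by (simp add: has_field_derivative_iff)
    moreover have "filterlim (\<lambda>n. inverse (real (Suc n))) (at 0) sequentially"
      using LIMSEQ_inverse_real_of_nat by (simp add: filterlim_at)
    ultimately have "(\<lambda>n. (f (x + inverse (real (Suc n)) *\<^sub>R v) - f x) / inverse (real (Suc n))) \<longlonglongrightarrow> g x"
      by (rule filterlim_compose)
    then show ?thesis
      by (simp only: q_def divide_inverse inverse_inverse_eq mult.commute[of "real (Suc _)"] add.commute[of _ x])
  qed
  have qm: "q n \<in> borel_measurable borel" for n
    unfolding q_def[abs_def] using meas by measurable
  have w: "integrable lborel (\<lambda>x::'v. indicator (cball 0 (R + norm v)) x *\<^sub>R max B 0)"
    by (rule borel_integrable_compact) auto
  have "(\<lambda>n. \<integral>x. q n x \<partial>lborel) \<longlonglongrightarrow> (\<integral>x. g x \<partial>lborel)"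
    by (rule integral_dominated_convergence[where s = q, OF _ _ w])
       (use qm lim bound meas in auto)
  moreover have "(\<integral>x. q n x \<partial>lborel) = 0" for n
    using shift[of "inverse (real (Suc n)) *\<^sub>R v"] fi by (simp add: q_def)
  ultimately have "(\<integral>x. g x \<partial>lborel) = 0" by (simp add: LIMSEQ_const_iff)
  moreover have "integrable lborel g"
    by (rule integrable_dominated_convergence[where s = q, OF _ _ w])
       (use qm lim bound meas in auto)
  ultimately show ?thesis using has_integral_integral_lborel[of g] by (simp add: g_def[abs_def])
qed

lemma has_integral_extend:
  fixes f g :: "'v::euclidean_space \<Rightarrow> real"
  assumes "\<And>x. x \<in> S \<Longrightarrow> g x = f x" "\<And>x. x \<notin> S \<Longrightarrow> g x = 0" "(g has_integral I) UNIV"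
  shows "(f has_integral I) S"
proof -
  have "g = (\<lambda>x. if x \<in> S then f x else 0)" using assms(1,2) by auto
  with assms(3) show ?thesis by (simp add: has_integral_restrict_UNIV)
qed

text \<open>Extended by 0, the function is smooth everywhere: \<open>S\<close> and the complement of
  \<open>K\<close> are open, cover the space, and the extension is smooth on each.\<close>

lemma has_integral_derivative_compact_support:
  fixes f :: "'v::euclidean_space \<Rightarrow> real"
  assumes f: "smooth_on S f" and S: "open S" and K: "compact K" "K \<subseteq> S" "\<And>x. x \<in> S - K \<Longrightarrow> f x = 0"
  shows "((\<lambda>x. frechet_derivative f (at x) v) has_integral 0) S"
proof -
  define g where "g x = (if x \<in> S then f x else 0)" for x
  have gS: "smooth_on S g" by (rule smooth_on_cong[OF S _ f]) (simp add: g_def)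
  have oK: "open (- K)" using K(1) by (simp add: compact_imp_closed open_Compl)
  have g0: "g x = 0" if "x \<notin> K" for x using that K(3) by (simp add: g_def)
  have gK: "smooth_on (- K) g" by (rule smooth_on_cong[OF oK _ smooth_on_const[of _ 0]]) (simp add: g0)
  have "smooth_on UNIV g"
  proof (rule smooth_on_local)
    fix x
    show "\<exists>U. open U \<and> x \<in> U \<and> smooth_on U g"
      using gS gK S oK K(2) by (cases "x \<in> S") blast+
  qed
  from integral_derivative_compact_support_UNIV[OF this K(1) g0]
  have I: "((\<lambda>x. frechet_derivative g (at x) v) has_integral 0) UNIV" .
  show ?thesis
  proof (rule has_integral_extend[OF _ _ I])
    fix x assume x: "x \<in> S"
    show "frechet_derivative g (at x) v = frechet_derivative f (at x) v"
      using frechet_derivative_transform_within_open[OF smooth_on_differentiable[OF f x] S x, of g]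
      by (simp add: g_def)
  next
    fix x assume x: "x \<notin> S"
    have "(g has_derivative (\<lambda>_. 0)) (at x)"
      by (rule has_derivative_transform_within_open[of "\<lambda>_. 0" _ _ _ "- K"])
         (use oK K(2) g0 x in auto)
    then show "frechet_derivative g (at x) v = 0" by (simp flip: frechet_derivative_at)
  qed
qed

lemma absolutely_integrable_compact_support:
  fixes f :: "'v::euclidean_space \<Rightarrow> real"
  assumes "continuous_on S f" "compact K" "K \<subseteq> S" "\<And>x. x \<in> S - K \<Longrightarrow> f x = 0"
  shows "f absolutely_integrable_on S"
proof -
  have "integrable lborel (\<lambda>x. indicator K x *\<^sub>R f x)"
    by (rule borel_integrable_compact[OF assms(2)]) (rule continuous_on_subset[OF assms(1,3)])
  then have "integrable lebesgue (\<lambda>x. indicator K x *\<^sub>R f x)"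
    by (subst integrable_completion) auto
  moreover have "(\<lambda>x. indicator K x *\<^sub>R f x) = (\<lambda>x. indicator S x *\<^sub>R f x)"
    using assms(3,4) by (auto simp: fun_eq_iff indicator_def)
  ultimately show ?thesis by (simp add: set_integrable_def)
qed

text \<open>A real function is treated as one with values in \<open>real^1\<close>, the shape to
  which the vector-valued change of variables applies.\<close>

lemma integral_change_of_variables_real:
  fixes f :: "real^'n::{finite,wellorder} \<Rightarrow> real"
  assumes "S \<in> sets lebesgue" "\<And>x. x \<in> S \<Longrightarrow> (g has_derivative g' x) (at x within S)" "inj_on g S"
    and f: "f absolutely_integrable_on g ` S"
  shows "integral (g ` S) f = integral S (\<lambda>x. \<bar>det (matrix (g' x))\<bar> * f (g x))"
proof -
  let ?f = "\<lambda>x. vec (f x) :: real^1"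
  have "?f absolutely_integrable_on g ` S"
    using f by (simp add: absolutely_integrable_on_1_iff)
  then have "integral (g ` S) ?f = integral S (\<lambda>x. \<bar>det (matrix (g' x))\<bar> *\<^sub>R ?f (g x))"
    by (intro integral_change_of_variables[OF assms(1-3)]) blast+
  then show ?thesis by (simp add: integral_on_1_eq)
qed

text \<open>Meant for the orientation sign. The image of a chart may be disconnected, so the sign is
  constant only near each point, which is enough to move it through a derivative.\<close>

lemma smooth_on_locally_constant_mult:
  fixes f \<sigma> :: "'v::euclidean_space \<Rightarrow> real"
  assumes S: "open S" and f: "smooth_on S f"
    and \<sigma>: "\<And>x. x \<in> S \<Longrightarrow> \<exists>U. open U \<and> x \<in> U \<and> U \<subseteq> S \<and> (\<forall>y\<in>U. \<sigma> y = \<sigma> x)"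
  shows "smooth_on S (\<lambda>x. \<sigma> x * f x)"
    and "x \<in> S \<Longrightarrow> frechet_derivative (\<lambda>x. \<sigma> x * f x) (at x) v = \<sigma> x * frechet_derivative f (at x) v"
proof -
  show "smooth_on S (\<lambda>x. \<sigma> x * f x)"
  proof (rule smooth_on_local)
    fix x assume "x \<in> S"
    then obtain U where U: "open U" "x \<in> U" "U \<subseteq> S" "\<forall>y\<in>U. \<sigma> y = \<sigma> x" using \<sigma> by blast
    have "smooth_on U (\<lambda>y. \<sigma> y * f y)"
      by (rule smooth_on_cong[OF U(1) _ smooth_on_mult[OF U(1) smooth_on_const[of _ "\<sigma> x"] smooth_on_subset[OF f U(3)]]])
         (use U(4) in simp)
    with U show "\<exists>U. open U \<and> x \<in> U \<and> smooth_on U (\<lambda>y. \<sigma> y * f y)" by blast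
  qed
  show "frechet_derivative (\<lambda>x. \<sigma> x * f x) (at x) v = \<sigma> x * frechet_derivative f (at x) v" if x: "x \<in> S"
  proof -
    obtain U where U: "open U" "x \<in> U" "U \<subseteq> S" "\<forall>y\<in>U. \<sigma> y = \<sigma> x" using \<sigma>[OF x] by blast
    have "((\<lambda>y. \<sigma> y * f y) has_derivative (\<lambda>v. \<sigma> x * frechet_derivative f (at x) v)) (at x)"
      by (rule has_derivative_transform_within_open[OF has_derivative_mult_right[OF smooth_on_has_derivative[OF f x]] U(1,2)])
         (use U(4) in simp)
    then show ?thesis by (simp flip: frechet_derivative_at)
  qed
qed

section \<open>Orientation by a nowhere vanishing three-form\<close>

locale oriented_closed_manifold = closed_manifold +
  fixes \<mu> :: "'a tensor"
  assumes \<mu>: "diff_form \<A> 3 \<mu>" and \<mu>_nonzero: "c \<in> \<A> \<Longrightarrow> x \<in> img c \<Longrightarrow> \<mu> c x frame \<noteq> 0"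
begin

definition orientation :: "'a chart \<Rightarrow> real^3 \<Rightarrow> real" where
  "orientation c x = sgn (\<mu> c x frame)"

lemma orientation_locally_constant:
  assumes "c \<in> \<A>" "x \<in> img c"
  shows "\<exists>U. open U \<and> x \<in> U \<and> U \<subseteq> img c \<and> (\<forall>y\<in>U. orientation c y = orientation c x)"
proof -
  have cont: "continuous_on (img c) (\<lambda>y. \<mu> c y frame)"
    by (rule smooth_on_imp_continuous_on[OF diff_form_smooth[OF \<mu> assms(1)]])
  show ?thesis
  proof (cases "\<mu> c x frame > 0")
    case True
    have "open {y \<in> img c. \<mu> c y frame \<in> {0<..}}"
      using continuous_open_preimage[OF cont open_img[OF assms(1)] open_greaterThan[of 0]]
      by (simp add: vimage_def Collect_conj_eq)
    with True assms show ?thesis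
      by (intro exI[of _ "{y \<in> img c. \<mu> c y frame \<in> {0<..}}"]) (auto simp: orientation_def)
  next
    case False
    then have neg: "\<mu> c x frame < 0" using \<mu>_nonzero[OF assms] by simp
    have "open {y \<in> img c. \<mu> c y frame \<in> {..<0}}"
      using continuous_open_preimage[OF cont open_img[OF assms(1)] open_lessThan[of 0]]
      by (simp add: vimage_def Collect_conj_eq)
    with neg assms show ?thesis
      by (intro exI[of _ "{y \<in> img c. \<mu> c y frame \<in> {..<0}}"]) (auto simp: orientation_def)
  qed
qed

lemma continuous_on_orientation_mult:
  assumes "c \<in> \<A>" "smooth_on (img c) f"
  shows "continuous_on (img c) (\<lambda>x. orientation c x * f x)"
  by (rule smooth_on_imp_continuous_on[OF smooth_on_locally_constant_mult(1)[OF open_img[OF assms(1)] assms(2)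
          orientation_locally_constant[OF assms(1)]]])

text \<open>The change of variables involves the absolute value of the Jacobian, the transformation
  of three-forms the Jacobian itself; this sign makes up the difference.\<close>

lemma orientation_transition:
  assumes "c \<in> \<A>" "c' \<in> \<A>" "x \<in> overlap c c'"
  shows "orientation c x = sgn (det (matrix (frechet_derivative (transition c c') (at x)))) * orientation c' (transition c c' x)"
  unfolding orientation_def diff_form_3_natural[OF \<mu> assms] by (rule sgn_mult)

end

text \<open>The value of dh \<and> \<eta> on the coordinate frame, for a function given by its
  coordinate representations \<open>h c\<close>.\<close>

definition d_wedge :: "('a chart \<Rightarrow> real^3 \<Rightarrow> real) \<Rightarrow> 'a tensor \<Rightarrow> 'a chart \<Rightarrow> real^3 \<Rightarrow> real" where
  "d_wedge h \<eta> c x =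
    frechet_derivative (h c) (at x) e1 * apply2 (\<eta> c x) e2 e3 +
    frechet_derivative (h c) (at x) e2 * apply2 (\<eta> c x) e3 e1 +
    frechet_derivative (h c) (at x) e3 * apply2 (\<eta> c x) e1 e2"

context atlas
begin

lemma smooth_on_d_wedge:
  assumes "diff_form \<A> 2 \<eta>" "c \<in> \<A>" "smooth_on (img c) (h c)"
  shows "smooth_on (img c) (d_wedge h \<eta> c)"
  unfolding d_wedge_def[abs_def]
  by (intro smooth_on_add smooth_on_mult open_img[OF assms(2)] smooth_on_derivative[OF assms(3)]
      diff_form_2_smooth[OF assms(1,2)])

text \<open>By the chain rule dh is pulled back by the differential, as \<eta> is. The product is
  alternating and trilinear, so transporting the frame contributes the Jacobian determinant.\<close>

lemma d_wedge_transition: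
  assumes \<eta>: "diff_form \<A> 2 \<eta>" and c: "c \<in> \<A>" "c' \<in> \<A>" "x \<in> overlap c c'"
    and h: "smooth_on (img c') (h c')" "\<And>y. y \<in> overlap c c' \<Longrightarrow> h c y = h c' (transition c c' y)"
  shows "d_wedge h \<eta> c x = det (matrix (frechet_derivative (transition c c') (at x))) * d_wedge h \<eta> c' (transition c c' x)"
proof -
  let ?T = "transition c c'"
  let ?D = "frechet_derivative ?T (at x)"
  let ?a = "frechet_derivative (h c') (at (?T x))"
  let ?b = "apply2 (\<eta> c' (?T x))"
  note Tx = transition_in_img[OF c]
  note lin = linear_transition_derivative[OF c]
  have "((\<lambda>y. h c' (?T y)) has_derivative (\<lambda>v. ?a (?D v))) (at x)"
    using diff_chain_at[OF smooth_on_has_derivative[OF smooth_on_transition[OF c(1,2)] c(3)] smooth_on_has_derivative[OF h(1) Tx]]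
    by (simp only: o_def)
  then have "(h c has_derivative (\<lambda>v. ?a (?D v))) (at x)"
    by (rule has_derivative_transform_within_open[OF _ open_overlap[OF c(1,2)] c(3)]) (simp only: h(2))
  then have D: "frechet_derivative (h c) (at x) = (\<lambda>v. ?a (?D v))" by (rule frechet_derivative_at[symmetric])
  have t: "trilinear_alt (\<lambda>u v w. ?a u * ?b v w + ?a v * ?b w u + ?a w * ?b u v)"
    by (rule trilinear_alt_wedge_1_2[OF linear_frechet_derivative[OF smooth_on_differentiable[OF h(1) Tx]]
          diff_form_2_bilinear(1)[OF \<eta> c(2) Tx]])
  have "det (vector [?D e1, ?D e2, ?D e3] :: real^3^3) = det (matrix ?D)"
    using det_vector_matrix_mult[of "matrix ?D" e1 e2 e3] lin
    by (simp add: matrix_works det_vector_frame)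
  with trilinear_alt_det[OF t, of "?D e1" "?D e2" "?D e3"]
  show ?thesis
    unfolding d_wedge_def D diff_form_2_natural[OF \<eta> c] by simp
qed

end

lemma integral_zero_outside:
  fixes f :: "'v::euclidean_space \<Rightarrow> real"
  assumes "T \<subseteq> S" "\<And>x. x \<in> S - T \<Longrightarrow> f x = 0"
  shows "integral S f = integral T f"
proof -
  have "(\<lambda>x. if x \<in> S then f x else 0) = (\<lambda>x. if x \<in> T then f x else 0)"
    by (rule ext) (use assms in auto)
  then show ?thesis by (metis Henstock_Kurzweil_Integration.integral_restrict_UNIV)
qed

locale partitioned_manifold = oriented_closed_manifold +
  fixes C :: "'a chart set" and \<rho> :: "'a chart \<Rightarrow> 'a \<Rightarrow> real" and \<eta> :: "'a tensor"
  assumes partition: "partition_of_unity X \<A> C \<rho>" and \<eta>: "diff_form \<A> 2 \<eta>"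
begin

text \<open>The first index names the function of the partition, the second one the chart in whose
  coordinates it is read.\<close>

definition weight :: "'a chart \<Rightarrow> 'a chart \<Rightarrow> real^3 \<Rightarrow> real" where
  "weight c' c x = \<rho> c' (param c x)"

definition supp :: "'a chart \<Rightarrow> 'a set" where
  "supp c = X closure_of {p \<in> topspace X. \<rho> c p \<noteq> 0}"

lemma finite_C: "finite C" and C_chart: "c \<in> C \<Longrightarrow> c \<in> \<A>"
  using partition unfolding partition_of_unity_def by blast+

lemma smooth_on_weight:
  assumes "c \<in> \<A>" "c' \<in> C"
  shows "smooth_on (img c) (weight c' c)"
proof -
  have "smooth_fun \<A> (\<rho> c')" using partition assms(2) unfolding partition_of_unity_def by blast
  then have "smooth_on (img c) (\<rho> c' \<circ> param c)" using assms(1) unfolding smooth_fun_def by blast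
  then show ?thesis by (simp only: weight_def[abs_def] o_def)
qed

lemma weight_transition:
  "c1 \<in> \<A> \<Longrightarrow> c2 \<in> \<A> \<Longrightarrow> x \<in> overlap c1 c2 \<Longrightarrow> weight c c1 x = weight c c2 (transition c1 c2 x)"
  unfolding weight_def by (simp only: param_transition)

lemma supp_subset: "c \<in> C \<Longrightarrow> supp c \<subseteq> fst c"
  using partition unfolding partition_of_unity_def supp_def by blast

lemma compact_supp: "c \<in> C \<Longrightarrow> compact (snd c ` supp c)"
  by (rule compact_image_chart[OF C_chart closedin_compact_space[OF compact] supp_subset])
     (simp_all add: supp_def)

lemma supp_image_subset: "c \<in> C \<Longrightarrow> snd c ` supp c \<subseteq> img c"
  unfolding img_def using supp_subset by blast

lemma not_in_supp:
  assumes "x \<in> img c - snd c ` supp c"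
  shows "param c x \<notin> supp c"
  using assms by (metis DiffD1 DiffD2 chart_param imageI)

lemma weight_zero:
  assumes "c \<in> \<A>" "x \<in> img c" "param c x \<notin> supp c'"
  shows "weight c' c x = 0"
proof -
  have "param c x \<in> topspace X" using param_in_dom[OF assms(2)] chart_dom(2)[OF assms(1)] by blast
  moreover have "{p \<in> topspace X. \<rho> c' p \<noteq> 0} \<subseteq> supp c'"
    unfolding supp_def by (rule closure_of_subset) blast
  ultimately show ?thesis using assms(3) unfolding weight_def by blast
qed

text \<open>The support is closed, so outside it the weight vanishes on a whole neighbourhood and
  its derivative vanishes too.\<close>

lemma d_wedge_weight_zero:
  assumes "c \<in> \<A>" "x \<in> img c" "param c x \<notin> supp c'"
  shows "d_wedge (weight c') \<eta> c x = 0"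
proof -
  let ?U = "snd c ` (fst c \<inter> (topspace X - supp c'))"
  have U: "open ?U"
    by (rule open_image_chart[OF assms(1)]) (simp add: supp_def openin_diff)
  have "param c x \<in> fst c \<inter> (topspace X - supp c')"
    using assms(3) param_in_dom[OF assms(2)] chart_dom(2)[OF assms(1)] by blast
  then have xU: "x \<in> ?U" using chart_param[OF assms(2)] by (metis imageI)
  have "weight c' c y = 0" if y: "y \<in> ?U" for y
  proof -
    obtain p where p: "y = snd c p" "p \<in> fst c \<inter> (topspace X - supp c')" using y by (rule imageE)
    then show ?thesis using weight_zero[OF assms(1), of y c'] chart_in_img[of p c] assms(1) by simp
  qed
  then have "(weight c' c has_derivative (\<lambda>_. 0)) (at x)"
    by (intro has_derivative_transform_within_open[OF has_derivative_const U xU]) simp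
  then have "frechet_derivative (weight c' c) (at x) = (\<lambda>_. 0)" by (rule frechet_derivative_at[symmetric])
  then show ?thesis by (simp add: d_wedge_def)
qed

lemma sum_weight:
  assumes "c \<in> \<A>" "x \<in> img c"
  shows "(\<Sum>c'\<in>C. weight c' c x) = 1"
proof -
  have "param c x \<in> topspace X" using param_in_dom[OF assms(2)] chart_dom(2)[OF assms(1)] by blast
  then show ?thesis using partition unfolding partition_of_unity_def weight_def by blast
qed

text \<open>The weights sum to the constant 1 on the open image of the chart, so their derivatives
  sum to 0.\<close>

lemma sum_d_wedge_weight:
  assumes "c \<in> \<A>" "x \<in> img c"
  shows "(\<Sum>c'\<in>C. d_wedge (weight c') \<eta> c x) = 0"
proof -
  have "((\<lambda>y. \<Sum>c'\<in>C. weight c' c y) has_derivative (\<lambda>v. \<Sum>c'\<in>C. frechet_derivative (weight c' c) (at x) v)) (at x)"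
    by (rule has_derivative_sum[OF smooth_on_has_derivative[OF smooth_on_weight[OF assms(1)] assms(2)]])
  moreover have "((\<lambda>y. \<Sum>c'\<in>C. weight c' c y) has_derivative (\<lambda>_. 0)) (at x)"
    by (rule has_derivative_transform_within_open[OF has_derivative_const open_img[OF assms(1)] assms(2)])
       (simp only: sum_weight[OF assms(1)])
  ultimately have "(\<lambda>v. \<Sum>c'\<in>C. frechet_derivative (weight c' c) (at x) v) = (\<lambda>_. 0)"
    by (rule has_derivative_unique)
  then have "(\<Sum>c'\<in>C. frechet_derivative (weight c' c) (at x) v) = 0" for v by (rule fun_cong)
  then show ?thesis unfolding d_wedge_def by (simp add: sum.distrib flip: sum_distrib_right)
qed

lemma smooth_on_d_wedge_weight: "c \<in> \<A> \<Longrightarrow> c' \<in> C \<Longrightarrow> smooth_on (img c) (d_wedge (weight c') \<eta> c)"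
  by (rule smooth_on_d_wedge[OF \<eta>]) (use smooth_on_weight in blast)+

text \<open>Leibniz: d(\<rho>\<eta>) = d\<rho> \<and> \<eta> + \<rho> d\<eta>. The left side is a
  sum of partial derivatives of functions with compact support in the chart, so it integrates to 0,
  also with the locally constant sign in front.\<close>

lemma integral_by_parts_chart:
  assumes c: "c \<in> C"
  shows "integral (img c) (\<lambda>x. orientation c x * (weight c c x * ext_deriv 2 \<eta> c x frame)) =
    - integral (img c) (\<lambda>x. orientation c x * d_wedge (weight c) \<eta> c x)"
proof -
  note cA = C_chart[OF c]
  note loc = orientation_locally_constant[OF cA]
  note S = open_img[OF cA] and K = compact_supp[OF c] supp_image_subset[OF c]
  define f where "f u v x = weight c c x * apply2 (\<eta> c x) u v" for u v x
  have f: "smooth_on (img c) (f u v)" for u v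
    unfolding f_def[abs_def]
    by (rule smooth_on_mult[OF S smooth_on_weight[OF cA c] diff_form_2_smooth[OF \<eta> cA]])
  have w0: "weight c c x = 0" if "x \<in> img c - snd c ` supp c" for x
    using weight_zero[OF cA _ not_in_supp[OF that]] that by blast
  have dw0: "d_wedge (weight c) \<eta> c x = 0" if "x \<in> img c - snd c ` supp c" for x
    using d_wedge_weight_zero[OF cA _ not_in_supp[OF that]] that by blast
  have I: "((\<lambda>x. orientation c x * frechet_derivative (f u v) (at x) w) has_integral 0) (img c)" for u v w
  proof (rule has_integral_eq[OF _ has_integral_derivative_compact_support[OF smooth_on_locally_constant_mult(1)[OF S f loc] S K]])
    show "frechet_derivative (\<lambda>x. orientation c x * f u v x) (at x) w = orientation c x * frechet_derivative (f u v) (at x) w"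
      if "x \<in> img c" for x by (rule smooth_on_locally_constant_mult(2)[OF S f loc that])
    show "orientation c x * f u v x = 0" if "x \<in> img c - snd c ` supp c" for x
      using w0[OF that] by (simp add: f_def)
  qed
  have "((\<lambda>x. orientation c x * frechet_derivative (f e2 e3) (at x) e1 + orientation c x * frechet_derivative (f e3 e1) (at x) e2 +
      orientation c x * frechet_derivative (f e1 e2) (at x) e3) has_integral 0 + 0 + 0) (img c)"
    by (intro has_integral_add I)
  moreover have "orientation c x * frechet_derivative (f e2 e3) (at x) e1 + orientation c x * frechet_derivative (f e3 e1) (at x) e2 +
      orientation c x * frechet_derivative (f e1 e2) (at x) e3 =
      orientation c x * (weight c c x * ext_deriv 2 \<eta> c x frame) + orientation c x * d_wedge (weight c) \<eta> c x" if x: "x \<in> img c" for x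
  proof -
    have "(f u v has_derivative (\<lambda>w. weight c c x * frechet_derivative (\<lambda>y. apply2 (\<eta> c y) u v) (at x) w +
        frechet_derivative (weight c c) (at x) w * apply2 (\<eta> c x) u v)) (at x)" for u v
      unfolding f_def[abs_def]
      by (rule has_derivative_mult[OF smooth_on_has_derivative[OF smooth_on_weight[OF cA c] x]
            smooth_on_has_derivative[OF diff_form_2_smooth[OF \<eta> cA] x]])
    from frechet_derivative_at[OF this, symmetric]
    have D: "frechet_derivative (f u v) (at x) = (\<lambda>w. weight c c x * frechet_derivative (\<lambda>y. apply2 (\<eta> c y) u v) (at x) w +
        frechet_derivative (weight c c) (at x) w * apply2 (\<eta> c x) u v)" for u v .
    show ?thesis unfolding D ext_deriv_2_frame[OF \<eta> cA x] d_wedge_def by (simp only: algebra_simps)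
  qed
  ultimately have "((\<lambda>x. orientation c x * (weight c c x * ext_deriv 2 \<eta> c x frame) +
      orientation c x * d_wedge (weight c) \<eta> c x) has_integral 0 + 0 + 0) (img c)"
    by (rule has_integral_eq[rotated])
  \<comment> \<open>Only the sum of the two terms is known to be integrable so far. Integrability of
    this one allows it to be subtracted, which also yields the integral of the other.\<close>
  moreover have i2: "(\<lambda>x. orientation c x * d_wedge (weight c) \<eta> c x) absolutely_integrable_on img c"
    by (rule absolutely_integrable_compact_support[OF continuous_on_orientation_mult[OF cA smooth_on_d_wedge_weight[OF cA c]] K])
       (simp add: dw0)
  ultimately have "((\<lambda>x. orientation c x * (weight c c x * ext_deriv 2 \<eta> c x frame) +
      orientation c x * d_wedge (weight c) \<eta> c x - orientation c x * d_wedge (weight c) \<eta> c x) has_integral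
      0 + 0 + 0 - integral (img c) (\<lambda>x. orientation c x * d_wedge (weight c) \<eta> c x)) (img c)"
    by (intro has_integral_diff integrable_integral set_lebesgue_integral_eq_integral(1))
  then show ?thesis by (simp add: integral_unique)
qed

lemma absolutely_integrable_weighted:
  assumes "c \<in> C" "c' \<in> C"
  shows "(\<lambda>x. weight c c x * (orientation c x * d_wedge (weight c') \<eta> c x)) absolutely_integrable_on img c"
proof (rule absolutely_integrable_compact_support[OF _ compact_supp[OF assms(1)] supp_image_subset[OF assms(1)]])
  note cA = C_chart[OF assms(1)]
  show "continuous_on (img c) (\<lambda>x. weight c c x * (orientation c x * d_wedge (weight c') \<eta> c x))"
    by (rule continuous_on_mult[OF smooth_on_imp_continuous_on[OF smooth_on_weight[OF cA assms(1)]]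
          continuous_on_orientation_mult[OF cA smooth_on_d_wedge_weight[OF cA assms(2)]]])
  fix x assume x: "x \<in> img c - snd c ` supp c"
  have "weight c c x = 0" using weight_zero[OF cA _ not_in_supp[OF x]] x by blast
  then show "weight c c x * (orientation c x * d_wedge (weight c') \<eta> c x) = 0" by simp
qed

text \<open>Both integrals live on the overlap: in \<open>c\<close> because \<rho>(c') vanishes
  outside the domain of \<open>c'\<close>, in \<open>c'\<close> because d\<rho>(c) vanishes outside
  the domain of \<open>c\<close>. There the change of variables by the transition map identifies
  them.\<close>

lemma integral_change_of_charts:
  assumes c: "c \<in> C" "c' \<in> C"
  shows "integral (img c) (\<lambda>x. weight c' c x * (orientation c x * d_wedge (weight c) \<eta> c x)) =
    integral (img c') (\<lambda>x. weight c' c' x * (orientation c' x * d_wedge (weight c) \<eta> c' x))"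
    (is "integral _ ?F = integral _ ?G")
proof -
  note A = C_chart[OF c(1)] C_chart[OF c(2)]
  let ?T = "transition c c'"
  have 1: "integral (img c) ?F = integral (overlap c c') ?F"
  proof (rule integral_zero_outside[OF overlap_subset])
    fix x assume x: "x \<in> img c - overlap c c'"
    then have "param c x \<notin> supp c'" using in_overlap_iff[OF A(1)] supp_subset[OF c(2)] by blast
    then have "weight c' c x = 0" using weight_zero[OF A(1)] x by blast
    then show "?F x = 0" by simp
  qed
  have 2: "integral (img c') ?G = integral (overlap c' c) ?G"
  proof (rule integral_zero_outside[OF overlap_subset])
    fix x assume x: "x \<in> img c' - overlap c' c"
    then have "param c' x \<notin> supp c" using in_overlap_iff[OF A(2)] supp_subset[OF c(1)] by blast
    then have "d_wedge (weight c) \<eta> c' x = 0" using d_wedge_weight_zero[OF A(2)] x by blast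
    then show "?G x = 0" by simp
  qed
  have im: "?T ` overlap c c' = overlap c' c" by (rule transition_image[OF A(1)])
  have "?G absolutely_integrable_on ?T ` overlap c c'"
    unfolding im
    by (rule set_integrable_subset[OF absolutely_integrable_weighted[OF c(2,1)] _ overlap_subset])
       (use open_overlap[OF A(2,1)] in auto)
  then have "integral (?T ` overlap c c') ?G = integral (overlap c c')
      (\<lambda>x. \<bar>det (matrix (frechet_derivative ?T (at x)))\<bar> * ?G (?T x))"
    by (rule integral_change_of_variables_real[rotated 3])
       (use open_overlap[OF A] inj_on_transition[OF A] smooth_on_has_derivative[OF smooth_on_transition[OF A]]
         in \<open>auto intro: has_derivative_at_withinI\<close>)
  also have "\<dots> = integral (overlap c c') ?F"
  proof (rule integral_cong)
    fix x assume x: "x \<in> overlap c c'"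
    have dw: "d_wedge (weight c) \<eta> c x = det (matrix (frechet_derivative ?T (at x))) * d_wedge (weight c) \<eta> c' (?T x)"
      by (rule d_wedge_transition[where h = "weight c", OF \<eta> A x smooth_on_weight[OF A(2) c(1)] weight_transition[OF A]])
    \<comment> \<open>With |d| = d sgn d, the factor d transforms the three-form and sgn d the
      orientation.\<close>
    have "\<bar>d\<bar> * (w * (s * z)) = w * ((sgn d * s) * (d * z))" for d w s z :: real
      unfolding abs_sgn[of d] by (simp only: mult_ac)
    then show "\<bar>det (matrix (frechet_derivative ?T (at x)))\<bar> * ?G (?T x) = ?F x"
      unfolding dw orientation_transition[OF A x] weight_transition[OF A x, of c'] .
  qed
  finally show ?thesis unfolding im 1 2 ..
qed

text \<open>The boundary terms d\<rho>(c) \<and> \<eta> are multiplied by 1 = sum of \<rho>(c') and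
  each summand is moved to the chart c'. After interchanging the two finite sums, the inner one
  contains the sum of all d\<rho>(c), which is 0.\<close>

theorem stokes_partition:
  "(\<Sum>c\<in>C. integral (img c) (\<lambda>x. orientation c x * (weight c c x * ext_deriv 2 \<eta> c x frame))) = 0"
proof -
  let ?I = "\<lambda>c d. \<lambda>x. weight d d x * (orientation d x * d_wedge (weight c) \<eta> d x)"
  have "integral (img c) (\<lambda>x. orientation c x * d_wedge (weight c) \<eta> c x) =
      (\<Sum>c'\<in>C. integral (img c') (?I c c'))" if c: "c \<in> C" for c
  proof -
    note cA = C_chart[OF c]
    have "integral (img c) (\<lambda>x. orientation c x * d_wedge (weight c) \<eta> c x) =
        integral (img c) (\<lambda>x. \<Sum>c'\<in>C. weight c' c x * (orientation c x * d_wedge (weight c) \<eta> c x))"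
      by (rule integral_cong) (simp add: sum_weight[OF cA] flip: sum_distrib_right)
    also have "\<dots> = (\<Sum>c'\<in>C. integral (img c) (\<lambda>x. weight c' c x * (orientation c x * d_wedge (weight c) \<eta> c x)))"
    proof (rule Henstock_Kurzweil_Integration.integral_sum[OF finite_C])
      fix c' assume c': "c' \<in> C"
      have "(\<lambda>x. weight c' c x * (orientation c x * d_wedge (weight c) \<eta> c x)) absolutely_integrable_on img c"
      proof (rule absolutely_integrable_compact_support[OF _ compact_supp[OF c] supp_image_subset[OF c]])
        show "continuous_on (img c) (\<lambda>x. weight c' c x * (orientation c x * d_wedge (weight c) \<eta> c x))"
          by (rule continuous_on_mult[OF smooth_on_imp_continuous_on[OF smooth_on_weight[OF cA c']]
                continuous_on_orientation_mult[OF cA smooth_on_d_wedge_weight[OF cA c]]])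
        fix x assume x: "x \<in> img c - snd c ` supp c"
        have "d_wedge (weight c) \<eta> c x = 0" using d_wedge_weight_zero[OF cA _ not_in_supp[OF x]] x by blast
        then show "weight c' c x * (orientation c x * d_wedge (weight c) \<eta> c x) = 0" by simp
      qed
      then show "(\<lambda>x. weight c' c x * (orientation c x * d_wedge (weight c) \<eta> c x)) integrable_on img c"
        by (rule set_lebesgue_integral_eq_integral(1))
    qed
    also have "\<dots> = (\<Sum>c'\<in>C. integral (img c') (?I c c'))"
      by (rule sum.cong[OF refl integral_change_of_charts[OF c]])
    finally show ?thesis .
  qed
  then have "(\<Sum>c\<in>C. integral (img c) (\<lambda>x. orientation c x * (weight c c x * ext_deriv 2 \<eta> c x frame))) =
      - (\<Sum>c\<in>C. \<Sum>c'\<in>C. integral (img c') (?I c c'))"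
    by (simp add: integral_by_parts_chart sum_negf)
  also have "(\<Sum>c\<in>C. \<Sum>c'\<in>C. integral (img c') (?I c c')) = (\<Sum>c'\<in>C. \<Sum>c\<in>C. integral (img c') (?I c c'))"
    by (rule sum.swap)
  also have "\<dots> = (\<Sum>c'\<in>C. integral (img c') (\<lambda>x. \<Sum>c\<in>C. ?I c c' x))"
    by (rule sum.cong[OF refl Henstock_Kurzweil_Integration.integral_sum[OF finite_C, symmetric]])
       (rule set_lebesgue_integral_eq_integral(1)[OF absolutely_integrable_weighted])
  also have "\<dots> = (\<Sum>c'\<in>C. integral (img c') (\<lambda>x. 0))"
  proof (rule sum.cong[OF refl], rule integral_cong)
    fix c' x assume "c' \<in> C" "x \<in> img c'"
    then show "(\<Sum>c\<in>C. ?I c c' x) = 0"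
      by (simp add: sum_d_wedge_weight[OF C_chart] flip: sum_distrib_left)
  qed
  finally show ?thesis by simp
qed

end

context oriented_closed_manifold
begin

text \<open>The choice term inside \<open>integral_over\<close>, named so that the existence of a
  partition yields its properties.\<close>

definition chosen_partition :: "'a chart set \<times> ('a chart \<Rightarrow> 'a \<Rightarrow> real)" where
  "chosen_partition = (SOME (C, \<rho>). partition_of_unity X \<A> C \<rho>)"

lemma partition_of_unity_chosen: "partition_of_unity X \<A> (fst chosen_partition) (snd chosen_partition)"
proof -
  have "\<exists>P. case P of (C, \<rho>) \<Rightarrow> partition_of_unity X \<A> C \<rho>"
    using ex_partition_of_unity by auto
  from someI_ex[OF this] show ?thesis
    unfolding chosen_partition_def by (simp add: case_prod_unfold)
qed

lemma integral_over_eq: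
  "integral_over X \<A> \<mu> \<omega> = (\<Sum>c\<in>fst chosen_partition. integral (img c)
    (\<lambda>x. orientation c x * (snd chosen_partition c (param c x) * \<omega> c x frame)))"
  unfolding integral_over_def chosen_partition_def[symmetric] orientation_def
  by (simp add: case_prod_unfold Let_def)

theorem stokes:
  assumes "diff_form \<A> 2 \<eta>"
  shows "integral_over X \<A> \<mu> (ext_deriv 2 \<eta>) = 0"
proof -
  interpret partitioned_manifold X \<A> \<mu> "fst chosen_partition" "snd chosen_partition" \<eta>
    by unfold_locales (rule partition_of_unity_chosen, rule assms)
  show ?thesis using stokes_partition unfolding integral_over_eq weight_def .
qed

lemma integral_over_cong:
  assumes "\<And>c x. c \<in> \<A> \<Longrightarrow> x \<in> img c \<Longrightarrow> \<omega> c x frame = \<omega>' c x frame"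
  shows "integral_over X \<A> \<mu> \<omega> = integral_over X \<A> \<mu> \<omega>'"
proof -
  have "fst chosen_partition \<subseteq> \<A>" using partition_of_unity_chosen unfolding partition_of_unity_def by blast
  then show ?thesis unfolding integral_over_eq
    by (intro sum.cong refl integral_cong) (simp add: assms subsetD)
qed

lemma integral_over_add:
  assumes "\<And>c. c \<in> \<A> \<Longrightarrow> smooth_on (img c) (\<lambda>x. \<omega> c x frame)" "\<And>c. c \<in> \<A> \<Longrightarrow> smooth_on (img c) (\<lambda>x. \<omega>' c x frame)"
  shows "integral_over X \<A> \<mu> (\<lambda>c x v. \<omega> c x v + \<omega>' c x v) = integral_over X \<A> \<mu> \<omega> + integral_over X \<A> \<mu> \<omega>'"
proof -
  \<comment> \<open>The locale takes a two-form as a parameter; the zero form serves here, where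
    facts about weights and supports are wanted.\<close>
  interpret partitioned_manifold X \<A> \<mu> "fst chosen_partition" "snd chosen_partition" "\<lambda>c x v. 0"
  proof unfold_locales
    show "diff_form \<A> 2 (\<lambda>c x v. 0)"
      by (rule diff_form_2I[where b = "\<lambda>c x u v. 0"]) (auto simp: bilinear_alt_def linear_zero smooth_on_const)
  qed (rule partition_of_unity_chosen)
  have int: "(\<lambda>x. orientation c x * (weight c c x * \<omega> c x frame)) integrable_on img c"
    if c: "c \<in> fst chosen_partition" and \<omega>: "\<And>c. c \<in> \<A> \<Longrightarrow> smooth_on (img c) (\<lambda>x. \<omega> c x frame)" for c and \<omega> :: "'a tensor"
  proof -
    note cA = C_chart[OF c]
    have "(\<lambda>x. orientation c x * (weight c c x * \<omega> c x frame)) absolutely_integrable_on img c"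
    proof (rule absolutely_integrable_compact_support[OF _ compact_supp[OF c] supp_image_subset[OF c]])
      show "continuous_on (img c) (\<lambda>x. orientation c x * (weight c c x * \<omega> c x frame))"
        by (rule continuous_on_orientation_mult[OF cA smooth_on_mult[OF open_img[OF cA] smooth_on_weight[OF cA c] \<omega>[OF cA]]])
      fix x assume x: "x \<in> img c - snd c ` supp c"
      have "weight c c x = 0" using weight_zero[OF cA _ not_in_supp[OF x]] x by blast
      then show "orientation c x * (weight c c x * \<omega> c x frame) = 0" by simp
    qed
    then show ?thesis by (rule set_lebesgue_integral_eq_integral(1))
  qed
  show ?thesis
    unfolding integral_over_eq weight_def[symmetric] sum.distrib[symmetric]
    by (rule sum.cong[OF refl])
       (simp add: distrib_left Henstock_Kurzweil_Integration.integral_add[OF int[where \<omega> = \<omega>, OF _ assms(1)] int[where \<omega> = \<omega>', OF _ assms(2)]])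
qed

end

section \<open>Contact metric geometry\<close>

text \<open>The matrix on the left is the Gram matrix of the rows of \<open>P\<close> with respect
  to \<open>G\<close>.\<close>

lemma conjugate_matrix_entry:
  fixes P G :: "real^3^3"
  shows "(P ** G ** transpose P) $ i $ j = P $ i \<bullet> (G *v (P $ j))"
  by (simp add: matrix_matrix_mult_def matrix_vector_mult_def inner_vec_def transpose_def sum_3 algebra_simps)

text \<open>The K-contact structure on one tangent space in coordinates: \<open>k\<close> is
  \<kappa>, \<open>W\<close> is d\<kappa>, \<open>R\<close> is \<xi>, \<open>J\<close> is \<phi>,
  \<open>G\<close> is the Gram matrix of the metric, and \<open>m\<close> is the value of \<kappa>
  \<and> d\<kappa> on the coordinate frame.\<close>

locale contact_vector_space =
  fixes k :: "real^3 \<Rightarrow> real" and W :: "real^3 \<Rightarrow> real^3 \<Rightarrow> real" and R :: "real^3"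
    and J :: "real^3 \<Rightarrow> real^3" and G :: "real^3^3" and m :: real
  assumes k: "linear k" and W: "bilinear_alt W" and kR: "k R = 1" and WR: "W R v = 0"
    and JR: "J R = 0" and kJ: "k u = 0 \<Longrightarrow> k (J u) = 0" and JJ: "k u = 0 \<Longrightarrow> J (J u) = - u"
    and G: "u \<bullet> (G *v v) = k u * k v + W u (J v)" and G_sym: "transpose G = G"
    and G_pos: "u \<noteq> 0 \<Longrightarrow> u \<bullet> (G *v u) > 0"
    and m: "m = k e1 * W e2 e3 + k e2 * W e3 e1 + k e3 * W e1 e2" and m_nonzero: "m \<noteq> 0"
begin

lemma G_commute: "u \<bullet> (G *v v) = v \<bullet> (G *v u)"
proof -
  have "u \<bullet> (G *v v) = (transpose G *v u) \<bullet> v" by (simp add: dot_lmul_matrix)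
  then show ?thesis by (simp add: G_sym inner_commute)
qed

lemma volume: "k u * W v w + k v * W w u + k w * W u v = m * det (vector [u, v, w] :: real^3^3)"
  using trilinear_alt_det[OF trilinear_alt_wedge_1_2[OF k W], of u v w] m by (simp only: mult.commute)

text \<open>The contraction of \<kappa> \<and> d\<kappa> with \<xi> is d\<kappa>, because
  \<kappa>(\<xi>) = 1 and d\<kappa> is annihilated by \<xi>.\<close>

lemma volume_Reeb: "W v w = m * det (vector [R, v, w] :: real^3^3)"
  using volume[of R v w] kR WR bilinear_alt_swap[OF W, of w R] by simp

text \<open>In an adapted frame R, u, Ju with u in the contact plane, the Gram matrix is diagonal
  with entries 1, N, N, so det(G) det(P)^2 = N^2. The volume of the same frame is m det(P) = N.
  Comparing the two removes det(P).\<close>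

lemma det_G: "det G = m\<^sup>2"
proof -
  note lin = bilinear_altD(1,2)[OF W]
  have "\<exists>a b. W a b \<noteq> 0"
  proof (rule ccontr)
    assume "\<not> ?thesis"
    then have "m = 0" using m by simp
    with m_nonzero show False ..
  qed
  then obtain a b where ab: "W a b \<noteq> 0" by blast
  \<comment> \<open>The projection of \<open>a\<close> to the contact plane along \<open>R\<close>.
    It leaves \<open>W _ b\<close> unchanged because \<open>W\<close> annihilates \<open>R\<close>,
    so the result is not 0.\<close>
  define u where "u = a - k a *\<^sub>R R"
  have ku: "k u = 0" by (simp add: u_def linear_diff[OF k] linear_cmul[OF k] kR)
  have "W u b = W a b" by (simp add: u_def linear_diff[OF lin(1)] linear_cmul[OF lin(1)] WR)
  with ab have "u \<noteq> 0" using linear_0[OF lin(1)] by metis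
  define N where "N = W u (J u)"
  have N: "N > 0" using G_pos[OF \<open>u \<noteq> 0\<close>] by (simp add: G ku N_def)
  define P where "P = (vector [R, u, J u] :: real^3^3)"
  have "m * det P = N" using volume_Reeb[of u "J u"] by (simp add: P_def N_def)
  then have 1: "m\<^sup>2 * (det P)\<^sup>2 = N\<^sup>2" by (simp flip: power_mult_distrib)
  \<comment> \<open>The values from which the entries of the Gram matrix in the adapted frame are
    computed; J(Ju) = -u accounts for the negated arguments.\<close>
  have z: "W u (- u) = 0" "W (J u) (- u) = N" "W u R = 0" "W (J u) R = 0" "W u 0 = 0" "W (J u) 0 = 0"
    using bilinear_altD(3)[OF W, of u] bilinear_alt_swap[OF W, of "J u" u] bilinear_alt_swap[OF W, of R u]
      bilinear_alt_swap[OF W, of R "J u"] WR linear_neg[OF lin(2)] linear_0[OF lin(2)]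
    by (simp_all add: N_def)
  have "det (P ** G ** transpose P) = N\<^sup>2"
    unfolding det_3 conjugate_matrix_entry G P_def
    by (simp add: kR ku WR JR kJ[OF ku] JJ[OF ku] z linear_neg[OF k] power2_eq_square flip: N_def)
  then have 2: "det G * (det P)\<^sup>2 = N\<^sup>2"
    by (simp add: det_mul power2_eq_square mult_ac)
  have "(det P)\<^sup>2 \<noteq> 0" using \<open>m * det P = N\<close> N by auto
  with 1 2 show ?thesis by (metis mult_right_cancel)
qed

text \<open>The left side is the coefficient in \<open>volume_form\<close>: the Riemannian volume,
  oriented by \<kappa> \<and> d\<kappa>, is \<kappa> \<and> d\<kappa> itself.\<close>

lemma sgn_sqrt_det_G: "sgn m * sqrt (det G) = m"
  by (simp add: det_G sgn_mult_abs)

lemma ex_metric_dual: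
  assumes "linear b"
  shows "\<exists>u. \<forall>v. b v = u \<bullet> (G *v v)"
proof -
  have "det G \<noteq> 0" using m_nonzero by (simp add: det_G)
  note inv = matrix_inv_symmetric[OF G_sym this]
  define p where "p = (\<chi> i. b (axis i 1))"
  have "b v = (matrix_inv G *v p) \<bullet> (G *v v)" for v
  proof -
    have "(matrix_inv G *v p) \<bullet> (G *v v) = v \<bullet> (G *v (matrix_inv G *v p))" by (rule G_commute)
    also have "\<dots> = v \<bullet> p" by (simp add: matrix_vector_mul_assoc inv)
    also have "\<dots> = b v" using linear_basis_3[OF assms, of v] by (simp add: p_def inner_vec_def sum_3)
    finally show ?thesis ..
  qed
  then show ?thesis by blast
qed

text \<open>Puts a two-form into the shape that \<open>hodge_2\<close> expects, with the factor
  \<open>m\<close>; since det G = m^2, all scalars then cancel and \<star> of the form is minus the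
  metric dual of u.\<close>

lemma ex_volume_dual:
  assumes "bilinear_alt b"
  shows "\<exists>u. \<forall>v w. b v w = m * det (vector [u, v, w] :: real^3^3)"
proof (intro exI allI)
  fix v w
  show "b v w = m * det (vector [(1 / m) *\<^sub>R vector [b e2 e3, b e3 e1, b e1 e2], v, w] :: real^3^3)"
    unfolding bilinear_alt_cross[OF assms, of v w]
    using linear_cmul[OF trilinear_altD(1)[OF trilinear_alt_det_vector], of "1 / m" "vector [b e2 e3, b e3 e1, b e1 e2]" v w]
      m_nonzero by simp
qed

end

lemma gram_apply:
  assumes "multilinear 2 (g c x)"
  shows "u \<bullet> (gram g c x *v v) = apply2 (g c x) u v"
proof -
  have l: "linear (\<lambda>u. apply2 (g c x) u v)" "linear (apply2 (g c x) u)" for u v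
    using assms by (simp_all only: multilinear_2)
  show ?thesis
    unfolding linear_basis_3[OF l(1), of u] linear_basis_3[OF l(2), of _ v]
    by (simp add: gram_def inner_vec_def matrix_vector_mult_def sum_3 apply2_def algebra_simps)
qed

section \<open>Forms on a K-contact manifold\<close>

locale K_contact_manifold = closed_manifold +
  fixes \<phi> :: "'a endo" and \<xi> :: "'a vfield" and \<kappa> g :: "'a tensor"
  assumes K_contact: "K_contact \<A> \<phi> \<xi> \<kappa> g"
begin

lemma \<kappa>: "diff_form \<A> 1 \<kappa>"
  using K_contact unfolding K_contact_def contact_form_def by blast

lemma d\<kappa>: "diff_form \<A> 2 (ext_deriv 1 \<kappa>)"
  by (rule diff_form_ext_deriv_1[OF \<kappa>])

lemma contact_volume_nonzero: "c \<in> \<A> \<Longrightarrow> x \<in> img c \<Longrightarrow> contact_volume \<kappa> c x frame \<noteq> 0"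
  using K_contact unfolding K_contact_def contact_form_def by blast

sublocale oriented_closed_manifold X \<A> "contact_volume \<kappa>"
proof unfold_locales
  show "diff_form \<A> 3 (contact_volume \<kappa>)"
    unfolding contact_volume_def by (rule diff_form_wedge_1_2[OF \<kappa> d\<kappa>])
qed (rule contact_volume_nonzero)

lemma reeb_smooth: "c \<in> \<A> \<Longrightarrow> smooth_on (img c) (\<xi> c)"
  using K_contact unfolding K_contact_def reeb_field_def vector_field_def by blast

lemma wedge_1_2_frame:
  assumes "diff_form \<A> 1 \<alpha>" "diff_form \<A> 2 \<beta>" "c \<in> \<A>" "x \<in> img c"
  shows "wedge 1 2 \<alpha> \<beta> c x frame = apply1 (\<alpha> c x) e1 * apply2 (\<beta> c x) e2 e3 +
    apply1 (\<alpha> c x) e2 * apply2 (\<beta> c x) e3 e1 + apply1 (\<alpha> c x) e3 * apply2 (\<beta> c x) e1 e2"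
  unfolding wedge_1_2[of \<alpha> c x \<beta>, OF diff_formD(1)[OF assms(1,3,4)] diff_formD[OF assms(2-4)]]
  by simp

lemma contact_vector_space:
  assumes c: "c \<in> \<A>" and x: "x \<in> img c"
  shows "contact_vector_space (apply1 (\<kappa> c x)) (apply2 (ext_deriv 1 \<kappa> c x)) (\<xi> c x) (\<phi> c x) (gram g c x)
    (contact_volume \<kappa> c x frame)"
proof -
  note k = diff_form_1_linear[OF \<kappa> c x] and W = diff_form_2_bilinear[OF d\<kappa> c x]
  have reeb: "interior_prod \<xi> \<kappa> c x v = 1" "interior_prod \<xi> (ext_deriv 1 \<kappa>) c x v = 0" for v
    using K_contact c x unfolding K_contact_def reeb_field_def by blast+
  have K: "\<phi> c x (\<xi> c x) = 0"
    "\<And>u. \<kappa> c x (\<lambda>_. u) = 0 \<longrightarrow> \<kappa> c x (\<lambda>_. \<phi> c x u) = 0 \<and> \<phi> c x (\<phi> c x u) = - u"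
    "\<And>v. g c x v = \<kappa> c x (\<lambda>_. v 0) * \<kappa> c x (\<lambda>_. v 1) + ext_deriv 1 \<kappa> c x (case_nat (v 0) (\<lambda>_. \<phi> c x (v 1)))"
    using K_contact c x unfolding K_contact_def by blast+
  have gm: "multilinear 2 (g c x)" and g_sym: "\<And>v. g c x v = g c x (\<lambda>i. v (1 - i))"
    and g_pos: "\<And>v. v 0 = v 1 \<Longrightarrow> v 0 \<noteq> 0 \<Longrightarrow> g c x v > 0"
    using K_contact c x unfolding K_contact_def riemannian_metric_def tensor_field_def by blast+
  have g2: "g c x v = apply2 (g c x) (v 0) (v 1)" for v using gm by (simp only: multilinear_2)
  show ?thesis
  proof (rule contact_vector_space.intro)
    show "apply1 (\<kappa> c x) (\<xi> c x) = 1"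
      using reeb(1)[of "\<lambda>_. 0"] unfolding interior_prod_def k(2)[of "case_nat _ _"] by simp
    show "apply2 (ext_deriv 1 \<kappa> c x) (\<xi> c x) v = 0" for v
      using reeb(2)[of "\<lambda>_. v"] unfolding interior_prod_def W(2)[of "case_nat _ _"] by simp
    show "\<phi> c x (\<xi> c x) = 0" by (rule K(1))
    show "apply1 (\<kappa> c x) u = 0 \<Longrightarrow> apply1 (\<kappa> c x) (\<phi> c x u) = 0" 
      "apply1 (\<kappa> c x) u = 0 \<Longrightarrow> \<phi> c x (\<phi> c x u) = - u" for u
      using K(2)[of u] by (simp_all add: apply1_def)
    show "u \<bullet> (gram g c x *v v) = apply1 (\<kappa> c x) u * apply1 (\<kappa> c x) v + apply2 (ext_deriv 1 \<kappa> c x) u (\<phi> c x v)" for u v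
      unfolding gram_apply[where g = g, OF gm] apply2_def[of "g c x"] K(3)[of "case_nat u (\<lambda>_. v)"] by (simp add: apply1_def apply2_def)
    have sym: "apply2 (g c x) u v = apply2 (g c x) v u" for u v
      using g_sym[of "case_nat u (\<lambda>_. v)"] unfolding g2[of "case_nat _ _"] g2[of "\<lambda>i. case_nat _ _ (1 - i)"] by simp
    show "transpose (gram g c x) = gram g c x"
      using sym by (simp add: transpose_def gram_def apply2_def vec_eq_iff)
    show "0 < u \<bullet> (gram g c x *v u)" if "u \<noteq> 0" for u
      unfolding gram_apply[where g = g, OF gm] apply2_def using g_pos[of "case_nat u (\<lambda>_. u)"] that by simp
    show "contact_volume \<kappa> c x frame = apply1 (\<kappa> c x) e1 * apply2 (ext_deriv 1 \<kappa> c x) e2 e3 +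
        apply1 (\<kappa> c x) e2 * apply2 (ext_deriv 1 \<kappa> c x) e3 e1 + apply1 (\<kappa> c x) e3 * apply2 (ext_deriv 1 \<kappa> c x) e1 e2"
      unfolding contact_volume_def by (rule wedge_1_2_frame[OF \<kappa> d\<kappa> c x])
  qed (rule k(1), rule W(1), rule contact_volume_nonzero[OF c x])
qed

end

declare One_nat_def [simp del]

text \<open>Degrees are written with the literal 1. With \<open>One_nat_def\<close> removed, terms
  such as \<open>lie_deriv 1\<close> keep their shape, and these rules supply the two
  simplifications that relied on \<open>Suc 0\<close>.\<close>

lemma one_nat_simps [simp]:
  fixes h :: "nat \<Rightarrow> real"
  shows "case_nat a f 1 = f 0" "(\<Sum>i<1. h i) = h 0"
proof -
  have "{..<1::nat} = {0}" by auto
  then show "(\<Sum>i<1. h i) = h 0" by simp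
qed (simp add: One_nat_def)

context atlas
begin

text \<open>The product rule for \<alpha>(V), where both the form and its argument vary; V is
  expanded over the basis so that only products of functions are differentiated.\<close>

lemma derivative_form_1_vector_field:
  assumes \<alpha>: "diff_form \<A> 1 \<alpha>" and c: "c \<in> \<A>" and x: "x \<in> img c" and V: "smooth_on (img c) V"
  shows "((\<lambda>y. apply1 (\<alpha> c y) (V y)) has_derivative
    (\<lambda>v. frechet_derivative (\<lambda>y. apply1 (\<alpha> c y) (V x)) (at x) v +
      apply1 (\<alpha> c x) (frechet_derivative V (at x) v))) (at x)"
proof -
  note lin = diff_form_1_linear(1)[OF \<alpha> c]
  let ?D = "\<lambda>b. frechet_derivative (\<lambda>y. apply1 (\<alpha> c y) b) (at x)"
  have rep: "f w = (\<Sum>b\<in>Basis. (w \<bullet> b) * f b)" if "linear f" for f :: "real^3 \<Rightarrow> real" and w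
    using linear_sum[OF that, of "\<lambda>b. (w \<bullet> b) *\<^sub>R b" Basis]
    by (simp add: euclidean_representation linear_cmul[OF that])
  have "((\<lambda>y. \<Sum>b\<in>Basis. (V y \<bullet> b) * apply1 (\<alpha> c y) b) has_derivative
      (\<lambda>v. \<Sum>b\<in>Basis. (V x \<bullet> b) * ?D b v + (frechet_derivative V (at x) v \<bullet> b) * apply1 (\<alpha> c x) b)) (at x)"
    by (rule has_derivative_sum[OF has_derivative_mult[OF has_derivative_inner_left[OF smooth_on_has_derivative[OF V x]]
            smooth_on_has_derivative[OF diff_form_1_smooth[OF \<alpha> c] x]]])
  then have "((\<lambda>y. apply1 (\<alpha> c y) (V y)) has_derivative
      (\<lambda>v. \<Sum>b\<in>Basis. (V x \<bullet> b) * ?D b v + (frechet_derivative V (at x) v \<bullet> b) * apply1 (\<alpha> c x) b)) (at x)"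
    by (rule has_derivative_transform_within_open[OF _ open_img[OF c] x]) (rule rep[OF lin, symmetric])
  then show ?thesis
    unfolding sum.distrib rep[OF lin[OF x], symmetric]
      rep[OF linear_derivative_form_1[OF \<alpha> c x], symmetric] .
qed

end

context oriented_closed_manifold
begin

lemma integral_over_neg: "integral_over X \<A> \<mu> (neg \<omega>) = - integral_over X \<A> \<mu> \<omega>"
  by (simp add: integral_over_eq neg_def sum_negf)

lemma smooth_on_ext_deriv_2_frame:
  assumes "diff_form \<A> 2 \<eta>" "c \<in> \<A>"
  shows "smooth_on (img c) (\<lambda>x. ext_deriv 2 \<eta> c x frame)"
  by (rule smooth_on_cong[OF open_img[OF assms(2)] ext_deriv_2_frame[OF assms, symmetric]], assumption)
     (intro smooth_on_add open_img[OF assms(2)] smooth_on_derivative diff_form_2_smooth[OF assms])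

end

section \<open>The operators on a horizontal one-form\<close>

locale horizontal_one_form = K_contact_manifold +
  fixes A :: "'a tensor"
  assumes horizontal: "horizontal_form \<A> \<xi> 1 A"
begin

lemma A: "diff_form \<A> 1 A"
  using horizontal unfolding horizontal_form_def by blast

lemma dA: "diff_form \<A> 2 (ext_deriv 1 A)"
  by (rule diff_form_ext_deriv_1[OF A])

lemma A_reeb: "c \<in> \<A> \<Longrightarrow> x \<in> img c \<Longrightarrow> apply1 (A c x) (\<xi> c x) = 0"
proof -
  assume cx: "c \<in> \<A>" "x \<in> img c"
  have "interior_prod \<xi> A c x (\<lambda>_. 0) = 0"
    using horizontal cx unfolding horizontal_form_def by (metis zero_less_one)
  then show ?thesis unfolding interior_prod_def diff_form_1_linear(2)[OF A cx, of "case_nat _ _"] by simp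
qed

text \<open>Cartan's formula, where \<open>\<iota>\<^sub>\<xi>A = 0\<close>.\<close>

lemma lie_deriv_horizontal:
  assumes c: "c \<in> \<A>" and x: "x \<in> img c"
  shows "lie_deriv 1 \<xi> A c x v = apply2 (ext_deriv 1 A c x) (\<xi> c x) (v 0)"
proof -
  let ?D = "\<lambda>u. frechet_derivative (\<lambda>y. apply1 (A c y) u) (at x)"
  let ?D\<xi> = "frechet_derivative (\<xi> c) (at x)"
  \<comment> \<open>Differentiating A(\<xi>) = 0 trades A(D\<xi> w), which occurs in the Lie
    derivative, for minus the derivative of A at the fixed argument \<xi>. This is the second half
    of \<iota>(\<xi>) dA.\<close>
  have "((\<lambda>y. apply1 (A c y) (\<xi> c y)) has_derivative (\<lambda>_. 0)) (at x)"
    by (rule has_derivative_transform_within_open[OF has_derivative_const open_img[OF c] x]) (simp add: A_reeb[OF c])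
  from has_derivative_unique[OF derivative_form_1_vector_field[OF A c x reeb_smooth[OF c]] this]
  have "?D (\<xi> c x) w + apply1 (A c x) (?D\<xi> w) = 0" for w by (rule fun_cong)
  then have D\<xi>: "apply1 (A c x) (?D\<xi> w) = - ?D (\<xi> c x) w" for w by (simp add: eq_neg_iff_add_eq_0 add.commute)
  have "frechet_derivative (\<lambda>y. A c y v) (at x) = ?D (v 0)"
    by (rule frechet_derivative_transform_within_open[OF smooth_on_differentiable[OF diff_form_smooth[OF A c] x] open_img[OF c] x])
       (rule diff_form_1_linear(2)[OF A c])
  then show ?thesis
    unfolding lie_deriv_def apply2_def ext_deriv_1[OF A c x] diff_form_1_linear(2)[OF A c x, of "v(_ := _)"]
    by (simp add: D\<xi>)
qed

definition F :: "'a chart \<Rightarrow> real^3 \<Rightarrow> real" where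
  "F c x = wedge 1 2 \<kappa> (ext_deriv 1 A) c x frame / contact_volume \<kappa> c x frame"

lemma F_smooth: "c \<in> \<A> \<Longrightarrow> smooth_on (img c) (F c)"
  unfolding F_def[abs_def]
  by (rule smooth_on_divide[OF open_img diff_form_smooth[OF diff_form_wedge_1_2[OF \<kappa> dA]] diff_form_smooth[OF \<mu>] contact_volume_nonzero])

text \<open>Numerator and denominator are frame values of three-forms and acquire the same Jacobian,
  which is nonzero because the contact volume vanishes in no chart.\<close>

lemma F_transition:
  assumes "c \<in> \<A>" "c' \<in> \<A>" "x \<in> overlap c c'"
  shows "F c x = F c' (transition c c' x)"
proof -
  have "x \<in> img c" using assms(3) overlap_subset by blast
  then have "det (matrix (frechet_derivative (transition c c') (at x))) \<noteq> 0"
    using contact_volume_nonzero[OF assms(1)] diff_form_3_natural[OF \<mu> assms] by force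
  then show ?thesis
    unfolding F_def diff_form_3_natural[OF \<mu> assms] diff_form_3_natural[OF diff_form_wedge_1_2[OF \<kappa> dA] assms]
    by simp
qed

lemma op_D1_eq:
  assumes c: "c \<in> \<A>" and x: "x \<in> img c"
  shows "op_D1 \<xi> \<kappa> g A c x v = apply2 (ext_deriv 1 A c x) (\<xi> c x) (v 0) +
    frechet_derivative (F c) (at x) (v 0) - apply1 (\<kappa> c x) (v 0) * frechet_derivative (F c) (at x) (\<xi> c x)"
proof -
  define \<beta> where "\<beta> = d_H \<xi> \<kappa> 1 A"
  define s where "s = star_H \<xi> \<kappa> g 2 \<beta>"
  have s: "s c y v = F c y" if y: "y \<in> img c" for y v
  proof -
    interpret contact_vector_space "apply1 (\<kappa> c y)" "apply2 (ext_deriv 1 \<kappa> c y)" "\<xi> c y" "\<phi> c y" "gram g c y"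
      "contact_volume \<kappa> c y frame" by (rule contact_vector_space[OF c y])
    let ?k = "apply1 (\<kappa> c y)"
    let ?l = "apply2 (ext_deriv 1 A c y) (\<xi> c y)"
    let ?b = "\<lambda>u v. apply2 (ext_deriv 1 A c y) u v - (?k u * ?l v - ?k v * ?l u)"
    note Z = diff_form_2_bilinear[OF dA c y]
    have l: "linear ?l" by (rule bilinear_altD(2)[OF Z(1)])
    have lm2: "apply1 (lie_deriv 1 \<xi> A c y) = ?l"
      by (rule ext) (simp add: apply1_def lie_deriv_horizontal[OF c y])
    have lm1: "multilinear 1 (lie_deriv 1 \<xi> A c y)"
      unfolding multilinear_1 lm2 using l by (simp add: lie_deriv_horizontal[OF c y])
    have \<beta>: "\<beta> c y v = ?b (v 0) (v 1)" for v
      unfolding \<beta>_def d_H_def Z(2)[of v]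
        wedge_1_1[where \<alpha> = \<kappa> and \<beta> = "lie_deriv 1 \<xi> A" and c = c and x = y, OF diff_formD(1)[OF \<kappa> c y] lm1] lm2 ..
    then have \<beta>2: "apply2 (\<beta> c y) = ?b" by (intro ext) (simp add: apply2_def)
    have balt: "bilinear_alt ?b"
      using bilinear_alt_wedge_1_1[OF k l] Z(1) unfolding bilinear_alt_def
      by (simp add: linear_compose_sub)
    have \<beta>m: "multilinear 2 (\<beta> c y)" using alternating_form_2[of "\<beta> c y"] \<beta> \<beta>2 balt by simp
    obtain u where u: "\<And>v w. ?b v w = contact_volume \<kappa> c y frame * det (vector [u, v, w] :: real^3^3)"
      using ex_volume_dual[OF balt] by blast
    have detG: "det (gram g c y) \<noteq> 0" using m_nonzero by (simp add: det_G)
    have "star \<kappa> g 2 \<beta> c y w = - (u \<bullet> (gram g c y *v w 0))" for w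
      unfolding star_def hodge_2[where g = g and c = c and x = y and \<beta> = \<beta>, OF G_sym detG _ \<beta>m, unfolded \<beta>2, OF u] sgn_sqrt_det_G
      using m_nonzero by (simp add: det_G power2_eq_square)
    then have "s c y v = u \<bullet> (gram g c y *v \<xi> c y)"
      by (simp add: s_def star_H_def neg_def interior_prod_def)
    \<comment> \<open>g(u, \<xi>) = \<kappa>(u), because \<kappa>(\<xi>) = 1 and \<phi> annihilates
      \<xi>.\<close>
    also have "\<dots> = ?k u" by (simp add: G kR JR linear_0[OF bilinear_altD(2)[OF W]])
    also have "\<dots> = F c y"
    proof -
      \<comment> \<open>\<open>?b\<close> differs from dA by a wedge product with \<kappa>, which a
        further factor \<kappa> annihilates.\<close>
      have "wedge 1 2 \<kappa> (ext_deriv 1 A) c y frame = ?k e1 * ?b e2 e3 + ?k e2 * ?b e3 e1 + ?k e3 * ?b e1 e2"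
        unfolding wedge_1_2_frame[OF \<kappa> dA c y] by (simp add: algebra_simps)
      also have "\<dots> = contact_volume \<kappa> c y frame * ?k u"
        unfolding u linear_basis_3[OF k, of u] by (simp add: det_3 axis_def algebra_simps)
      finally show ?thesis using m_nonzero by (simp add: F_def)
    qed
    finally show ?thesis .
  qed
  have D: "frechet_derivative (\<lambda>y. s c y w) (at x) = frechet_derivative (F c) (at x)" for w
    by (rule frechet_derivative_transform_within_open[OF _ open_img[OF c] x, symmetric])
       (simp_all add: smooth_on_differentiable[OF F_smooth[OF c] x] s)
  \<comment> \<open>In degree 0 the correction sum of \<open>lie_deriv\<close> is empty and only the
    derivative along \<xi> remains.\<close>
  have lie: "lie_deriv 0 \<xi> s c x w = frechet_derivative (F c) (at x) (\<xi> c x)" for w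
    unfolding lie_deriv_def D by simp
  have "d_H \<xi> \<kappa> 0 s c x v = frechet_derivative (F c) (at x) (v 0) - apply1 (\<kappa> c x) (v 0) * frechet_derivative (F c) (at x) (\<xi> c x)"
    unfolding d_H_def wedge_1_0[where \<alpha> = \<kappa> and \<beta> = "lie_deriv 0 \<xi> s" and c = c and x = x, OF diff_formD(1)[OF \<kappa> c x], unfolded lie, OF refl]
    by (simp add: ext_deriv_def D)
  then show ?thesis
    unfolding op_D1_def lie_deriv_horizontal[OF c x] \<beta>_def[symmetric] s_def[symmetric] by simp
qed

text \<open>What the pointwise wedge and star formulas require of the one-form \<open>op_D1\<close>.
  It is horizontal since dA is alternating and \<kappa>(\<xi>) = 1 lets the two derivatives of F
  along \<xi> cancel.\<close>

lemma op_D1_linear: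
  assumes c: "c \<in> \<A>" and x: "x \<in> img c"
  shows "multilinear 1 (op_D1 \<xi> \<kappa> g A c x)" "linear (apply1 (op_D1 \<xi> \<kappa> g A c x))"
    "apply1 (op_D1 \<xi> \<kappa> g A c x) (\<xi> c x) = 0"
proof -
  interpret contact_vector_space "apply1 (\<kappa> c x)" "apply2 (ext_deriv 1 \<kappa> c x)" "\<xi> c x" "\<phi> c x" "gram g c x"
    "contact_volume \<kappa> c x frame" by (rule contact_vector_space[OF c x])
  note Z = diff_form_2_bilinear(1)[OF dA c x]
  have DF: "linear (frechet_derivative (F c) (at x))"
    by (rule linear_frechet_derivative[OF smooth_on_differentiable[OF F_smooth[OF c] x]])
  have eq: "apply1 (op_D1 \<xi> \<kappa> g A c x) = (\<lambda>u. apply2 (ext_deriv 1 A c x) (\<xi> c x) u +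
    frechet_derivative (F c) (at x) u - apply1 (\<kappa> c x) u * frechet_derivative (F c) (at x) (\<xi> c x))"
    by (rule ext) (simp add: apply1_def[of "op_D1 _ _ _ _ _ _"] op_D1_eq[OF c x])
  show lin: "linear (apply1 (op_D1 \<xi> \<kappa> g A c x))"
    unfolding eq using bilinear_altD(2)[OF Z, of "\<xi> c x"] DF k
    by (intro linearI) (simp_all add: linear_add linear_cmul algebra_simps)
  show "multilinear 1 (op_D1 \<xi> \<kappa> g A c x)"
    unfolding multilinear_1 using lin eq by (simp add: op_D1_eq[OF c x])
  show "apply1 (op_D1 \<xi> \<kappa> g A c x) (\<xi> c x) = 0"
    unfolding eq by (simp add: bilinear_altD(3)[OF Z] kR)
qed

lemma op_D_eq:
  assumes c: "c \<in> \<A>" and x: "x \<in> img c"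
  shows "op_D \<xi> \<kappa> g A c x v = apply1 (\<kappa> c x) (v 0) * apply1 (op_D1 \<xi> \<kappa> g A c x) (v 1) -
    apply1 (\<kappa> c x) (v 1) * apply1 (op_D1 \<xi> \<kappa> g A c x) (v 0)"
  unfolding op_D_def by (rule wedge_1_1[where \<alpha> = \<kappa> and \<beta> = "op_D1 \<xi> \<kappa> g A" and c = c and x = x, OF diff_formD(1)[OF \<kappa> c x] op_D1_linear(1)[OF c x]])

text \<open>Let u be the vector whose contraction with the volume is DA. Then -\<star>DA is the
  metric dual of u by \<open>hodge_2\<close>, and \<star> of that dual is the contraction again by
  \<open>hodge_1\<close>.\<close>

lemma star_star_op_D:
  assumes c: "c \<in> \<A>" and x: "x \<in> img c"
  shows "star \<kappa> g 1 (neg (star \<kappa> g 2 (op_D \<xi> \<kappa> g A))) c x = op_D \<xi> \<kappa> g A c x"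
proof
  fix w
  interpret contact_vector_space "apply1 (\<kappa> c x)" "apply2 (ext_deriv 1 \<kappa> c x)" "\<xi> c x" "\<phi> c x" "gram g c x"
    "contact_volume \<kappa> c x frame" by (rule contact_vector_space[OF c x])
  let ?T = "op_D \<xi> \<kappa> g A"
  let ?b = "\<lambda>u v. apply1 (\<kappa> c x) u * apply1 (op_D1 \<xi> \<kappa> g A c x) v - apply1 (\<kappa> c x) v * apply1 (op_D1 \<xi> \<kappa> g A c x) u"
  have T2: "apply2 (?T c x) = ?b" by (intro ext) (simp add: apply2_def op_D_eq[OF c x])
  have balt: "bilinear_alt ?b" by (rule bilinear_alt_wedge_1_1[OF k op_D1_linear(2)[OF c x]])
  have Tm: "multilinear 2 (?T c x)" using alternating_form_2[of "?T c x"] op_D_eq[OF c x] T2 balt by simp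
  obtain u where u: "\<And>v w. ?b v w = contact_volume \<kappa> c x frame * det (vector [u, v, w] :: real^3^3)"
    using ex_volume_dual[OF balt] by blast
  have detG: "det (gram g c x) \<noteq> 0" using m_nonzero by (simp add: det_G)
  have s2: "neg (star \<kappa> g 2 ?T) c x w = u \<bullet> (gram g c x *v w 0)" for w
    unfolding neg_def star_def hodge_2[where g = g and c = c and x = x and \<beta> = ?T, OF G_sym detG _ Tm, unfolded T2, OF u] sgn_sqrt_det_G
    using m_nonzero by (simp add: det_G power2_eq_square)
  then have a1: "apply1 (neg (star \<kappa> g 2 ?T) c x) v = u \<bullet> (gram g c x *v v)" for v by (simp add: apply1_def)
  have "linear (\<lambda>v. u \<bullet> (gram g c x *v v))"
    by (intro linearI) (simp_all add: matrix_vector_right_distrib inner_add_right matrix_vector_mult_scaleR)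
  moreover have "apply1 (neg (star \<kappa> g 2 ?T) c x) = (\<lambda>v. u \<bullet> (gram g c x *v v))" by (rule ext) (rule a1)
  ultimately have m1: "multilinear 1 (neg (star \<kappa> g 2 ?T) c x)" unfolding multilinear_1 by (simp add: s2)
  show "star \<kappa> g 1 (neg (star \<kappa> g 2 ?T)) c x w = ?T c x w"
    unfolding star_def[of _ _ 1] hodge_1[where g = g and c = c and x = x and \<beta> = "neg (star \<kappa> g 2 ?T)", OF G_sym detG a1 m1] sgn_sqrt_det_G
    by (simp add: op_D_eq[OF c x] u)
qed

text \<open>For b = g(u, _) the form \<star>b is the contraction of the volume with u. Inserting
  \<xi> and negating exchanges u and \<xi>, and the contraction of the volume with \<xi> is
  d\<kappa>.\<close>

lemma star_H_form:
  assumes c: "c \<in> \<A>" and x: "x \<in> img c" and b: "\<And>w. b c x w = u \<bullet> (gram g c x *v w 0)"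
  shows "star_H \<xi> \<kappa> g 1 b c x w = apply2 (ext_deriv 1 \<kappa> c x) u (w 0)"
proof -
  interpret contact_vector_space "apply1 (\<kappa> c x)" "apply2 (ext_deriv 1 \<kappa> c x)" "\<xi> c x" "\<phi> c x" "gram g c x"
    "contact_volume \<kappa> c x frame" by (rule contact_vector_space[OF c x])
  have detG: "det (gram g c x) \<noteq> 0" using m_nonzero by (simp add: det_G)
  have a1: "apply1 (b c x) v = u \<bullet> (gram g c x *v v)" for v by (simp add: apply1_def b)
  have "linear (\<lambda>v. u \<bullet> (gram g c x *v v))"
    by (intro linearI) (simp_all add: matrix_vector_right_distrib inner_add_right matrix_vector_mult_scaleR)
  moreover have "apply1 (b c x) = (\<lambda>v. u \<bullet> (gram g c x *v v))" by (rule ext) (rule a1)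
  ultimately have m1: "multilinear 1 (b c x)" unfolding multilinear_1 by (simp add: b)
  have "star_H \<xi> \<kappa> g 1 b c x w = - (contact_volume \<kappa> c x frame * det (vector [u, \<xi> c x, w 0] :: real^3^3))"
    unfolding star_H_def neg_def interior_prod_def star_def
      hodge_1[where g = g and c = c and x = x and \<beta> = b, OF G_sym detG a1 m1] sgn_sqrt_det_G by simp
  also have "\<dots> = contact_volume \<kappa> c x frame * det (vector [\<xi> c x, u, w 0] :: real^3^3)"
    using trilinear_alt_swap(1)[OF trilinear_alt_det_vector, of "\<xi> c x" u "w 0"] by simp
  finally show ?thesis by (simp only: volume_Reeb)
qed

text \<open>On metric duals of horizontal vectors the operator \<open>star_H\<close> acts as the
  complex structure \<phi>: it sends g(u, _) to d\<kappa>(u, _) = g(\<phi> u, _). With the negation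
  in between, applying it twice gives the identity because \<phi>\<phi> = -1 on the contact
  plane.\<close>

lemma star_H_star_H_op_D1:
  assumes c: "c \<in> \<A>" and x: "x \<in> img c"
  shows "star_H \<xi> \<kappa> g 1 (neg (star_H \<xi> \<kappa> g 1 (op_D1 \<xi> \<kappa> g A))) c x = op_D1 \<xi> \<kappa> g A c x"
proof
  fix w
  interpret contact_vector_space "apply1 (\<kappa> c x)" "apply2 (ext_deriv 1 \<kappa> c x)" "\<xi> c x" "\<phi> c x" "gram g c x"
    "contact_volume \<kappa> c x frame" by (rule contact_vector_space[OF c x])
  let ?B = "op_D1 \<xi> \<kappa> g A"
  let ?W = "apply2 (ext_deriv 1 \<kappa> c x)"
  note B = op_D1_linear[OF c x]
  obtain u where u: "\<And>v. apply1 (?B c x) v = u \<bullet> (gram g c x *v v)" using ex_metric_dual[OF B(2)] by blast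
  have Bu: "?B c x w = u \<bullet> (gram g c x *v w 0)" for w
    using B(1) unfolding multilinear_1 by (simp add: u)
  \<comment> \<open>The dual form is horizontal, so g(u, \<xi>) = 0, and this number is
    \<kappa>(u).\<close>
  have ku: "apply1 (\<kappa> c x) u = 0"
    using B(3) u[of "\<xi> c x"] G[of u "\<xi> c x"] by (simp add: kR JR linear_0[OF bilinear_altD(2)[OF W]])
  note neg1 = linear_neg[OF bilinear_altD(1)[OF W]] and neg2 = linear_neg[OF bilinear_altD(2)[OF W]]
  have "neg (star_H \<xi> \<kappa> g 1 ?B) c x v = (- \<phi> c x u) \<bullet> (gram g c x *v v 0)" for v
  proof -
    have "neg (star_H \<xi> \<kappa> g 1 ?B) c x v = - ?W u (v 0)"
      unfolding neg_def star_H_form[where b = ?B, OF c x Bu] ..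
    also have "\<dots> = ?W (v 0) u" using bilinear_alt_swap[OF W, of "v 0" u] by simp
    also have "\<dots> = - (v 0 \<bullet> (gram g c x *v \<phi> c x u))"
      by (simp add: G kJ[OF ku] JJ[OF ku] neg2)
    also have "\<dots> = (- \<phi> c x u) \<bullet> (gram g c x *v v 0)"
      by (simp add: G_commute[of "v 0"])
    finally show ?thesis .
  qed
  then have "star_H \<xi> \<kappa> g 1 (neg (star_H \<xi> \<kappa> g 1 ?B)) c x w = ?W (- \<phi> c x u) (w 0)"
    by (rule star_H_form[OF c x])
  also have "\<dots> = ?W (w 0) (\<phi> c x u)"
    using bilinear_alt_swap[OF W, of "\<phi> c x u" "w 0"] by (simp add: neg1)
  also have "\<dots> = w 0 \<bullet> (gram g c x *v u)" by (simp add: G ku)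
  also have "\<dots> = ?B c x w" by (simp add: Bu G_commute[of "w 0"])
  finally show "star_H \<xi> \<kappa> g 1 (neg (star_H \<xi> \<kappa> g 1 ?B)) c x w = ?B c x w" .
qed

definition \<eta> :: "'a tensor" where
  "\<eta> = (\<lambda>c x v. F c x * wedge 1 1 \<kappa> A c x v)"

lemma \<eta>: "diff_form \<A> 2 \<eta>"
  unfolding \<eta>_def by (rule diff_form_2_scale[OF diff_form_wedge_1_1[OF \<kappa> A] F_smooth F_transition])

text \<open>The Leibniz rule d(F \<kappa> \<and> A) = dF \<and> \<kappa> \<and> A + F (d\<kappa>
  \<and> A - \<kappa> \<and> dA), evaluated on the coordinate frame, where d\<kappa> \<and> A = A
  \<and> d\<kappa>.\<close>

lemma ext_deriv_\<eta>:
  assumes c: "c \<in> \<A>" and x: "x \<in> img c"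
  defines "f \<equiv> frechet_derivative (F c) (at x)" and "k \<equiv> apply1 (\<kappa> c x)" and "a \<equiv> apply1 (A c x)"
    and "W \<equiv> apply2 (ext_deriv 1 \<kappa> c x)" and "Z \<equiv> apply2 (ext_deriv 1 A c x)"
  shows "ext_deriv 2 \<eta> c x frame =
    f e1 * (k e2 * a e3 - k e3 * a e2) + f e2 * (k e3 * a e1 - k e1 * a e3) + f e3 * (k e1 * a e2 - k e2 * a e1) +
    F c x * ((a e1 * W e2 e3 + a e2 * W e3 e1 + a e3 * W e1 e2) - (k e1 * Z e2 e3 + k e2 * Z e3 e1 + k e3 * Z e1 e2))"
proof -
  let ?Dk = "\<lambda>u. frechet_derivative (\<lambda>y. apply1 (\<kappa> c y) u) (at x)"
  let ?Da = "\<lambda>u. frechet_derivative (\<lambda>y. apply1 (A c y) u) (at x)"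
  note Dk = smooth_on_has_derivative[OF diff_form_1_smooth[OF \<kappa> c] x]
  note Da = smooth_on_has_derivative[OF diff_form_1_smooth[OF A c] x]
  have "((\<lambda>y. apply2 (\<eta> c y) u v) has_derivative (\<lambda>w.
      F c x * (k u * ?Da v w + ?Dk u w * a v - (k v * ?Da u w + ?Dk v w * a u)) + f w * (k u * a v - k v * a u))) (at x)" for u v
    unfolding k_def a_def f_def
  proof (rule has_derivative_transform_within_open[OF has_derivative_mult[OF smooth_on_has_derivative[OF F_smooth[OF c] x]
          has_derivative_diff[OF has_derivative_mult[OF Dk Da] has_derivative_mult[OF Dk Da]]] open_img[OF c] x])
    fix y assume y: "y \<in> img c"
    show "F c y * (apply1 (\<kappa> c y) u * apply1 (A c y) v - apply1 (\<kappa> c y) v * apply1 (A c y) u) = apply2 (\<eta> c y) u v"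
      unfolding apply2_def \<eta>_def
        wedge_1_1[where \<alpha> = \<kappa> and \<beta> = A and c = c and x = y, OF diff_formD(1)[OF \<kappa> c y] diff_formD(1)[OF A c y]]
      by simp
  qed
  from frechet_derivative_at[OF this, symmetric]
  have D: "frechet_derivative (\<lambda>y. apply2 (\<eta> c y) u v) (at x) = (\<lambda>w.
      F c x * (k u * ?Da v w + ?Dk u w * a v - (k v * ?Da u w + ?Dk v w * a u)) + f w * (k u * a v - k v * a u))" for u v .
  have WZ: "W u v = ?Dk v u - ?Dk u v" "Z u v = ?Da v u - ?Da u v" for u v
    unfolding W_def Z_def apply2_def ext_deriv_1[OF \<kappa> c x] ext_deriv_1[OF A c x] by simp_all
  show ?thesis unfolding ext_deriv_2_frame[OF \<eta> c x] D WZ by (simp add: algebra_simps)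
qed

text \<open>The common integrand in the form A \<and> \<kappa> \<and> D1 A, which is literally what
  the usual inner product produces; moving \<kappa> to the front costs a sign.\<close>

definition Q :: "'a tensor" where
  "Q = wedge 1 2 A (op_D \<xi> \<kappa> g A)"

text \<open>The equations are stated for frame values because the integral reads only these. They
  follow from three pointwise relations between three-forms, of which \<open>H2\<close> and
  \<open>H3\<close> are checked by contraction with \<xi>.\<close>

lemma Q_frame:
  assumes c: "c \<in> \<A>" and x: "x \<in> img c"
  shows "Q c x frame = wedge 1 2 A (ext_deriv 1 A) c x frame
    - square_quotient (wedge 1 2 \<kappa> (ext_deriv 1 A)) (contact_volume \<kappa>) c x frame
    - ext_deriv 2 \<eta> c x frame"
    and "wedge 1 2 \<kappa> (wedge 1 1 A (op_D1 \<xi> \<kappa> g A)) c x frame = - Q c x frame"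
proof -
  interpret contact_vector_space "apply1 (\<kappa> c x)" "apply2 (ext_deriv 1 \<kappa> c x)" "\<xi> c x" "\<phi> c x" "gram g c x"
    "contact_volume \<kappa> c x frame" by (rule contact_vector_space[OF c x])
  note contact = k kR W WR m_nonzero
  define k where "k = apply1 (\<kappa> c x)"
  define a where "a = apply1 (A c x)"
  define W where "W = apply2 (ext_deriv 1 \<kappa> c x)"
  define Z where "Z = apply2 (ext_deriv 1 A c x)"
  define B where "B = apply1 (op_D1 \<xi> \<kappa> g A c x)"
  define f where "f = frechet_derivative (F c) (at x)"
  define l where "l = Z (\<xi> c x)"
  define m where "m = contact_volume \<kappa> c x frame"
  note defs = k_def[symmetric] a_def[symmetric] W_def[symmetric] Z_def[symmetric] B_def[symmetric] f_def[symmetric]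
    l_def[symmetric] m_def[symmetric]
  have k: "linear k" "k (\<xi> c x) = 1" and W: "bilinear_alt W" "\<And>v. W (\<xi> c x) v = 0" and m: "m \<noteq> 0"
    using contact unfolding defs by blast+
  have a: "linear a" "a (\<xi> c x) = 0" unfolding a_def by (rule diff_form_1_linear(1)[OF A c x], rule A_reeb[OF c x])
  have Z: "bilinear_alt Z" unfolding Z_def by (rule diff_form_2_bilinear(1)[OF dA c x])
  have l: "linear l" unfolding l_def by (rule bilinear_altD(2)[OF Z])
  have B: "linear B" unfolding B_def by (rule op_D1_linear(2)[OF c x])
  have R: "\<xi> c x \<noteq> 0" using k linear_0[OF k(1)] by auto
  have Beq: "B u = l u + f u - k u * f (\<xi> c x)" for u
    unfolding B_def apply1_def[of "op_D1 _ _ _ _ _ _"] op_D1_eq[OF c x] unfolding defs ..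
  have H1: "k e1 * Z e2 e3 + k e2 * Z e3 e1 + k e3 * Z e1 e2 = F c x * m"
    using m wedge_1_2_frame[OF \<kappa> dA c x] unfolding F_def defs by simp
  \<comment> \<open>A \<and> d\<kappa> = 0, since both factors are annihilated by \<xi>.\<close>
  have H2: "a e1 * W e2 e3 + a e2 * W e3 e1 + a e3 * W e1 e2 = 0"
  proof (rule trilinear_alt_eq_0[OF trilinear_alt_wedge_1_2[OF a(1) W(1)] R])
    show "a (\<xi> c x) * W v w + a v * W w (\<xi> c x) + a w * W (\<xi> c x) v = 0" for v w
      using bilinear_alt_swap[OF W(1), of w "\<xi> c x"] by (simp add: a W)
  qed
  \<comment> \<open>A \<and> dA + \<kappa> \<and> A \<and> l = 0 with l the contraction of dA by
    \<xi>. As A(\<xi>) = 0 and l(\<xi>) = 0, contraction with \<xi> gives -A \<and> l from the first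
    term and A \<and> l from the second.\<close>
  have H3: "(a e1 * Z e2 e3 + a e2 * Z e3 e1 + a e3 * Z e1 e2) +
      (k e1 * (a e2 * l e3 - a e3 * l e2) + k e2 * (a e3 * l e1 - a e1 * l e3) + k e3 * (a e1 * l e2 - a e2 * l e1)) = 0"
  proof -
    have t: "trilinear_alt (\<lambda>u v w. (a u * Z v w + a v * Z w u + a w * Z u v) +
        (k u * (a v * l w - a w * l v) + k v * (a w * l u - a u * l w) + k w * (a u * l v - a v * l u)))"
      using trilinear_alt_wedge_1_2[OF a(1) Z] trilinear_alt_wedge_1_2[OF k(1) bilinear_alt_wedge_1_1[OF a(1) l]]
      unfolding trilinear_alt_def by (simp add: linear_compose_add)
    show ?thesis
    proof (rule trilinear_alt_eq_0[OF t R])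
      show "a (\<xi> c x) * Z v w + a v * Z w (\<xi> c x) + a w * Z (\<xi> c x) v +
        (k (\<xi> c x) * (a v * l w - a w * l v) + k v * (a w * l (\<xi> c x) - a (\<xi> c x) * l w) +
         k w * (a (\<xi> c x) * l v - a v * l (\<xi> c x))) = 0" for v w
        using bilinear_alt_swap[OF Z, of w "\<xi> c x"] bilinear_altD(3)[OF Z, of "\<xi> c x"] by (simp add: a k l_def)
    qed
  qed
  have DT: "multilinear 2 (op_D \<xi> \<kappa> g A c x)" "alternating 2 (op_D \<xi> \<kappa> g A c x)"
    "apply2 (op_D \<xi> \<kappa> g A c x) = (\<lambda>u v. k u * B v - k v * B u)"
  proof -
    show *: "apply2 (op_D \<xi> \<kappa> g A c x) = (\<lambda>u v. k u * B v - k v * B u)"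
      by (intro ext) (simp add: apply2_def op_D_eq[OF c x] k_def B_def)
    show "multilinear 2 (op_D \<xi> \<kappa> g A c x)" "alternating 2 (op_D \<xi> \<kappa> g A c x)"
      using alternating_form_2[of "op_D \<xi> \<kappa> g A c x"] bilinear_alt_wedge_1_1[OF k(1) B] *
      by (simp_all add: op_D_eq[OF c x] k_def B_def)
  qed
  have Q: "Q c x frame = a e1 * (k e2 * B e3 - k e3 * B e2) + a e2 * (k e3 * B e1 - k e1 * B e3) + a e3 * (k e1 * B e2 - k e2 * B e1)"
    unfolding Q_def wedge_1_2[where \<alpha> = A and \<beta> = "op_D \<xi> \<kappa> g A" and c = c and x = x, OF diff_formD(1)[OF A c x] DT(1,2)] DT(3) defs
    by simp
  have AdA: "wedge 1 2 A (ext_deriv 1 A) c x frame = a e1 * Z e2 e3 + a e2 * Z e3 e1 + a e3 * Z e1 e2"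
    unfolding wedge_1_2_frame[OF A dA c x] defs ..
  have sq: "square_quotient (wedge 1 2 \<kappa> (ext_deriv 1 A)) (contact_volume \<kappa>) c x frame = F c x * (F c x * m)"
    unfolding square_quotient_def F_def[symmetric] m_def by (simp add: power2_eq_square)
  \<comment> \<open>By \<open>H1\<close> and \<open>H2\<close> the part of d\<eta> without dF is
    -F^2 times the volume and cancels the square term. The \<kappa>-component of \<open>B\<close>
    disappears under the wedge with \<kappa>, and \<open>H3\<close> accounts for the Lie
    derivative.\<close>
  show "Q c x frame = wedge 1 2 A (ext_deriv 1 A) c x frame
    - square_quotient (wedge 1 2 \<kappa> (ext_deriv 1 A)) (contact_volume \<kappa>) c x frame
    - ext_deriv 2 \<eta> c x frame"
    unfolding Q AdA sq ext_deriv_\<eta>[OF c x, unfolded defs] H1 H2 Beq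
    using H3 by (simp add: algebra_simps)
  have BT: "multilinear 2 (wedge 1 1 A (op_D1 \<xi> \<kappa> g A) c x)" "alternating 2 (wedge 1 1 A (op_D1 \<xi> \<kappa> g A) c x)"
    "apply2 (wedge 1 1 A (op_D1 \<xi> \<kappa> g A) c x) = (\<lambda>u v. a u * B v - a v * B u)"
  proof -
    have eq: "wedge 1 1 A (op_D1 \<xi> \<kappa> g A) c x v = a (v 0) * B (v 1) - a (v 1) * B (v 0)" for v
      unfolding a_def B_def by (rule wedge_1_1[where \<alpha> = A and \<beta> = "op_D1 \<xi> \<kappa> g A" and c = c and x = x, OF diff_formD(1)[OF A c x] op_D1_linear(1)[OF c x]])
    show *: "apply2 (wedge 1 1 A (op_D1 \<xi> \<kappa> g A) c x) = (\<lambda>u v. a u * B v - a v * B u)"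
      by (intro ext) (simp add: apply2_def eq)
    show "multilinear 2 (wedge 1 1 A (op_D1 \<xi> \<kappa> g A) c x)" "alternating 2 (wedge 1 1 A (op_D1 \<xi> \<kappa> g A) c x)"
      using alternating_form_2[of "wedge 1 1 A (op_D1 \<xi> \<kappa> g A) c x"] bilinear_alt_wedge_1_1[OF a(1) B] * eq
      by simp_all
  qed
  show "wedge 1 2 \<kappa> (wedge 1 1 A (op_D1 \<xi> \<kappa> g A)) c x frame = - Q c x frame"
    unfolding Q wedge_1_2[where \<alpha> = \<kappa> and \<beta> = "wedge 1 1 A (op_D1 \<xi> \<kappa> g A)" and c = c and x = x, OF diff_formD(1)[OF \<kappa> c x] BT(1,2)] BT(3) defs
    by (simp add: algebra_simps)
qed

lemma wedge_cong: "\<beta> c x = \<beta>' c x \<Longrightarrow> wedge k l \<alpha> \<beta> c x v = wedge k l \<alpha> \<beta>' c x v"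
  by (simp add: wedge_def)

text \<open>The pointwise identity for \<open>Q\<close> is integrated and the exact term removed by
  Stokes' theorem. The smoothness facts \<open>s1\<close> to \<open>s3\<close> make the integral
  additive.\<close>

lemma action_eq: "action X \<A> \<kappa> A = integral_over X \<A> (contact_volume \<kappa>) Q"
proof -
  let ?I = "integral_over X \<A> (contact_volume \<kappa>)"
  let ?sq = "square_quotient (wedge 1 2 \<kappa> (ext_deriv 1 A)) (contact_volume \<kappa>)"
  have s1: "smooth_on (img c) (\<lambda>x. wedge 1 2 A (ext_deriv 1 A) c x frame)" if c: "c \<in> \<A>" for c
    by (rule diff_form_smooth[OF diff_form_wedge_1_2[OF A dA] c])
  have s2: "smooth_on (img c) (\<lambda>x. neg ?sq c x frame)" if c: "c \<in> \<A>" for c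
  proof -
    have "smooth_on (img c) (\<lambda>x. (-1) * (F c x * F c x * contact_volume \<kappa> c x frame))"
      by (intro smooth_on_mult open_img[OF c] smooth_on_const F_smooth[OF c] diff_form_smooth[OF \<mu> c])
    moreover have "(\<lambda>x. (-1) * (F c x * F c x * contact_volume \<kappa> c x frame)) = (\<lambda>x. neg ?sq c x frame)"
      unfolding neg_def square_quotient_def F_def power2_eq_square by simp
    ultimately show ?thesis by (simp only:)
  qed
  have s3: "smooth_on (img c) (\<lambda>x. neg (ext_deriv 2 \<eta>) c x frame)" if c: "c \<in> \<A>" for c
    unfolding neg_def by (rule smooth_on_linear[OF open_img[OF c] bounded_linear_minus[OF bounded_linear_ident] smooth_on_ext_deriv_2_frame[OF \<eta> c]])
  have "?I Q = ?I (\<lambda>c x v. wedge 1 2 A (ext_deriv 1 A) c x v + (neg ?sq c x v + neg (ext_deriv 2 \<eta>) c x v))"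
    by (rule integral_over_cong) (simp add: Q_frame(1) neg_def)
  also have "\<dots> = ?I (wedge 1 2 A (ext_deriv 1 A)) + ?I (\<lambda>c x v. neg ?sq c x v + neg (ext_deriv 2 \<eta>) c x v)"
    by (rule integral_over_add[where \<omega> = "wedge 1 2 A (ext_deriv 1 A)", OF s1]) (assumption, rule smooth_on_add[OF open_img s2 s3])
  also have "?I (\<lambda>c x v. neg ?sq c x v + neg (ext_deriv 2 \<eta>) c x v) = ?I (neg ?sq) + ?I (neg (ext_deriv 2 \<eta>))"
    by (rule integral_over_add[where \<omega> = "neg ?sq" and \<omega>' = "neg (ext_deriv 2 \<eta>)", OF s2 s3])
  finally show ?thesis
    by (simp add: integral_over_neg stokes[OF \<eta>] action_def contact_integral_def)
qed

lemma inner_L2_eq: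
  "inner_L2 X \<A> \<kappa> g A (neg (star \<kappa> g 2 (op_D \<xi> \<kappa> g A))) = integral_over X \<A> (contact_volume \<kappa>) Q"
  unfolding inner_L2_def contact_integral_def Q_def
  by (rule integral_over_cong, rule wedge_cong, rule star_star_op_D)

text \<open>The sign (-1)^1 in the definition of this inner product cancels the one from moving
  \<kappa> past A.\<close>

lemma inner_contact_eq:
  "inner_contact X \<A> \<xi> \<kappa> g 1 A (neg (star_H \<xi> \<kappa> g 1 (op_D1 \<xi> \<kappa> g A))) = integral_over X \<A> (contact_volume \<kappa>) Q"
proof -
  let ?I = "integral_over X \<A> (contact_volume \<kappa>)"
  have "?I (wedge 1 2 \<kappa> (wedge 1 1 A (star_H \<xi> \<kappa> g 1 (neg (star_H \<xi> \<kappa> g 1 (op_D1 \<xi> \<kappa> g A)))))) = ?I (neg Q)"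
  proof (rule integral_over_cong)
    fix c x assume cx: "c \<in> \<A>" "x \<in> img c"
    show "wedge 1 2 \<kappa> (wedge 1 1 A (star_H \<xi> \<kappa> g 1 (neg (star_H \<xi> \<kappa> g 1 (op_D1 \<xi> \<kappa> g A))))) c x frame = neg Q c x frame"
    proof -
      have "wedge 1 1 A (star_H \<xi> \<kappa> g 1 (neg (star_H \<xi> \<kappa> g 1 (op_D1 \<xi> \<kappa> g A)))) c x = wedge 1 1 A (op_D1 \<xi> \<kappa> g A) c x"
        by (rule ext, rule wedge_cong, rule star_H_star_H_op_D1[OF cx])
      then have "wedge 1 2 \<kappa> (wedge 1 1 A (star_H \<xi> \<kappa> g 1 (neg (star_H \<xi> \<kappa> g 1 (op_D1 \<xi> \<kappa> g A))))) c x frame =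
          wedge 1 2 \<kappa> (wedge 1 1 A (op_D1 \<xi> \<kappa> g A)) c x frame"
        by (rule wedge_cong)
      then show ?thesis by (simp only: Q_frame(2)[OF cx] neg_def)
    qed
  qed
  \<comment> \<open>The second factor of \<open>inner_contact\<close> has degree
    \<open>2 - l\<close>, here 1, and the wedge must be recognised as
    \<open>wedge 1 1\<close>.\<close>
  moreover have "2 - 1 = (1::nat)" by simp
  ultimately show ?thesis unfolding inner_contact_def contact_integral_def by (simp only: integral_over_neg) simp
qed

end

theorem proposition17:
  fixes X :: "'a topology" and \<A> :: "'a chart set"
    and \<phi> :: "'a endo" and \<xi> :: "'a vfield" and \<kappa> g :: "'a tensor"
  assumes "closed_three_manifold X \<A>"
    and "K_contact \<A> \<phi> \<xi> \<kappa> g"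
    and "quasi_regular X \<A> \<xi>"
  shows "\<forall>A. horizontal_form \<A> \<xi> 1 A \<longrightarrow>
      action X \<A> \<kappa> A = inner_L2 X \<A> \<kappa> g A (neg (star \<kappa> g 2 (op_D \<xi> \<kappa> g A))) \<and>
      action X \<A> \<kappa> A =
        inner_contact X \<A> \<xi> \<kappa> g 1 A (neg (star_H \<xi> \<kappa> g 1 (op_D1 \<xi> \<kappa> g A)))"
proof (intro allI impI)
  fix A assume "horizontal_form \<A> \<xi> 1 A"
  then interpret horizontal_one_form X \<A> \<phi> \<xi> \<kappa> g A
    using assms(1,2) by unfold_locales (simp_all add: closed_three_manifold_def)
  show "action X \<A> \<kappa> A = inner_L2 X \<A> \<kappa> g A (neg (star \<kappa> g 2 (op_D \<xi> \<kappa> g A))) \<and>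
      action X \<A> \<kappa> A = inner_contact X \<A> \<xi> \<kappa> g 1 A (neg (star_H \<xi> \<kappa> g 1 (op_D1 \<xi> \<kappa> g A)))"
    using action_eq inner_L2_eq inner_contact_eq by simp
qed

end
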